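(* Let $N\ge 2$, $p>1$, let $A=\{x\in\mathbb{R}^N : a<|x|<b\}$ with $0<a<b<\infty$, let $m$ be a positive integer, and let $v_p$ be a radial solution with $m$ nodal zones of $$-\Delta v=|v|^{p-1}v\ \text{ in } A,\qquad v=0\ \text{ on }\partial A.$$ Then $v_p$ is radially nondegenerate, and it is degenerate if and only if $$\nu_l(p)=-j(N-2+j)\quad\text{for some } l\in\{1,\dots,m\} \text{ and some integer } j\ge 2,$$ or $$\nu_m(p)=-(N-1),$$ where $\nu_l(p)$ denotes the $l$-th eigenvalue of the singular-weight Sturm–Liouville problem given in the context.
   Context: A radial solution $v=v(r)$, $r=|x|$, has $m$ nodal zones if the set $\{x\in A: v(x)\neq 0\}$ has exactly $m$ connected components. The solution $v_p$ is degenerate if the linearized problem $-\Delta w=p|v_p|^{p-1}w$ in $A$, $w=0$ on $\partial A$, has a nontrivial solution $w$; it is nondegenerate otherwise. It is radially nondegenerate if this linearized problem has no nontrivial radial solution. The numbers $\nu_1(p)<\nu_2(p)<\cdots$ are the (simple) eigenvalues $\nu$ of $$-\phi''-\frac{N-1}{r}\phi'=\Big(p|v_p|^{p-1}+\frac{\nu}{r^2}\Big)\phi\ \text{ for } a<r<b,\qquad \phi(a)=\phi(b)=0,$$ listed in increasing order. *)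

theory Defs
  imports "HOL-Analysis.Analysis"
begin

definition partial_deriv :: "'a::euclidean_space \<Rightarrow> ('a \<Rightarrow> real) \<Rightarrow> 'a \<Rightarrow> real" where
  "partial_deriv i f x = frechet_derivative f (at x) i"

definition laplacian :: "('a::euclidean_space \<Rightarrow> real) \<Rightarrow> 'a \<Rightarrow> real" where
  "laplacian f x = (\<Sum>i\<in>Basis. partial_deriv i (partial_deriv i f) x)"

text \<open>Intended for open \<open>S\<close>, where the derivatives within \<open>S\<close> are the full derivatives.\<close>

definition C2_on :: "'a::euclidean_space set \<Rightarrow> ('a \<Rightarrow> real) \<Rightarrow> bool" where
  "C2_on S f \<longleftrightarrow>
     f differentiable_on S \<and>
     (\<forall>i\<in>Basis. partial_deriv i f differentiable_on S) \<and>
     (\<forall>i\<in>Basis. \<forall>j\<in>Basis. continuous_on S (partial_deriv i (partial_deriv j f)))"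

definition annulus :: "real \<Rightarrow> real \<Rightarrow> 'a::euclidean_space set" where
  "annulus a b = {x. a < norm x \<and> norm x < b}"

text \<open>Classical solutions of the Dirichlet problem \<open>-\<Delta> f = g\<close> in \<open>A\<close>, \<open>f = 0\<close> on the boundary;
  \<open>g\<close> may depend on \<open>f\<close>.\<close>

definition dirichlet_solution ::
    "'a::euclidean_space set \<Rightarrow> ('a \<Rightarrow> real) \<Rightarrow> ('a \<Rightarrow> real) \<Rightarrow> bool" where
  "dirichlet_solution A g f \<longleftrightarrow>
     C2_on A f \<and> continuous_on (closure A) f \<and>
     (\<forall>x\<in>A. - laplacian f x = g x) \<and> (\<forall>x\<in>frontier A. f x = 0)"

definition lane_emden_solution ::
    "real \<Rightarrow> 'a::euclidean_space set \<Rightarrow> ('a \<Rightarrow> real) \<Rightarrow> bool" where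
  "lane_emden_solution p A v \<longleftrightarrow>
     dirichlet_solution A (\<lambda>x. \<bar>v x\<bar> powr (p - 1) * v x) v"

definition has_profile_on ::
    "'a::euclidean_space set \<Rightarrow> ('a \<Rightarrow> real) \<Rightarrow> (real \<Rightarrow> real) \<Rightarrow> bool" where
  "has_profile_on S v u \<longleftrightarrow> (\<forall>x\<in>S. v x = u (norm x))"

definition radial_on :: "'a::euclidean_space set \<Rightarrow> ('a \<Rightarrow> real) \<Rightarrow> bool" where
  "radial_on S v \<longleftrightarrow> (\<exists>u. has_profile_on S v u)"

text \<open>An infinite number of components has cardinality \<open>0\<close> here, so this is meaningful
  for positive \<open>m\<close>.\<close>

definition has_nodal_zones :: "'a::euclidean_space set \<Rightarrow> ('a \<Rightarrow> real) \<Rightarrow> nat \<Rightarrow> bool" where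
  "has_nodal_zones A v m \<longleftrightarrow> card (components {x\<in>A. v x \<noteq> 0}) = m"

definition linearized_solution ::
    "real \<Rightarrow> 'a::euclidean_space set \<Rightarrow> ('a \<Rightarrow> real) \<Rightarrow> ('a \<Rightarrow> real) \<Rightarrow> bool" where
  "linearized_solution p A v w \<longleftrightarrow>
     dirichlet_solution A (\<lambda>x. p * \<bar>v x\<bar> powr (p - 1) * w x) w"

definition degenerate :: "real \<Rightarrow> 'a::euclidean_space set \<Rightarrow> ('a \<Rightarrow> real) \<Rightarrow> bool" where
  "degenerate p A v \<longleftrightarrow> (\<exists>w. linearized_solution p A v w \<and> (\<exists>x\<in>A. w x \<noteq> 0))"

definition radially_nondegenerate ::
    "real \<Rightarrow> 'a::euclidean_space set \<Rightarrow> ('a \<Rightarrow> real) \<Rightarrow> bool" where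
  "radially_nondegenerate p A v \<longleftrightarrow>
     \<not> (\<exists>w. linearized_solution p A v w \<and> radial_on (closure A) w \<and> (\<exists>x\<in>A. w x \<noteq> 0))"

text \<open>Eigenvalues of the one-dimensional problem for the radial profile \<open>u\<close> in dimension \<open>N\<close>.
  For continuous \<open>u\<close> the equation forces \<open>\<phi>''\<close> to be continuous, so \<open>\<phi>\<close> is of class \<open>C\<^sup>2\<close> in the
  open interval.\<close>

definition radial_eigenvalue ::
    "nat \<Rightarrow> real \<Rightarrow> real \<Rightarrow> real \<Rightarrow> (real \<Rightarrow> real) \<Rightarrow> real \<Rightarrow> bool" where
  "radial_eigenvalue N p a b u \<nu> \<longleftrightarrow>
     (\<exists>\<phi> \<phi>' \<phi>''.
        continuous_on {a..b} \<phi> \<and> \<phi> a = 0 \<and> \<phi> b = 0 \<and> (\<exists>r\<in>{a<..<b}. \<phi> r \<noteq> 0) \<and>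
        (\<forall>r\<in>{a<..<b}.
           (\<phi> has_real_derivative \<phi>' r) (at r) \<and>
           (\<phi>' has_real_derivative \<phi>'' r) (at r) \<and>
           - \<phi>'' r - (real N - 1) / r * \<phi>' r
             = (p * \<bar>u r\<bar> powr (p - 1) + \<nu> / r\<^sup>2) * \<phi> r))"

text \<open>\<open>\<nu>\<close> is the \<open>l\<close>-th eigenvalue (counting from \<open>1\<close>) in increasing order. A relation is used
  rather than a function of \<open>l\<close>, so that nothing is said about \<open>\<nu>\<^sub>l\<close> unless an \<open>l\<close>-th eigenvalue
  exists.\<close>

definition nth_radial_eigenvalue ::
    "nat \<Rightarrow> real \<Rightarrow> real \<Rightarrow> real \<Rightarrow> (real \<Rightarrow> real) \<Rightarrow> nat \<Rightarrow> real \<Rightarrow> bool" where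
  "nth_radial_eigenvalue N p a b u l \<nu> \<longleftrightarrow>
     radial_eigenvalue N p a b u \<nu> \<and>
     finite {\<mu>. radial_eigenvalue N p a b u \<mu> \<and> \<mu> \<le> \<nu>} \<and>
     card {\<mu>. radial_eigenvalue N p a b u \<mu> \<and> \<mu> \<le> \<nu>} = l"

end

theory Submission
  imports Defs
begin

text \<open>
  Write \<open>N\<close> for the dimension and \<open>u\<close> for the radial profile. Expanding a solution \<open>w\<close> of the linearized problem
  in spherical harmonics turns it into radial functions \<open>h\<close> with \<open>h(a) = h(b) = 0\<close> and
  \<open>-h'' - (N-1)/r h' = (p|u|\<^sup>p\<^sup>-\<^sup>1 + \<nu>/r\<^sup>2) h\<close>, where \<open>\<nu> = -k(N-2+k)\<close> and \<open>k\<close> is the degree of the harmonic;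
  conversely such an \<open>h\<close> times a harmonic of degree \<open>k\<close> solves the linearized problem. So degeneracy means
  that some number \<open>-k(N-2+k)\<close> is a radial eigenvalue, and three facts about radial eigenvalues remain:
  \<open>0\<close> is never one (\<open>k = 0\<close>), every negative one is among the first \<open>m\<close>, and if \<open>-(N-1)\<close> is one
  (\<open>k = 1\<close>) then it is the \<open>m\<close>-th.

  These come from Sturm comparison with two explicit solutions. Dilation invariance of the equation gives
  \<open>z = r u' + 2/(p-1) u\<close>, which solves the radial equation with \<open>\<nu> = 0\<close>; translation invariance gives
  \<open>u'\<close>, which solves it with \<open>\<nu> = -(N-1)\<close>. In the variable \<open>log r\<close> the function \<open>r\<^sup>2\<^sup>/\<^sup>(\<^sup>p\<^sup>-\<^sup>1\<^sup>) u\<close> satisfies an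
  autonomous damped oscillator equation. Its energy is monotone and is positive at both ends, hence positive
  throughout, and this forces \<open>z\<close> to have at most one zero in each nodal interval (\<open>z_slope\<close>,
  \<open>z_zeros_card\<close>). Thus \<open>z\<close> has at most \<open>m\<close> zeros. The \<open>l\<close>-th eigenfunction has at least \<open>l + 1\<close> zeros in \<open>[a,b]\<close>, and
  \<open>z\<close> vanishes between any two of them if \<open>\<nu>\<^sub>l < 0\<close>; so \<open>l \<le> m\<close>. An eigenfunction for \<open>\<nu> = 0\<close> oscillates
  faster than \<open>u\<close>, so it has at least \<open>m\<close> interior zeros and two boundary zeros, which would give \<open>z\<close> too many zeros
  (\<open>zero_not_eigenvalue\<close>). Finally \<open>u'\<close> has a zero in each nodal interval; if \<open>-(N-1)\<close> is an eigenvalue, its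
  eigenfunction has a zero between any two of these, so at least \<open>m - 1\<close> interior zeros, and a shooting
  argument with the Pruefer angle produces \<open>m - 1\<close> smaller eigenvalues
  (\<open>eigenvalues_below_from_zeros\<close>, \<open>translation_eigenvalue_index\<close>).

  The expansion in spherical harmonics is replaced by moments against homogeneous polynomials \<open>f\<close> over the sphere.
  The moment of \<open>w\<close> against \<open>f\<close> of degree \<open>k\<close> satisfies the radial equation with \<open>\<nu> = -k(N-2+k)\<close> up to a
  forcing term which is the moment against the Laplacian of \<open>f\<close>, of degree \<open>k-2\<close> (\<open>sphere_moment_ode\<close>). In
  the least degree in which some moment is not identically zero the forcing vanishes, and that moment is an
  eigenfunction. Such a degree exists because polynomials are dense on the sphere
  (\<open>hpoly_moments_complete\<close>).
\<close>

section \<open>Sturm comparison for second-order linear equations\<close>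

text \<open>A first return to zero would have to happen from above, against the positive slope there.\<close>
lemma crosses_upwards_once:
  fixes f :: "real \<Rightarrow> real"
  assumes st: "s < t" and cont: "continuous_on {s..t} f" and fs: "f s \<ge> 0"
    and up: "\<And>x. x \<in> {s..t} \<Longrightarrow> f x = 0 \<Longrightarrow> \<exists>d>0. (f has_real_derivative d) (at x within {s..t})"
  shows "f t > 0"
proof (rule ccontr)
  assume "\<not> f t > 0"
  then have ft: "f t \<le> 0" by simp
  have "\<exists>x\<in>{s..<t}. f x > 0"
  proof (cases "f s > 0")
    case False
    with fs up[of s] st obtain d where "d > 0" "(f has_real_derivative d) (at s within {s..t})"
      by auto
    then obtain e where e: "e > 0" "\<And>h. h > 0 \<Longrightarrow> s + h \<in> {s..t} \<Longrightarrow> h < e \<Longrightarrow> f s < f (s + h)"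
      using has_real_derivative_pos_inc_right by blast
    define h where "h = min (e/2) ((t - s)/2)"
    have "h > 0" "h < e" "s + h < t" using e st by (auto simp: h_def min_def field_simps)
    with e(2)[of h] fs show ?thesis by (intro bexI[of _ "s + h"]) auto
  qed (use st in auto)
  then obtain x where x: "s \<le> x" "x < t" "f x > 0" by auto
  define S where "S = {y \<in> {x..t}. f y \<le> 0}"
  have contx: "continuous_on {x..t} f" using continuous_on_subset[OF cont] x by auto
  have "closed S" unfolding S_def
    using continuous_closed_preimage[OF contx, of "{..0}"] by (simp add: vimage_def Collect_conj_eq[symmetric] Int_def)
  moreover have "t \<in> S" using x ft by (auto simp: S_def)
  moreover have bdd: "bdd_below S" by (auto simp: S_def intro: bdd_belowI[of _ x])
  ultimately have tau: "Inf S \<in> S" by (intro closed_contains_Inf) auto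
  define \<tau> where "\<tau> = Inf S"
  have t1: "\<tau> \<in> {x..t}" "f \<tau> \<le> 0" using tau by (auto simp: S_def \<tau>_def)
  have t2: "f y > 0" if "y \<in> {x..<\<tau>}" for y
    using that t1 cInf_lower[OF _ bdd, of y] unfolding \<tau>_def[symmetric] by (force simp: S_def)
  have xt: "x < \<tau>" using t1 x by (cases "x = \<tau>") auto
  have "f \<tau> \<ge> 0"
  proof (rule ccontr)
    assume neg: "\<not> f \<tau> \<ge> 0"
    have "continuous_on {x..\<tau>} f" using continuous_on_subset[OF contx] t1 by auto
    then obtain y where "x \<le> y" "y \<le> \<tau>" "f y = 0"
      using IVT2'[of f \<tau> 0 x] neg x xt by auto
    then show False using t2[of y] neg by (cases "y = \<tau>") auto
  qed
  then have f0: "f \<tau> = 0" using t1 by simp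
  obtain d where d: "d > 0" "(f has_real_derivative d) (at \<tau> within {s..t})"
    using up[of \<tau>] f0 t1 x by auto
  obtain e where e: "e > 0" "\<And>h. h > 0 \<Longrightarrow> \<tau> - h \<in> {s..t} \<Longrightarrow> h < e \<Longrightarrow> f (\<tau> - h) < f \<tau>"
    using has_real_derivative_pos_inc_left[OF d(2,1)] by blast
  define h where "h = min (e/2) (\<tau> - x)"
  have h: "h > 0" "h < e" "x \<le> \<tau> - h" using e xt by (auto simp: h_def)
  have "f (\<tau> - h) < 0" using e(2)[of h] h t1 x f0 by auto
  moreover have "f (\<tau> - h) > 0" using t2[of "\<tau> - h"] h t1 by auto
  ultimately show False by simp
qed

text \<open>The counting half of Sturm theory: \<open>k + 1\<close> points with a zero of another function in every gap give \<open>k\<close> zeros of it.\<close>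
lemma finite_gap_points:
  fixes F :: "real set"
  assumes "finite F" "card F = Suc k"
    and gap: "\<And>s t. s \<in> F \<Longrightarrow> t \<in> F \<Longrightarrow> s < t \<Longrightarrow> \<exists>z\<in>{s<..<t}. Q z"
  shows "\<exists>F'. finite F' \<and> card F' = k \<and> F' \<subseteq> {Min F<..<Max F} \<and> (\<forall>z\<in>F'. Q z)"
  using assms
proof (induction k arbitrary: F)
  case 0
  then show ?case by (intro exI[of _ "{}"]) auto
next
  case (Suc k)
  define M where "M = Max F"
  define F1 where "F1 = F - {M}"
  have ne: "F \<noteq> {}" using Suc by auto
  have MF: "M \<in> F" using Suc ne by (simp add: M_def)
  have F1: "finite F1" "card F1 = Suc k" using Suc MF by (auto simp: F1_def)
  have ne1: "F1 \<noteq> {}" using F1 by auto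
  obtain F' where F': "finite F'" "card F' = k" "F' \<subseteq> {Min F1<..<Max F1}" "\<forall>z\<in>F'. Q z"
    using Suc.IH[of F1] F1 Suc.prems(3) by (force simp: F1_def)
  have M1: "Max F1 \<in> F1" using F1 ne1 by simp
  then have lt: "Max F1 < M"
    using Suc.prems(1) by (auto simp: F1_def M_def order.strict_iff_order)
  have M1F: "Max F1 \<in> F" using M1 by (simp add: F1_def)
  have m1: "Min F1 \<ge> Min F" using F1 ne1 Suc.prems(1) by (intro Min_antimono) (auto simp: F1_def)
  obtain z where z: "z \<in> {Max F1<..<M}" "Q z" using Suc.prems(3)[OF M1F MF lt] by auto
  have "z \<notin> F'" using F' z by auto
  moreover have "Min F1 \<le> Max F1" using F1 ne1 by auto
  ultimately show ?case using F' z m1 lt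
    by (intro exI[of _ "insert z F'"]) (auto simp: M_def)
qed

text \<open>The equation \<open>(P \<phi>')' + G \<phi> = 0\<close> as a first-order system with \<open>g = P \<phi>'\<close>. One-sided derivatives at the ends of the
  interval make the initial value \<open>(\<phi>, g)\<close> at an end meaningful.\<close>
definition sl_sol :: "(real \<Rightarrow> real) \<Rightarrow> (real \<Rightarrow> real) \<Rightarrow> real \<Rightarrow> real \<Rightarrow> (real \<Rightarrow> real) \<Rightarrow> (real \<Rightarrow> real) \<Rightarrow> bool"
  where "sl_sol P G a b \<phi> g \<longleftrightarrow> (\<forall>r\<in>{a..b}.
    (\<phi> has_real_derivative g r / P r) (at r within {a..b}) \<and>
    (g has_real_derivative - (G r * \<phi> r)) (at r within {a..b}))"

lemma sl_sol_subset:
  assumes "sl_sol P G a b \<phi> g" "a \<le> s" "t \<le> b"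
  shows "sl_sol P G s t \<phi> g"
  using assms unfolding sl_sol_def
  by (auto intro!: DERIV_subset[where s="{a..b}" and t="{s..t}"])

lemma sl_sol_continuous:
  assumes "sl_sol P G a b \<phi> g"
  shows "continuous_on {a..b} \<phi>" "continuous_on {a..b} g"
  using assms unfolding sl_sol_def by (auto intro!: DERIV_continuous_on)

lemma sl_sol_wronskian:
  assumes "sl_sol P G a b \<phi> g" "sl_sol P H a b \<psi> h" "\<And>r. r \<in> {a..b} \<Longrightarrow> P r > 0" "r \<in> {a..b}"
  shows "((\<lambda>r. g r * \<psi> r - \<phi> r * h r) has_real_derivative (H r - G r) * \<phi> r * \<psi> r) (at r within {a..b})"
proof -
  have "P r \<noteq> 0" using assms(3)[OF assms(4)] by simp
  with assms(1,2,4) show ?thesis unfolding sl_sol_def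
    by (auto intro!: derivative_eq_intros simp: field_simps)
qed

text \<open>The quantity \<open>E = \<phi>\<^sup>2 + g\<^sup>2\<close> satisfies \<open>|E'| \<le> K E\<close>, so \<open>E\<close> vanishes everywhere once it vanishes somewhere.\<close>
lemma sl_sol_unique_zero:
  assumes sol: "sl_sol P G a b \<phi> g" and P: "\<And>r. r \<in> {a..b} \<Longrightarrow> P r > 0"
    and cont: "continuous_on {a..b} P" "continuous_on {a..b} G"
    and s: "s \<in> {a..b}" "\<phi> s = 0" "g s = 0" and r: "r \<in> {a..b}"
  shows "\<phi> r = 0 \<and> g r = 0"
proof -
  define q where "q r = \<bar>1 / P r - G r\<bar>" for r
  have "continuous_on {a..b} q" unfolding q_def using P
    by (intro continuous_intros cont) (metis less_irrefl)
  then have "bounded (q ` {a..b})"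
    by (intro compact_imp_bounded compact_continuous_image) auto
  then obtain K where "\<forall>x\<in>q ` {a..b}. norm x \<le> K" unfolding bounded_iff by blast
  then have K: "q r \<le> K" if "r \<in> {a..b}" for r using that by force
  define E where "E r = (\<phi> r)\<^sup>2 + (g r)\<^sup>2" for r
  have dE: "(E has_real_derivative 2 * (\<phi> r * g r * (1 / P r - G r))) (at r within {a..b})" if "r \<in> {a..b}" for r
    unfolding E_def using sol that P[OF that] unfolding sl_sol_def
    by (auto intro!: derivative_eq_intros simp: field_simps)
  have bd: "\<bar>2 * (\<phi> r * g r * (1 / P r - G r))\<bar> \<le> K * E r" if "r \<in> {a..b}" for r
  proof -
    have "\<bar>2 * (\<phi> r * g r * (1 / P r - G r))\<bar> = (2 * \<bar>\<phi> r\<bar> * \<bar>g r\<bar>) * q r"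
      by (simp add: q_def abs_mult)
    also have "2 * \<bar>\<phi> r\<bar> * \<bar>g r\<bar> \<le> E r"
      using sum_squares_bound[of "\<bar>\<phi> r\<bar>" "\<bar>g r\<bar>"] by (simp add: E_def)
    hence "(2 * \<bar>\<phi> r\<bar> * \<bar>g r\<bar>) * q r \<le> E r * K"
      using K[OF that] by (intro mult_mono) (auto simp: E_def q_def)
    finally show ?thesis by (simp add: mult.commute)
  qed
  have Es: "E s = 0" using s by (simp add: E_def)
  have "E r \<le> 0"
  proof (cases "s \<le> r")
    case True
    have "E r * exp (- K * r) \<le> E s * exp (- K * s)"
    proof (rule DERIV_nonpos_imp_decreasing_open[OF True, of "\<lambda>r. E r * exp (- K * r)"])
      fix x assume x: "s < x" "x < r"
      then have xi: "x \<in> {a..b}" "x \<in> interior {a..b}" using s r by auto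
      have "(E has_real_derivative 2 * (\<phi> x * g x * (1 / P x - G x))) (at x)"
        using dE[OF xi(1)] at_within_interior[OF xi(2)] by simp
      then have "((\<lambda>r. E r * exp (- K * r)) has_real_derivative (2 * (\<phi> x * g x * (1 / P x - G x)) - K * E x) * exp (-K * x)) (at x)"
        by (auto intro!: derivative_eq_intros simp: algebra_simps)
      moreover have "(2 * (\<phi> x * g x * (1 / P x - G x)) - K * E x) * exp (-K * x) \<le> 0"
        using bd[OF xi(1)] by (intro mult_nonpos_nonneg) auto
      ultimately show "\<exists>y. ((\<lambda>r. E r * exp (- K * r)) has_real_derivative y) (at x) \<and> y \<le> 0" by blast
    next
      show "continuous_on {s..r} (\<lambda>r. E r * exp (- K * r))" unfolding E_def
        using s r sl_sol_continuous[OF sol]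
        by (intro continuous_intros) (auto elim: continuous_on_subset)
    qed
    then show ?thesis using Es by (simp add: mult_le_0_iff)
  next
    case False
    then have True: "r \<le> s" by simp
    have "E r * exp (K * r) \<le> E s * exp (K * s)"
    proof (rule DERIV_nonneg_imp_increasing_open[OF True, of "\<lambda>r. E r * exp (K * r)"])
      fix x assume x: "r < x" "x < s"
      then have xi: "x \<in> {a..b}" "x \<in> interior {a..b}" using s r by auto
      have "(E has_real_derivative 2 * (\<phi> x * g x * (1 / P x - G x))) (at x)"
        using dE[OF xi(1)] at_within_interior[OF xi(2)] by simp
      then have "((\<lambda>r. E r * exp (K * r)) has_real_derivative (2 * (\<phi> x * g x * (1 / P x - G x)) + K * E x) * exp (K * x)) (at x)"
        by (auto intro!: derivative_eq_intros simp: algebra_simps)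
      moreover have "(2 * (\<phi> x * g x * (1 / P x - G x)) + K * E x) * exp (K * x) \<ge> 0"
        using bd[OF xi(1)] by (intro mult_nonneg_nonneg) auto
      ultimately show "\<exists>y. ((\<lambda>r. E r * exp (K * r)) has_real_derivative y) (at x) \<and> 0 \<le> y" by blast
    next
      show "continuous_on {r..s} (\<lambda>r. E r * exp (K * r))" unfolding E_def
        using s r sl_sol_continuous[OF sol]
        by (intro continuous_intros) (auto elim: continuous_on_subset)
    qed
    then show ?thesis using Es by (simp add: mult_le_0_iff)
  qed
  then show ?thesis by (simp add: E_def sum_power2_le_zero_iff)
qed


lemma sl_sol_nontrivial:
  assumes sol: "sl_sol P G a b \<phi> g" and P: "\<And>r. r \<in> {a..b} \<Longrightarrow> P r > 0"
    and cont: "continuous_on {a..b} P" "continuous_on {a..b} G"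
    and r: "r \<in> {a..b}" "\<phi> r \<noteq> 0" and s: "s \<in> {a..b}" "\<phi> s = 0"
  shows "g s \<noteq> 0"
  using sl_sol_unique_zero[OF sol P cont s _ r(1)] r(2) by blast

lemma zero_free_right_neighbourhood:
  fixes \<phi> :: "real \<Rightarrow> real"
  assumes "(\<phi> has_real_derivative D) (at s within {s..t})" "D \<noteq> 0" "\<phi> s = 0" "s < t"
  obtains e where "e > 0" "s + e < t" "\<And>r. s < r \<Longrightarrow> r \<le> s + e \<Longrightarrow> \<phi> r \<noteq> 0"
proof -
  have "\<exists>e>0. \<forall>r. s < r \<and> r \<le> t \<and> r - s < e \<longrightarrow> \<phi> r \<noteq> 0"
  proof (cases "D > 0")
    case True
    from has_real_derivative_pos_inc_right[OF assms(1) True]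
    obtain d where "d > 0" "\<And>h. h > 0 \<Longrightarrow> s + h \<in> {s..t} \<Longrightarrow> h < d \<Longrightarrow> \<phi> s < \<phi> (s + h)" by blast
    then show ?thesis using assms(3)
      by (intro exI[of _ d]) (smt (verit) atLeastAtMost_iff)
  next
    case False
    then have "D < 0" using assms by simp
    from has_real_derivative_neg_dec_right[OF assms(1) this]
    obtain d where "d > 0" "\<And>h. h > 0 \<Longrightarrow> s + h \<in> {s..t} \<Longrightarrow> h < d \<Longrightarrow> \<phi> s > \<phi> (s + h)" by blast
    then show ?thesis using assms(3)
      by (intro exI[of _ d]) (smt (verit) atLeastAtMost_iff)
  qed
  then obtain e where e: "e > 0" "\<forall>r. s < r \<and> r \<le> t \<and> r - s < e \<longrightarrow> \<phi> r \<noteq> 0" by blast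
  show ?thesis
    by (rule that[of "min (e/2) ((t-s)/2)"]) (use e assms in \<open>auto simp: min_def field_simps split: if_splits\<close>)
qed

lemma next_zero:
  fixes \<phi> :: "real \<Rightarrow> real"
  assumes cont: "continuous_on {s..t} \<phi>" and st: "s < t" and z: "\<phi> s = 0" "\<phi> t = 0"
    and D: "(\<phi> has_real_derivative D) (at s within {s..t})" "D \<noteq> 0"
  obtains t' where "s < t'" "t' \<le> t" "\<phi> t' = 0" "\<And>r. s < r \<Longrightarrow> r < t' \<Longrightarrow> \<phi> r \<noteq> 0"
proof -
  obtain e where e: "e > 0" "s + e < t" "\<And>r. s < r \<Longrightarrow> r \<le> s + e \<Longrightarrow> \<phi> r \<noteq> 0"
    using zero_free_right_neighbourhood[OF D z(1) st] by blast
  define S where "S = {r \<in> {s+e..t}. \<phi> r = 0}"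
  have "continuous_on {s+e..t} \<phi>" using continuous_on_subset[OF cont] e by auto
  then have "closed S" unfolding S_def
    using continuous_closed_preimage[of "{s+e..t}" \<phi> "{0}"] by (simp add: vimage_def Collect_conj_eq[symmetric] Int_def)
  moreover have "t \<in> S" using e z by (auto simp: S_def)
  moreover have bdd: "bdd_below S" by (auto simp: S_def intro: bdd_belowI[of _ "s+e"])
  ultimately have "Inf S \<in> S" by (intro closed_contains_Inf) auto
  show ?thesis
  proof (rule that[of "Inf S"])
    show "s < Inf S" "Inf S \<le> t" "\<phi> (Inf S) = 0" using \<open>Inf S \<in> S\<close> e(1) by (auto simp: S_def)
    fix r assume r: "s < r" "r < Inf S"
    show "\<phi> r \<noteq> 0"
    proof
      assume "\<phi> r = 0"
      with e(3)[of r] r \<open>Inf S \<in> S\<close> have "r \<in> S" by (force simp: S_def)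
      then show False using cInf_lower[OF _ bdd, of r] r by simp
    qed
  qed
qed

text \<open>Shrink \<open>t\<close> to the first zero \<open>t'\<close> of \<open>\<phi>\<close> after \<open>s\<close>. If \<open>\<psi>\<close> had no zero in between, both functions could be
  normalized to be positive there; the Wronskian would then be nondecreasing, nonnegative at \<open>s\<close> and nonpositive at \<open>t'\<close>,
  hence zero, against strictness or independence.\<close>
lemma sturm_comparison:
  assumes \<phi>: "sl_sol P G a b \<phi> g" and \<psi>: "sl_sol P H a b \<psi> h"
    and P: "\<And>r. r \<in> {a..b} \<Longrightarrow> P r > 0"
    and cont: "continuous_on {a..b} P" "continuous_on {a..b} G"
    and st: "a \<le> s" "s < t" "t \<le> b" and z: "\<phi> s = 0" "\<phi> t = 0" and nz: "\<phi> c \<noteq> 0" "c \<in> {a..b}"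
    and le: "\<And>r. s < r \<Longrightarrow> r < t \<Longrightarrow> G r \<le> H r"
    and indep: "(\<forall>r. s < r \<and> r < t \<longrightarrow> G r < H r) \<or> (\<forall>r\<in>{s..t}. g r * \<psi> r - \<phi> r * h r \<noteq> 0)"
  shows "\<exists>r\<in>{s<..<t}. \<psi> r = 0"
proof -
  have gs: "g s \<noteq> 0" using sl_sol_nontrivial[OF \<phi> P cont nz(2,1)] st z by auto
  have \<phi>s: "sl_sol P G s t \<phi> g" using sl_sol_subset[OF \<phi>] st by auto
  have Ps: "P s > 0" using P[of s] st by auto
  obtain t' where t': "s < t'" "t' \<le> t" "\<phi> t' = 0" "\<And>r. s < r \<Longrightarrow> r < t' \<Longrightarrow> \<phi> r \<noteq> 0"
    by (rule next_zero[OF sl_sol_continuous(1)[OF \<phi>s] st(2) z, of "g s / P s"])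
       (use \<phi>s st gs Ps in \<open>auto simp: sl_sol_def\<close>)
  show ?thesis
  proof (rule ccontr)
    assume "\<not> ?thesis"
    then have \<psi>nz: "\<psi> r \<noteq> 0" if "s < r" "r < t'" for r using that t' by auto
    define x0 where "x0 = (s + t') / 2"
    have x0: "s < x0" "x0 < t'" using t' by (auto simp: x0_def)
    have \<phi>1: "sl_sol P G s t' \<phi> g" using sl_sol_subset[OF \<phi>] st t' by auto
    have \<psi>1: "sl_sol P H s t' \<psi> h" using sl_sol_subset[OF \<psi>] st t' by auto
    have P1: "\<And>r. r \<in> {s..t'} \<Longrightarrow> P r > 0" using P st t' by auto
    have sgn: "0 < f x0 * f r" if "continuous_on {s..t'} f" "\<And>r. s < r \<Longrightarrow> r < t' \<Longrightarrow> f r \<noteq> 0" "s < r" "r < t'"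
      for f :: "real \<Rightarrow> real" and r
    proof (rule ccontr)
      assume "\<not> 0 < f x0 * f r"
      then have "f x0 < 0 \<and> 0 < f r \<or> f r < 0 \<and> 0 < f x0"
        using that(2)[of r] that(2)[of x0] that(3,4) x0 by (simp add: zero_less_mult_iff) linarith
      moreover have "connected (f ` {min r x0..max r x0})"
        by (intro connected_continuous_image continuous_on_subset[OF that(1)]) (use that x0 in auto)
      moreover have "f r \<in> f ` {min r x0..max r x0}" "f x0 \<in> f ` {min r x0..max r x0}" by auto
      ultimately have "0 \<in> f ` {min r x0..max r x0}"
        unfolding connected_iff_interval by (meson less_imp_le)
      then show False using that x0 by (auto simp: min_def max_def split: if_splits)
    qed
    \<comment> \<open>Multiplying by the values at one point makes both functions positive between \<open>s\<close> and \<open>t'\<close>.\<close>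
    define F where "F r = \<phi> x0 * \<phi> r" for r
    define Q where "Q r = \<psi> x0 * \<psi> r" for r
    define W where "W r = (\<phi> x0 * \<psi> x0) * (g r * \<psi> r - \<phi> r * h r)" for r
    have F: "F r > 0" if "s < r" "r < t'" for r
      unfolding F_def using sgn[OF sl_sol_continuous(1)[OF \<phi>1] t'(4) that] .
    have Q: "Q r > 0" if "s < r" "r < t'" for r
      unfolding Q_def using sgn[OF sl_sol_continuous(1)[OF \<psi>1] \<psi>nz that] .
    have dW: "(W has_real_derivative (H r - G r) * F r * Q r) (at r within {s..t'})" if "r \<in> {s..t'}" for r
    proof -
      have "(W has_real_derivative (\<phi> x0 * \<psi> x0) * ((H r - G r) * \<phi> r * \<psi> r)) (at r within {s..t'})"
        unfolding W_def by (rule DERIV_cmult[OF sl_sol_wronskian[OF \<phi>1 \<psi>1 P1 that]])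
      then show ?thesis by (simp add: F_def Q_def algebra_simps)
    qed
    have Qcl: "Q s \<ge> 0" "Q t' \<ge> 0"
    proof -
      have "continuous_on {s..t'} Q" unfolding Q_def
        using sl_sol_continuous(1)[OF \<psi>1] by (intro continuous_intros)
      then have c: "closed ({s..t'} \<inter> Q -` {0..})" by (intro continuous_closed_preimage) auto
      have "{s<..<t'} \<subseteq> {s..t'} \<inter> Q -` {0..}" by (auto intro!: less_imp_le[OF Q])
      then have "closure {s<..<t'} \<subseteq> {s..t'} \<inter> Q -` {0..}" using c by (rule closure_minimal)
      then have "{s..t'} \<subseteq> {s..t'} \<inter> Q -` {0..}" using t' by simp
      then have "\<forall>x\<in>{s..t'}. x \<in> Q -` {0..}" by blast
      then show "Q s \<ge> 0" "Q t' \<ge> 0" using t'(1) by simp_all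
    qed
    define g1 where "g1 r = \<phi> x0 * g r" for r
    have dF: "(F has_real_derivative g1 r / P r) (at r within {s..t'})" if "r \<in> {s..t'}" for r
      unfolding F_def g1_def using \<phi>1 that by (auto simp: sl_sol_def intro!: derivative_eq_intros)
    have gs0: "g1 s \<ge> 0"
    proof (rule ccontr)
      assume "\<not> g1 s \<ge> 0"
      then have "g1 s / P s < 0" using Ps by (simp add: divide_less_0_iff)
      from has_real_derivative_neg_dec_right[OF dF[of s] this] t' obtain d where
        d: "d > 0" "\<And>h. h > 0 \<Longrightarrow> s + h \<in> {s..t'} \<Longrightarrow> h < d \<Longrightarrow> F s > F (s + h)" by auto
      define k where "k = min (d/2) ((t' - s)/2)"
      have "k > 0" "k < d" "s + k < t'" using d t' by (auto simp: k_def min_def field_simps)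
      then show False using d(2)[of k] F[of "s+k"] z by (auto simp: F_def)
    qed
    have gt0: "g1 t' \<le> 0"
    proof (rule ccontr)
      assume "\<not> g1 t' \<le> 0"
      then have "g1 t' / P t' > 0" using P1[of t'] t' by simp
      from has_real_derivative_pos_inc_left[OF dF[of t'] this] t' obtain d where
        d: "d > 0" "\<And>h. h > 0 \<Longrightarrow> t' - h \<in> {s..t'} \<Longrightarrow> h < d \<Longrightarrow> F (t' - h) < F t'" by auto
      define k where "k = min (d/2) ((t' - s)/2)"
      have "k > 0" "k < d" "s < t' - k" using d t' by (auto simp: k_def min_def field_simps)
      then show False using d(2)[of k] F[of "t'-k"] t' by (auto simp: F_def)
    qed
    have Ws: "W s \<ge> 0"
    proof -
      have "W s = g1 s * Q s" using z by (simp add: W_def g1_def Q_def)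
      then show ?thesis using gs0 Qcl by simp
    qed
    have Wt: "W t' \<le> 0"
    proof -
      have "W t' = g1 t' * Q t'" using t' by (simp add: W_def g1_def Q_def)
      then show ?thesis using gt0 Qcl by (simp add: mult_le_0_iff)
    qed
    have "\<exists>x\<in>{s<..<t'}. W t' - W s = ((H x - G x) * F x * Q x) * (t' - s)"
      by (rule mvt_simple[OF t'(1), of W "\<lambda>x. (*) ((H x - G x) * F x * Q x)"])
         (use dW in \<open>auto simp only: has_field_derivative_def atLeastAtMost_iff\<close>)
    then obtain x where x: "s < x" "x < t'" "W t' - W s = ((H x - G x) * F x * Q x) * (t' - s)"
      by auto
    have nn: "(H x - G x) * F x * Q x \<ge> 0"
      using le[of x] x t' F Q by (intro mult_nonneg_nonneg) (auto intro: less_imp_le)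
    have "W t' - W s \<le> 0" using Ws Wt by simp
    with x(3) have "((H x - G x) * F x * Q x) * (t' - s) \<le> 0" by simp
    then have "(H x - G x) * F x * Q x \<le> 0"
      using t'(1) by (meson mult_pos_pos not_le diff_gt_0_iff_gt)
    then have eq: "(H x - G x) * F x * Q x = 0" using nn by (rule order.antisym)
    then have Heq: "H x = G x" using F[of x] Q[of x] x by auto
    have "W t' = W s" using x(3) unfolding eq by simp
    then have "W s = 0" using Ws Wt by simp
    then have W0: "g s * \<psi> s - \<phi> s * h s = 0" using t'(4)[OF x0] \<psi>nz[OF x0] by (simp add: W_def)
    from indep show False
    proof
      assume "\<forall>r. s < r \<and> r < t \<longrightarrow> G r < H r"
      then show False using Heq x t'(2) by (metis less_irrefl less_le_trans)
    next
      assume "\<forall>r\<in>{s..t}. g r * \<psi> r - \<phi> r * h r \<noteq> 0"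
      then show False using W0 st by simp
    qed
  qed
qed

section \<open>Solutions up to the boundary and an existence theorem\<close>

text \<open>A solution known only in the open interval and continuous up to the ends is a solution up to the ends: \<open>P \<phi>'\<close> is a
  primitive of the continuous function \<open>-G \<phi>\<close>, and then \<open>\<phi>\<close> is a primitive of a continuous function.\<close>
lemma sl_sol_extend:
  assumes ab: "a < b" and P: "\<And>r. r \<in> {a..b} \<Longrightarrow> P r > 0"
    and cont: "continuous_on {a..b} P" "continuous_on {a..b} G" "continuous_on {a..b} \<phi>"
    and d1: "\<And>r. r \<in> {a<..<b} \<Longrightarrow> (\<phi> has_real_derivative \<phi>' r) (at r)"
    and d2: "\<And>r. r \<in> {a<..<b} \<Longrightarrow> ((\<lambda>r. P r * \<phi>' r) has_real_derivative - (G r * \<phi> r)) (at r)"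
  shows "\<exists>g. sl_sol P G a b \<phi> g \<and> (\<forall>r\<in>{a<..<b}. g r = P r * \<phi>' r)"
proof -
  define F where "F t = integral {a..t} (\<lambda>r. - (G r * \<phi> r))" for t
  have dF: "(F has_real_derivative - (G r * \<phi> r)) (at r within {a..b})" if "r \<in> {a..b}" for r
    unfolding F_def using that
    by (intro integral_has_real_derivative continuous_intros cont)
  have "\<exists>C. \<forall>r\<in>{a<..<b}. P r * \<phi>' r - F r = C"
  proof (rule has_field_derivative_zero_constant[of "{a<..<b}" "\<lambda>r. P r * \<phi>' r - F r"])
    fix r assume r: "r \<in> {a<..<b}"
    then have "(F has_real_derivative - (G r * \<phi> r)) (at r)"
      using dF[of r] at_within_interior[of r "{a..b}"] by auto
    from DERIV_diff[OF d2[OF r] this]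
    show "((\<lambda>r. P r * \<phi>' r - F r) has_real_derivative 0) (at r within {a<..<b})"
      using has_field_derivative_at_within by fastforce
  qed auto
  then obtain C where C: "\<And>r. r \<in> {a<..<b} \<Longrightarrow> P r * \<phi>' r = F r + C" by (force simp: algebra_simps)
  define g where "g r = F r + C" for r
  have dg: "(g has_real_derivative - (G r * \<phi> r)) (at r within {a..b})" if "r \<in> {a..b}" for r
    unfolding g_def using dF[OF that] by (auto intro!: derivative_eq_intros)
  have cg: "continuous_on {a..b} (\<lambda>r. g r / P r)"
    using P dg by (intro continuous_intros cont DERIV_continuous_on) force+
  define Q where "Q t = integral {a..t} (\<lambda>r. g r / P r)" for t
  have dQ: "(Q has_real_derivative g r / P r) (at r within {a..b})" if "r \<in> {a..b}" for r
    unfolding Q_def using that by (intro integral_has_real_derivative cg)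
  have "\<phi> r - Q r = \<phi> a - Q a" if "r \<in> {a..b}" for r
  proof (rule DERIV_isconst2[OF ab, of "\<lambda>r. \<phi> r - Q r"])
    show "continuous_on {a..b} (\<lambda>r. \<phi> r - Q r)"
      using dQ by (intro continuous_intros cont DERIV_continuous_on) force+
    fix x assume x: "a < x" "x < b"
    then have "(Q has_real_derivative g x / P x) (at x)"
      using dQ[of x] at_within_interior[of x "{a..b}"] by auto
    moreover have "g x / P x = \<phi>' x" using C[of x] x P[of x] by (simp add: g_def field_simps)
    ultimately show "((\<lambda>r. \<phi> r - Q r) has_real_derivative 0) (at x)"
      using DERIV_diff[OF d1[of x]] x by fastforce
  qed (use that in auto)
  then have eq: "\<phi> r = Q r + (\<phi> a - Q a)" if "r \<in> {a..b}" for r using that by (simp add: algebra_simps)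
  have "(\<phi> has_real_derivative g r / P r) (at r within {a..b})" if "r \<in> {a..b}" for r
  proof -
    have "((\<lambda>r. Q r + (\<phi> a - Q a)) has_real_derivative g r / P r) (at r within {a..b})"
      using dQ[OF that] by (auto intro!: derivative_eq_intros)
    then show ?thesis
      by (rule has_field_derivative_transform_within[of _ _ _ _ 1, OF _ zero_less_one that eq[symmetric]])
  qed
  with dg have "sl_sol P G a b \<phi> g" by (auto simp: sl_sol_def)
  with C show ?thesis by (intro exI[of _ g]) (auto simp: g_def)
qed

text \<open>Picard iteration for a globally Lipschitz right-hand side. In the unknown \<open>exp(-M(r - a)) \<theta>(r)\<close> with \<open>M = 2L + 1\<close> the
  integral operator contracts with factor \<open>1/2\<close> on the whole interval at once.\<close>
lemma lipschitz_ode_solution_exists: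
  fixes f :: "real \<Rightarrow> real \<Rightarrow> real"
  assumes ab: "a \<le> b" and L: "L \<ge> 0"
    and cont: "\<And>y. continuous_on {a..b} y \<Longrightarrow> continuous_on {a..b} (\<lambda>r. f r (y r))"
    and lip: "\<And>r y z. r \<in> {a..b} \<Longrightarrow> \<bar>f r y - f r z\<bar> \<le> L * \<bar>y - z\<bar>"
  shows "\<exists>\<theta>. \<theta> a = y0 \<and> (\<forall>r\<in>{a..b}. (\<theta> has_real_derivative f r (\<theta> r)) (at r within {a..b}))"
proof -
  define M where "M = 2 * L + 1"
  have M: "M > 0" "L / M \<le> 1/2" using L by (auto simp: M_def field_simps)
  \<comment> \<open>Bounded continuous functions live on the whole line, so the argument is clamped to \<open>{a..b}\<close>.\<close>
  define c where "c r = max a (min b r)" for r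
  have c: "c r \<in> {a..b}" "r \<in> {a..b} \<Longrightarrow> c r = r" for r using ab by (auto simp: c_def)
  have contc: "continuous_on UNIV c" unfolding c_def by (intro continuous_intros)
  define J where "J y t = y0 + integral {a..t} (\<lambda>s. f s (exp (M * (s - a)) * y s))" for y t
  define T where "T y r = exp (- M * (c r - a)) * J y (c r)" for y r
  have ci: "continuous_on {a..b} (\<lambda>s. f s (exp (M * (s - a)) * y s))" if "continuous_on {a..b} y" for y
    by (intro cont continuous_intros that)
  have dJ: "(J y has_real_derivative f r (exp (M * (r - a)) * y r)) (at r within {a..b})"
    if "continuous_on {a..b} y" "r \<in> {a..b}" for y r
    unfolding J_def
    using integral_has_real_derivative[OF ci[OF that(1)] that(2)] by (auto intro!: derivative_eq_intros)
  have Tb: "T y \<in> bcontfun" if y: "continuous_on {a..b} y" for y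
  proof -
    have "continuous_on {a..b} (\<lambda>t. exp (- M * (t - a)) * J y t)"
      using dJ[OF y] by (intro continuous_intros DERIV_continuous_on) blast+
    then have c1: "continuous_on (c ` UNIV) (\<lambda>t. exp (- M * (t - a)) * J y t)" and
      cp: "compact ((\<lambda>t. exp (- M * (t - a)) * J y t) ` {a..b})"
      using c by (auto elim!: continuous_on_subset intro: compact_continuous_image)
    have "continuous_on UNIV (T y)"
      using continuous_on_compose[OF contc c1] by (simp add: T_def[abs_def] o_def)
    moreover obtain B where "\<And>z. z \<in> (\<lambda>t. exp (- M * (t - a)) * J y t) ` {a..b} \<Longrightarrow> norm z \<le> B"
      using compact_imp_bounded[OF cp] unfolding bounded_iff by blast
    then have "norm (T y r) \<le> B" for r using c(1)[of r] by (auto simp: T_def)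
    ultimately show ?thesis by (rule bcontfun_normI)
  qed
  define TT where "TT y = Bcontfun (T (apply_bcontfun y))" for y
  have cy: "continuous_on {a..b} (apply_bcontfun y)" for y :: "real \<Rightarrow>\<^sub>C real"
    using apply_bcontfun[of y] by (auto simp: bcontfun_def elim: continuous_on_subset)
  have TT: "apply_bcontfun (TT y) = T (apply_bcontfun y)" for y
    unfolding TT_def by (rule Bcontfun_inverse[OF Tb[OF cy]])
  have "\<exists>!y. TT y = y"
  proof (rule banach_fix_type[of "1/2"]; (intro allI)?)
    fix y z :: "real \<Rightarrow>\<^sub>C real"
    define D where "D = dist y z"
    show "dist (TT y) (TT z) \<le> 1/2 * dist y z"
    proof (rule dist_bound)
      fix r
      define t where "t = c r"
      have t: "t \<in> {a..b}" using c by (simp add: t_def)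
      have sub: "{a..t} \<subseteq> {a..b}" using t by auto
      have i1: "(\<lambda>s. f s (exp (M * (s - a)) * y s)) integrable_on {a..t}" for y :: "real \<Rightarrow>\<^sub>C real"
        by (rule integrable_continuous_interval[OF continuous_on_subset[OF ci[OF cy] sub]])
      have hi: "((\<lambda>s. L * D * exp (M * (s - a))) has_integral (L * D * exp (M * (t - a)) / M - L * D * exp (M * (a - a)) / M)) {a..t}"
        using t M by (intro fundamental_theorem_of_calculus)
          (auto intro!: derivative_eq_intros simp flip: has_real_derivative_iff_has_vector_derivative)
      have "\<bar>J y t - J z t\<bar> = \<bar>integral {a..t} (\<lambda>s. f s (exp (M * (s - a)) * y s) - f s (exp (M * (s - a)) * z s))\<bar>"
        unfolding J_def by (subst integral_diff[OF i1 i1]) simp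
      also have "\<dots> \<le> integral {a..t} (\<lambda>s. L * D * exp (M * (s - a)))"
        unfolding real_norm_def[symmetric]
      proof (rule integral_norm_bound_integral)
        fix s assume s: "s \<in> {a..t}"
        have "\<bar>f s (exp (M * (s - a)) * y s) - f s (exp (M * (s - a)) * z s)\<bar> \<le> L * \<bar>exp (M * (s - a)) * y s - exp (M * (s - a)) * z s\<bar>"
          using s sub by (intro lip) auto
        also have "\<dots> = L * (exp (M * (s - a)) * \<bar>y s - z s\<bar>)"
          by (simp add: abs_mult right_diff_distrib[symmetric])
        also have "\<dots> \<le> L * (exp (M * (s - a)) * D)"
          using dist_bounded[of y s z] L by (intro mult_left_mono) (auto simp: D_def dist_real_def)
        finally show "norm (f s (exp (M * (s - a)) * y s) - f s (exp (M * (s - a)) * z s)) \<le> L * D * exp (M * (s - a))"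
          by (simp add: algebra_simps)
      qed (use hi i1 in \<open>auto intro: integrable_diff simp: has_integral_integrable\<close>)
      also have "\<dots> \<le> (L / M) * D * exp (M * (t - a))"
        using integral_unique[OF hi] L M by (simp add: D_def)
      also have "\<dots> \<le> 1/2 * D * exp (M * (t - a))"
        using M by (intro mult_right_mono) (auto simp: D_def)
      finally have le: "\<bar>J y t - J z t\<bar> \<le> 1/2 * D * exp (M * (t - a))" .
      have "dist (TT y r) (TT z r) = exp (- M * (t - a)) * \<bar>J y t - J z t\<bar>"
        by (simp add: TT T_def t_def dist_real_def abs_mult right_diff_distrib[symmetric])
      also have "\<dots> \<le> exp (- M * (t - a)) * (1/2 * D * exp (M * (t - a)))"
        using le by (intro mult_left_mono) auto
      also have "\<dots> = 1/2 * D" by (simp add: mult.commute flip: exp_add)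
      finally show "dist (TT y r) (TT z r) \<le> 1/2 * dist y z" by (simp add: D_def)
    qed
  qed auto
  then obtain y where y: "TT y = y" by blast
  define \<theta> where "\<theta> r = exp (M * (r - a)) * apply_bcontfun y r" for r
  have eq: "J y r = \<theta> r" if "r \<in> {a..b}" for r
  proof -
    have "apply_bcontfun y r = T y r" using TT[of y] y by simp
    then have "\<theta> r = exp (M * (r - a)) * exp (- M * (r - a)) * J y r"
      using that c(2)[of r] by (simp add: \<theta>_def T_def)
    also have "exp (M * (r - a)) * exp (- M * (r - a)) = 1" by (simp flip: exp_add)
    finally show ?thesis by simp
  qed
  have "(\<theta> has_real_derivative f r (\<theta> r)) (at r within {a..b})" if "r \<in> {a..b}" for r
    using has_field_derivative_transform_within[OF dJ[OF cy that, of y] zero_less_one that eq]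
    by (simp add: \<theta>_def[abs_def])
  moreover have "\<theta> a = y0" using eq[of a] ab by (simp add: J_def)
  ultimately show ?thesis by blast
qed

section \<open>The Pruefer angle\<close>

text \<open>The angle of \<open>(\<phi>, P \<phi>')\<close> in polar coordinates, \<open>\<phi> = \<rho> sin \<theta>\<close> and \<open>P \<phi>' = \<rho> cos \<theta>\<close>, started at \<open>\<phi>(a) = 0\<close>.\<close>
definition pruefer_angle :: "(real \<Rightarrow> real) \<Rightarrow> (real \<Rightarrow> real) \<Rightarrow> real \<Rightarrow> real \<Rightarrow> (real \<Rightarrow> real) \<Rightarrow> bool" where
  "pruefer_angle P G a b \<theta> \<longleftrightarrow> \<theta> a = 0 \<and>
     (\<forall>r\<in>{a..b}. (\<theta> has_real_derivative (cos (\<theta> r))\<^sup>2 / P r + G r * (sin (\<theta> r))\<^sup>2) (at r within {a..b}))"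

lemma sin_power2_lipschitz: "\<bar>(sin y)\<^sup>2 - (sin z)\<^sup>2\<bar> \<le> 2 * \<bar>y - z\<bar>"
  for y z :: real
proof -
  have 1: "\<bar>sin y - sin z\<bar> \<le> \<bar>y - z\<bar>"
  proof -
    have "sin y - sin z = 2 * sin ((y - z) / 2) * cos ((y + z) / 2)" by (rule sin_diff_sin)
    also have "\<bar>\<dots>\<bar> = 2 * (\<bar>sin ((y - z) / 2)\<bar> * \<bar>cos ((y + z) / 2)\<bar>)" by (simp add: abs_mult)
    also have "\<dots> \<le> 2 * (\<bar>(y - z) / 2\<bar> * 1)"
      by (intro mult_left_mono mult_mono abs_sin_x_le_abs_x) auto
    finally show ?thesis by simp
  qed
  have "\<bar>sin y + sin z\<bar> \<le> 2"
    using abs_sin_le_one[of y] abs_sin_le_one[of z] by linarith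
  then have "\<bar>sin y + sin z\<bar> * \<bar>sin y - sin z\<bar> \<le> 2 * \<bar>y - z\<bar>" using 1 by (intro mult_mono) auto
  then show ?thesis by (simp add: power2_eq_square square_diff_square_factored abs_mult)
qed

lemma pruefer_rhs_lipschitz:
  fixes y z :: real
  assumes "\<bar>1 / P\<bar> \<le> B" "\<bar>G\<bar> \<le> C"
  shows "\<bar>((cos y)\<^sup>2 / P + G * (sin y)\<^sup>2) - ((cos z)\<^sup>2 / P + G * (sin z)\<^sup>2)\<bar> \<le> 2 * (B + C) * \<bar>y - z\<bar>"
proof -
  have "((cos y)\<^sup>2 / P + G * (sin y)\<^sup>2) - ((cos z)\<^sup>2 / P + G * (sin z)\<^sup>2) = (G - 1 / P) * ((sin y)\<^sup>2 - (sin z)\<^sup>2)"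
    by (simp add: cos_squared_eq algebra_simps diff_divide_distrib)
  also have "\<bar>\<dots>\<bar> \<le> (B + C) * (2 * \<bar>y - z\<bar>)"
    unfolding abs_mult using assms sin_power2_lipschitz[of y z] by (intro mult_mono) linarith+
  finally show ?thesis by (simp add: algebra_simps)
qed

lemma continuous_on_interval_bounded:
  fixes f :: "real \<Rightarrow> real"
  assumes "continuous_on {a..b} f"
  obtains B where "B \<ge> 0" "\<And>r. r \<in> {a..b} \<Longrightarrow> \<bar>f r\<bar> \<le> B"
proof -
  have "bounded (f ` {a..b})" using assms by (intro compact_imp_bounded compact_continuous_image) auto
  then obtain B where "\<forall>x\<in>f ` {a..b}. norm x \<le> B" unfolding bounded_iff by blast
  then show ?thesis by (intro that[of "max B 0"]) force+
qed

lemma pruefer_lipschitz_constant: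
  fixes a b :: real and P G :: "real \<Rightarrow> real"
  assumes P: "\<And>r. r \<in> {a..b} \<Longrightarrow> P r > 0" and cont: "continuous_on {a..b} P" "continuous_on {a..b} G"
  obtains L where "L \<ge> 0" "\<And>r y z. r \<in> {a..b} \<Longrightarrow> \<bar>((cos y)\<^sup>2 / P r + G r * (sin y)\<^sup>2) - ((cos z)\<^sup>2 / P r + G r * (sin z)\<^sup>2)\<bar> \<le> L * \<bar>y - z\<bar>"
proof -
  have "continuous_on {a..b} (\<lambda>r. 1 / P r)" by (intro continuous_intros cont) (use P in force)
  then obtain B where B: "B \<ge> 0" "\<And>r. r \<in> {a..b} \<Longrightarrow> \<bar>1 / P r\<bar> \<le> B" using continuous_on_interval_bounded by blast
  obtain C where C: "C \<ge> 0" "\<And>r. r \<in> {a..b} \<Longrightarrow> \<bar>G r\<bar> \<le> C" using continuous_on_interval_bounded[OF cont(2)] by blast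
  show ?thesis
    by (rule that[of "2 * (B + C)"]) (use B C in simp, intro pruefer_rhs_lipschitz B C)
qed

lemma pruefer_angle_exists:
  assumes ab: "a \<le> b" and P: "\<And>r. r \<in> {a..b} \<Longrightarrow> P r > 0"
    and cont: "continuous_on {a..b} P" "continuous_on {a..b} G"
  shows "\<exists>\<theta>. pruefer_angle P G a b \<theta>"
proof -
  obtain L where L: "L \<ge> 0" "\<And>r y z. r \<in> {a..b} \<Longrightarrow> \<bar>((cos y)\<^sup>2 / P r + G r * (sin y)\<^sup>2) - ((cos z)\<^sup>2 / P r + G r * (sin z)\<^sup>2)\<bar> \<le> L * \<bar>y - z\<bar>"
    using pruefer_lipschitz_constant[OF P cont] by blast
  show ?thesis unfolding pruefer_angle_def
    by (rule lipschitz_ode_solution_exists[OF ab L(1) _ L(2)])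
       (use P in \<open>force intro!: continuous_intros cont\<close>)
qed

lemma pruefer_angle_continuous: "pruefer_angle P G a b \<theta> \<Longrightarrow> continuous_on {a..b} \<theta>"
  unfolding pruefer_angle_def by (auto intro!: DERIV_continuous_on)

text \<open>The radius is recovered from \<open>\<rho>'/\<rho> = (1/P - G) sin \<theta> cos \<theta>\<close>, which makes the polar form solve the system.\<close>
lemma sl_sol_of_pruefer:
  assumes \<theta>: "pruefer_angle P G a b \<theta>" and ab: "a \<le> b" and P: "\<And>r. r \<in> {a..b} \<Longrightarrow> P r > 0"
    and cont: "continuous_on {a..b} P" "continuous_on {a..b} G"
  shows "\<exists>\<rho>. (\<forall>r. \<rho> r > 0) \<and> sl_sol P G a b (\<lambda>r. \<rho> r * sin (\<theta> r)) (\<lambda>r. \<rho> r * cos (\<theta> r))"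
proof -
  define q where "q r = (1 / P r - G r) * sin (\<theta> r) * cos (\<theta> r)" for r
  have "continuous_on {a..b} q" unfolding q_def
    by (intro continuous_intros cont pruefer_angle_continuous[OF \<theta>]) (use P in force)
  define \<rho> where "\<rho> t = exp (integral {a..t} q)" for t
  have d\<rho>: "(\<rho> has_real_derivative \<rho> r * q r) (at r within {a..b})" if "r \<in> {a..b}" for r
    unfolding \<rho>_def using integral_has_real_derivative[OF \<open>continuous_on {a..b} q\<close> that]
    by (auto intro!: derivative_eq_intros)
  have "sl_sol P G a b (\<lambda>r. \<rho> r * sin (\<theta> r)) (\<lambda>r. \<rho> r * cos (\<theta> r))"
    unfolding sl_sol_def
  proof (intro ballI conjI)
    fix r assume r: "r \<in> {a..b}"
    have P0: "P r \<noteq> 0" using P[OF r] by simp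
    note d = d\<rho>[OF r] \<theta>[unfolded pruefer_angle_def, THEN conjunct2, rule_format, OF r]
    define s c where "s = sin (\<theta> r)" and "c = cos (\<theta> r)"
    have s2: "s * s = 1 - c * c" using sin_squared_eq[of "\<theta> r"] by (simp add: s_def c_def power2_eq_square)
    have s3: "s * (s * x) = x - c * (c * x)" for x using arg_cong[OF s2, of "\<lambda>z. z * x"] by (simp add: algebra_simps)
    have "((\<lambda>r. \<rho> r * sin (\<theta> r)) has_real_derivative \<rho> r * q r * s + \<rho> r * (c * (c\<^sup>2 / P r + G r * s\<^sup>2))) (at r within {a..b})"
      using d unfolding s_def c_def by (auto intro!: derivative_eq_intros)
    moreover have "\<rho> r * q r * s + \<rho> r * (c * (c\<^sup>2 / P r + G r * s\<^sup>2)) = \<rho> r * c / P r"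
      using P0 by (simp add: q_def field_simps power2_eq_square s2 s3 flip: s_def c_def)
    ultimately show "((\<lambda>r. \<rho> r * sin (\<theta> r)) has_real_derivative \<rho> r * cos (\<theta> r) / P r) (at r within {a..b})"
      by (simp add: c_def)
    have "((\<lambda>r. \<rho> r * cos (\<theta> r)) has_real_derivative \<rho> r * q r * c - \<rho> r * (s * (c\<^sup>2 / P r + G r * s\<^sup>2))) (at r within {a..b})"
      using d unfolding s_def c_def by (auto intro!: derivative_eq_intros)
    moreover have "\<rho> r * q r * c - \<rho> r * (s * (c\<^sup>2 / P r + G r * s\<^sup>2)) = - (G r * (\<rho> r * s))"
      using P0 by (simp add: q_def field_simps power2_eq_square s2 s3 flip: s_def c_def)
    ultimately show "((\<lambda>r. \<rho> r * cos (\<theta> r)) has_real_derivative - (G r * (\<rho> r * sin (\<theta> r)))) (at r within {a..b})"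
      by (simp add: s_def)
  qed
  then show ?thesis by (intro exI[of _ \<rho>]) (auto simp: \<rho>_def)
qed

lemma sin_zero_cos_squared: "sin x = 0 \<Longrightarrow> (cos x)\<^sup>2 = (1::real)"
  using sin_cos_squared_add[of x] by simp

text \<open>At a multiple of \<open>\<pi>\<close> the angle has slope \<open>1 / P > 0\<close>, so it never returns below one.\<close>
lemma pruefer_angle_passes_multiple:
  assumes \<theta>: "pruefer_angle P G a b \<theta>" and P: "\<And>r. r \<in> {a..b} \<Longrightarrow> P r > 0"
    and st: "a \<le> s" "s < t" "t \<le> b" and s: "\<theta> s \<ge> real k * pi"
  shows "\<theta> t > real k * pi"
proof -
  have "0 < \<theta> t - real k * pi"
  proof (rule crosses_upwards_once[of s t "\<lambda>r. \<theta> r - real k * pi"])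
    show "continuous_on {s..t} (\<lambda>r. \<theta> r - real k * pi)"
      using continuous_on_subset[OF pruefer_angle_continuous[OF \<theta>], of "{s..t}"] st by (auto intro!: continuous_intros)
    fix r assume r: "r \<in> {s..t}" "\<theta> r - real k * pi = 0"
    then have k: "\<theta> r = real k * pi" by simp
    have "sin (\<theta> r) = 0" unfolding k by simp
    moreover have rab: "r \<in> {a..b}" using r st by auto
    ultimately have "(\<theta> has_real_derivative 1 / P r) (at r within {a..b})"
      using \<theta> by (auto simp: pruefer_angle_def sin_zero_cos_squared dest!: bspec[where x=r])
    then have "(\<theta> has_real_derivative 1 / P r) (at r within {s..t})"
      by (rule DERIV_subset) (use st in auto)
    then show "\<exists>d>0. ((\<lambda>r. \<theta> r - real k * pi) has_real_derivative d) (at r within {s..t})"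
      using P[OF rab] by (intro exI[of _ "1 / P r"]) (auto intro!: derivative_eq_intros)
  qed (use st s in auto)
  then show ?thesis by simp
qed

lemma pruefer_angle_counts_zeros:
  assumes \<theta>: "pruefer_angle P G a b \<theta>" and P: "\<And>r. r \<in> {a..b} \<Longrightarrow> P r > 0"
    and F: "finite F" "F \<subseteq> {a<..<b}" "\<And>r. r \<in> F \<Longrightarrow> sin (\<theta> r) = 0"
    and t: "a < t" "t \<le> b" "\<And>r. r \<in> F \<Longrightarrow> r < t"
  shows "\<theta> t > real (card F) * pi"
  using F t
proof (induction "card F" arbitrary: F t)
  case 0
  then have "F = {}" by simp
  have "\<theta> a = 0" using \<theta> by (simp add: pruefer_angle_def)
  then show ?case using pruefer_angle_passes_multiple[OF \<theta> P, of a t 0] 0 \<open>F = {}\<close> by simp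
next
  case (Suc k)
  define M where "M = Max F"
  have M: "M \<in> F" using Suc by (auto simp: M_def intro!: Max_in)
  have lt: "r < M" if "r \<in> F - {M}" for r using that Suc(3) by (auto simp: M_def order.strict_iff_order)
  have k: "card (F - {M}) = k" using Suc M by simp
  have "\<theta> M > real k * pi"
    using Suc.hyps(1)[of "F - {M}" M] k Suc.prems M lt by force
  moreover obtain i :: int where i: "\<theta> M = of_int i * pi"
    using Suc.prems(3)[OF M] unfolding sin_zero_iff_int2 by blast
  ultimately have "i > int k" by (simp add: mult_less_cancel_right)
  then have "real (Suc k) \<le> of_int i" by linarith
  then have "\<theta> M \<ge> real (Suc k) * pi" unfolding i by (intro mult_right_mono) auto
  then have "\<theta> t > real (Suc k) * pi"
    using Suc.prems M by (intro pruefer_angle_passes_multiple[OF \<theta> P, of M]) auto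
  then show ?case using Suc by simp
qed

text \<open>Where \<open>G < 0\<close> the angle decreases at \<open>\<pi>/2\<close>, so it never gets past that value: no oscillation for a negative coefficient.\<close>
lemma pruefer_angle_small:
  assumes \<theta>: "pruefer_angle P G a b \<theta>" and ab: "a < b" and G: "\<And>r. r \<in> {a..b} \<Longrightarrow> G r < 0"
  shows "\<theta> b < pi"
proof -
  have "0 < pi / 2 - \<theta> b"
  proof (rule crosses_upwards_once[of a b "\<lambda>r. pi / 2 - \<theta> r"])
    show "continuous_on {a..b} (\<lambda>r. pi / 2 - \<theta> r)"
      using pruefer_angle_continuous[OF \<theta>] by (intro continuous_intros)
    fix r assume r: "r \<in> {a..b}" "pi / 2 - \<theta> r = 0"
    then have h: "\<theta> r = pi / 2" by simp
    have "(\<theta> has_real_derivative (cos (\<theta> r))\<^sup>2 / P r + G r * (sin (\<theta> r))\<^sup>2) (at r within {a..b})"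
      using \<theta> r unfolding pruefer_angle_def by blast
    then have "(\<theta> has_real_derivative G r) (at r within {a..b})" unfolding h by simp
    then show "\<exists>d>0. ((\<lambda>r. pi / 2 - \<theta> r) has_real_derivative d) (at r within {a..b})"
      using G[OF r(1)] by (intro exI[of _ "- G r"]) (auto intro!: derivative_eq_intros)
  qed (use \<theta> ab in \<open>auto simp: pruefer_angle_def\<close>)
  then show ?thesis using pi_gt_zero by linarith
qed

text \<open>Gronwall estimate for \<open>(\<eta> - \<theta>)\<^sup>2 + d\<^sup>2\<close>. Only the Lipschitz constant for \<open>G\<close> enters, so it can be kept fixed while
  \<open>H\<close> approaches \<open>G\<close>.\<close>
lemma pruefer_angle_dependence:
  assumes \<theta>: "pruefer_angle P G a b \<theta>" and ab: "a < b" and L: "L \<ge> 0"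
    and lip: "\<And>r y z. r \<in> {a..b} \<Longrightarrow> \<bar>((cos y)\<^sup>2 / P r + G r * (sin y)\<^sup>2) - ((cos z)\<^sup>2 / P r + G r * (sin z)\<^sup>2)\<bar> \<le> L * \<bar>y - z\<bar>"
    and \<eta>: "pruefer_angle P H a b \<eta>" and d: "\<And>r. r \<in> {a..b} \<Longrightarrow> \<bar>H r - G r\<bar> \<le> d"
  shows "(\<eta> b - \<theta> b)\<^sup>2 \<le> d\<^sup>2 * exp ((2 * L + 1) * (b - a))"
proof -
  define K where "K = 2 * L + 1"
  have K: "K \<ge> 1" using L by (simp add: K_def)
  define E where "E r = (\<eta> r - \<theta> r)\<^sup>2 + d\<^sup>2" for r
  have "E b * exp (- K * b) \<le> E a * exp (- K * a)"
  proof (rule DERIV_nonpos_imp_decreasing_open[OF less_imp_le[OF ab], of "\<lambda>r. E r * exp (- K * r)"])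
    show "continuous_on {a..b} (\<lambda>r. E r * exp (- K * r))" unfolding E_def
      using pruefer_angle_continuous[OF \<theta>] pruefer_angle_continuous[OF \<eta>] by (intro continuous_intros)
    fix x assume x: "a < x" "x < b"
    then have xi: "x \<in> {a..b}" and w: "at x within {a..b} = at x" by (auto intro!: at_within_interior)
    define A where "A = (cos (\<theta> x))\<^sup>2 / P x + G x * (sin (\<theta> x))\<^sup>2"
    define B where "B = (cos (\<eta> x))\<^sup>2 / P x + H x * (sin (\<eta> x))\<^sup>2"
    define B' where "B' = (cos (\<eta> x))\<^sup>2 / P x + G x * (sin (\<eta> x))\<^sup>2"
    define D where "D = \<eta> x - \<theta> x"
    have dd: "(\<theta> has_real_derivative A) (at x)" "(\<eta> has_real_derivative B) (at x)"
      using \<theta> \<eta> xi unfolding pruefer_angle_def A_def B_def w[symmetric] by blast+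
    have der: "((\<lambda>r. E r * exp (- K * r)) has_real_derivative (2 * D * (B - A) - K * E x) * exp (- K * x)) (at x)"
      unfolding E_def D_def using dd by (auto intro!: derivative_eq_intros simp: algebra_simps power2_eq_square)
    have 1: "\<bar>B' - A\<bar> \<le> L * \<bar>D\<bar>" unfolding B'_def A_def D_def by (rule lip[OF xi])
    have "B - B' = (H x - G x) * (sin (\<eta> x))\<^sup>2" by (simp add: B_def B'_def algebra_simps)
    also have "\<bar>\<dots>\<bar> \<le> d * 1" unfolding abs_mult
      using d[OF xi] abs_sin_le_one[of "\<eta> x"] by (intro mult_mono) (auto simp: abs_square_le_1)
    finally have 2: "\<bar>B - B'\<bar> \<le> d" by simp
    have "2 * D * (B - A) \<le> 2 * \<bar>D\<bar> * \<bar>B - A\<bar>"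
      by (metis abs_ge_self abs_mult abs_numeral)
    also have "\<dots> \<le> 2 * \<bar>D\<bar> * (L * \<bar>D\<bar> + d)" using 1 2 by (intro mult_left_mono) auto
    also have "\<dots> = 2 * L * D\<^sup>2 + 2 * \<bar>D\<bar> * d" by (simp add: algebra_simps power2_eq_square)
    also have "2 * \<bar>D\<bar> * d \<le> D\<^sup>2 + d\<^sup>2" using sum_squares_bound[of "\<bar>D\<bar>" d] by simp
    finally have "2 * D * (B - A) \<le> K * D\<^sup>2 + d\<^sup>2" by (simp add: K_def algebra_simps)
    also have "\<dots> \<le> K * E x" using K by (simp add: E_def D_def algebra_simps mult_le_cancel_right1)
    finally have "(2 * D * (B - A) - K * E x) * exp (- K * x) \<le> 0" by (simp add: mult_le_0_iff)
    with der show "\<exists>y. ((\<lambda>r. E r * exp (- K * r)) has_real_derivative y) (at x) \<and> y \<le> 0" by blast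
  qed
  then have "E b * exp (- K * b) * exp (K * b) \<le> E a * exp (- K * a) * exp (K * b)"
    by (intro mult_right_mono) auto
  then have "E b \<le> E a * exp (K * (b - a))"
    by (simp add: mult.assoc right_diff_distrib algebra_simps flip: exp_add)
  moreover have "E a = d\<^sup>2" using \<theta> \<eta> by (simp add: E_def pruefer_angle_def)
  ultimately show ?thesis by (simp add: E_def K_def) (smt (verit) zero_le_power2)
qed

section \<open>Radial equations and eigenvalues below a given one\<close>

text \<open>The radial operator in dimension \<open>n + 1\<close> in divergence form: \<open>-\<phi>'' - n/r \<phi>' = (q + \<nu>/r\<^sup>2) \<phi>\<close> with \<open>g = r\<^sup>n \<phi>'\<close>.\<close>
definition radial_sol :: "nat \<Rightarrow> (real \<Rightarrow> real) \<Rightarrow> real \<Rightarrow> real \<Rightarrow> real \<Rightarrow> (real \<Rightarrow> real) \<Rightarrow> (real \<Rightarrow> real) \<Rightarrow> bool" where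
  "radial_sol n q \<nu> a b \<phi> g \<longleftrightarrow> sl_sol (\<lambda>r. r ^ n) (\<lambda>r. r ^ n * (q r + \<nu> / r\<^sup>2)) a b \<phi> g"

lemma power_real_derivative:
  "r \<noteq> 0 \<Longrightarrow> ((\<lambda>r::real. r ^ n) has_real_derivative real n * r ^ n / r) (at r within S)"
proof -
  assume r: "r \<noteq> 0"
  have "((\<lambda>r::real. r ^ n) has_real_derivative real n * r ^ (n - 1)) (at r within S)"
    by (auto intro!: derivative_eq_intros)
  moreover have "real n * r ^ (n - 1) = real n * r ^ n / r" using r by (cases n) auto
  ultimately show ?thesis by metis
qed

lemma continuous_on_radial_coefficient:
  fixes q :: "real \<Rightarrow> real"
  assumes "0 < a" "continuous_on {a..b} q"
  shows "continuous_on {a..b} (\<lambda>r. r ^ n * (q r + \<nu> / r\<^sup>2))"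
  using assms by (intro continuous_intros) auto

lemma radial_sol_of_ode:
  assumes a: "0 < a" "a < b" and q: "continuous_on {a..b} q" and \<phi>: "continuous_on {a..b} \<phi>"
    and d: "\<And>r. r \<in> {a<..<b} \<Longrightarrow> (\<phi> has_real_derivative \<phi>' r) (at r) \<and>
           (\<phi>' has_real_derivative \<phi>'' r) (at r) \<and>
           - \<phi>'' r - real n / r * \<phi>' r = (q r + \<nu> / r\<^sup>2) * \<phi> r"
  shows "\<exists>g. radial_sol n q \<nu> a b \<phi> g"
proof -
  have "\<exists>g. sl_sol (\<lambda>r. r ^ n) (\<lambda>r. r ^ n * (q r + \<nu> / r\<^sup>2)) a b \<phi> g \<and>
     (\<forall>r\<in>{a<..<b}. g r = r ^ n * \<phi>' r)"
  proof (rule sl_sol_extend[OF a(2)])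
    show "continuous_on {a..b} (\<lambda>r. r ^ n * (q r + \<nu> / r\<^sup>2))"
      by (rule continuous_on_radial_coefficient[OF a(1) q])
    fix r assume r: "r \<in> {a<..<b}"
    then have r0: "r \<noteq> 0" using a by auto
    show "(\<phi> has_real_derivative \<phi>' r) (at r)" using d[OF r] by blast
    have "((\<lambda>r. r ^ n * \<phi>' r) has_real_derivative real n * r ^ n / r * \<phi>' r + r ^ n * \<phi>'' r) (at r)"
      using DERIV_mult[OF power_real_derivative[OF r0, of n] conjunct1[OF conjunct2[OF d[OF r]]]]
      by (simp add: mult.commute[of "\<phi>'' r"])
    moreover have "real n * r ^ n / r * \<phi>' r + r ^ n * \<phi>'' r = - (r ^ n * (- \<phi>'' r - real n / r * \<phi>' r))"
      by (simp add: algebra_simps)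
    ultimately show "((\<lambda>r. r ^ n * \<phi>' r) has_real_derivative - (r ^ n * (q r + \<nu> / r\<^sup>2) * \<phi> r)) (at r)"
      using d[OF r] by (simp add: mult.assoc)
  qed (use a \<phi> in \<open>auto intro!: continuous_intros\<close>)
  then show ?thesis unfolding radial_sol_def by blast
qed

lemma radial_eigenvalue_iff:
  assumes a: "0 < a" "a < b" and q: "continuous_on {a..b} (\<lambda>r. p * \<bar>u r\<bar> powr (p - 1))"
  shows "radial_eigenvalue (Suc n) p a b u \<nu> \<longleftrightarrow>
    (\<exists>\<phi> g. radial_sol n (\<lambda>r. p * \<bar>u r\<bar> powr (p - 1)) \<nu> a b \<phi> g \<and> \<phi> a = 0 \<and> \<phi> b = 0 \<and> (\<exists>r\<in>{a<..<b}. \<phi> r \<noteq> 0))"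
    (is "?l \<longleftrightarrow> ?r")
proof
  assume ?l
  then obtain \<phi> \<phi>' \<phi>'' where h: "continuous_on {a..b} \<phi>" "\<phi> a = 0" "\<phi> b = 0" "\<exists>r\<in>{a<..<b}. \<phi> r \<noteq> 0"
    and d: "\<And>r. r \<in> {a<..<b} \<Longrightarrow> (\<phi> has_real_derivative \<phi>' r) (at r) \<and>
           (\<phi>' has_real_derivative \<phi>'' r) (at r) \<and>
           - \<phi>'' r - (real (Suc n) - 1) / r * \<phi>' r = (p * \<bar>u r\<bar> powr (p - 1) + \<nu> / r\<^sup>2) * \<phi> r"
    unfolding radial_eigenvalue_def by blast
  have "\<exists>g. radial_sol n (\<lambda>r. p * \<bar>u r\<bar> powr (p - 1)) \<nu> a b \<phi> g"
    by (rule radial_sol_of_ode[OF a q h(1)]) (use d in simp)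
  then show ?r using h by blast
next
  assume ?r
  then obtain \<phi> g where s: "radial_sol n (\<lambda>r. p * \<bar>u r\<bar> powr (p - 1)) \<nu> a b \<phi> g"
    and h: "\<phi> a = 0" "\<phi> b = 0" "\<exists>r\<in>{a<..<b}. \<phi> r \<noteq> 0" by blast
  define G where "G r = p * \<bar>u r\<bar> powr (p - 1) + \<nu> / r\<^sup>2" for r
  have "(\<phi> has_real_derivative g r / r ^ n) (at r) \<and>
        ((\<lambda>r. g r / r ^ n) has_real_derivative (- (G r * \<phi> r) - real n / r * (g r / r ^ n))) (at r)"
    if r: "r \<in> {a<..<b}" for r
  proof -
    have r0: "r \<noteq> 0" "r \<in> {a..b}" using r a by auto
    have w: "at r within {a..b} = at r" using r by (auto intro!: at_within_interior)
    have d: "(\<phi> has_real_derivative g r / r ^ n) (at r)" "(g has_real_derivative - (r ^ n * G r * \<phi> r)) (at r)"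
      using s r0(2) unfolding radial_sol_def sl_sol_def w[symmetric] G_def by blast+
    have "((\<lambda>r. g r / r ^ n) has_real_derivative ((- (r ^ n * G r * \<phi> r)) * r ^ n - g r * (real n * r ^ n / r)) / (r ^ n * r ^ n)) (at r)"
      by (rule DERIV_divide[OF d(2) power_real_derivative[OF r0(1)]]) (use r0 in auto)
    moreover have "((- (r ^ n * G r * \<phi> r)) * r ^ n - g r * (real n * r ^ n / r)) / (r ^ n * r ^ n) = - (G r * \<phi> r) - real n / r * (g r / r ^ n)"
      using r0 by (simp add: field_simps)
    ultimately show ?thesis using d(1) by simp
  qed
  moreover have "continuous_on {a..b} \<phi>" using s sl_sol_continuous(1) unfolding radial_sol_def by blast
  ultimately show ?l unfolding radial_eigenvalue_def using h
    by (intro exI[of _ \<phi>] exI[of _ "\<lambda>r. g r / r ^ n"] exI[of _ "\<lambda>r. - (G r * \<phi> r) - real n / r * (g r / r ^ n)"])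
       (auto simp: G_def)
qed

lemma pruefer_multiple_imp_eigenfunction:
  fixes q :: "real \<Rightarrow> real"
  assumes a: "0 < a" "a < b" and q: "continuous_on {a..b} q"
    and \<theta>: "pruefer_angle (\<lambda>r. r ^ n) (\<lambda>r. r ^ n * (q r + \<nu> / r\<^sup>2)) a b \<theta>" and b: "sin (\<theta> b) = 0"
  shows "\<exists>\<phi> g. radial_sol n q \<nu> a b \<phi> g \<and> \<phi> a = 0 \<and> \<phi> b = 0 \<and> (\<exists>r\<in>{a<..<b}. \<phi> r \<noteq> 0)"
proof -
  have P: "\<And>r. r \<in> {a..b} \<Longrightarrow> r ^ n > 0" using a by auto
  have cP: "continuous_on {a..b} (\<lambda>r. r ^ n)" by (intro continuous_intros)
  obtain \<rho> where \<rho>: "\<And>r. \<rho> r > 0"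
    "sl_sol (\<lambda>r. r ^ n) (\<lambda>r. r ^ n * (q r + \<nu> / r\<^sup>2)) a b (\<lambda>r. \<rho> r * sin (\<theta> r)) (\<lambda>r. \<rho> r * cos (\<theta> r))"
    using sl_sol_of_pruefer[OF \<theta> less_imp_le[OF a(2)] P cP continuous_on_radial_coefficient[OF a(1) q]] by blast
  have \<theta>a: "\<theta> a = 0" using \<theta> by (simp add: pruefer_angle_def)
  have "((\<lambda>r. \<rho> r * sin (\<theta> r)) has_real_derivative \<rho> a * cos (\<theta> a) / a ^ n) (at a within {a..b})"
    using \<rho>(2) a unfolding sl_sol_def by auto
  from zero_free_right_neighbourhood[OF this] obtain e where
    e: "e > 0" "a + e < b" "\<And>r. a < r \<Longrightarrow> r \<le> a + e \<Longrightarrow> \<rho> r * sin (\<theta> r) \<noteq> 0"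
    using \<theta>a \<rho>(1)[of a] a by auto
  have "\<exists>r\<in>{a<..<b}. \<rho> r * sin (\<theta> r) \<noteq> 0" by (rule bexI[of _ "a + e"]) (use e in auto)
  then show ?thesis using \<rho>(2) \<theta>a b unfolding radial_sol_def by (metis mult_zero_right sin_zero)
qed

text \<open>Continuity of the end angle in the spectral parameter is what makes shooting by the intermediate value theorem work.\<close>
lemma pruefer_endpoint_continuous:
  fixes q :: "real \<Rightarrow> real"
  assumes a: "0 < a" "a < b" and q: "continuous_on {a..b} q"
    and \<Theta>: "\<And>\<nu>. pruefer_angle (\<lambda>r. r ^ n) (\<lambda>r. r ^ n * (q r + \<nu> / r\<^sup>2)) a b (\<Theta> \<nu>)"
  shows "continuous_on UNIV (\<lambda>\<nu>. \<Theta> \<nu> b)"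
  unfolding continuous_on_eq_continuous_at[OF open_UNIV]
proof
  fix \<mu> :: real
  have P: "\<And>r. r \<in> {a..b} \<Longrightarrow> r ^ n > 0" using a by auto
  have cont: "continuous_on {a..b} (\<lambda>r. r ^ n)" by (intro continuous_intros)
  obtain L where L: "L \<ge> 0" "\<And>r y z. r \<in> {a..b} \<Longrightarrow> \<bar>((cos y)\<^sup>2 / r ^ n + r ^ n * (q r + \<mu> / r\<^sup>2) * (sin y)\<^sup>2) - ((cos z)\<^sup>2 / r ^ n + r ^ n * (q r + \<mu> / r\<^sup>2) * (sin z)\<^sup>2)\<bar> \<le> L * \<bar>y - z\<bar>"
    using pruefer_lipschitz_constant[OF P cont continuous_on_radial_coefficient[OF a(1) q, of n \<mu>]] by blast
  have "continuous_on {a..b} (\<lambda>r. r ^ n / r\<^sup>2)" using a by (intro continuous_intros) auto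
  then obtain C where C: "C \<ge> 0" "\<And>r. r \<in> {a..b} \<Longrightarrow> \<bar>r ^ n / r\<^sup>2\<bar> \<le> C"
    using continuous_on_interval_bounded by blast
  define M where "M = C * sqrt (exp ((2 * L + 1) * (b - a)))"
  have bd: "\<bar>\<Theta> \<nu> b - \<Theta> \<mu> b\<bar> \<le> \<bar>\<nu> - \<mu>\<bar> * M" for \<nu>
  proof -
    have "(\<Theta> \<nu> b - \<Theta> \<mu> b)\<^sup>2 \<le> (\<bar>\<nu> - \<mu>\<bar> * C)\<^sup>2 * exp ((2 * L + 1) * (b - a))"
    proof (rule pruefer_angle_dependence[OF \<Theta> a(2) L(1) L(2) \<Theta>])
      fix r assume r: "r \<in> {a..b}"
      have "r ^ n * (q r + \<nu> / r\<^sup>2) - r ^ n * (q r + \<mu> / r\<^sup>2) = (\<nu> - \<mu>) * (r ^ n / r\<^sup>2)"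
        by (simp add: algebra_simps diff_divide_distrib)
      also have "\<bar>\<dots>\<bar> \<le> \<bar>\<nu> - \<mu>\<bar> * C" unfolding abs_mult by (intro mult_left_mono C(2)[OF r]) auto
      finally show "\<bar>r ^ n * (q r + \<nu> / r\<^sup>2) - r ^ n * (q r + \<mu> / r\<^sup>2)\<bar> \<le> \<bar>\<nu> - \<mu>\<bar> * C" .
    qed
    also have "\<dots> = (\<bar>\<nu> - \<mu>\<bar> * M)\<^sup>2" by (simp add: M_def power_mult_distrib)
    finally show ?thesis using C(1) unfolding abs_le_square_iff[symmetric] by (simp add: M_def abs_mult)
  qed
  have "((\<lambda>\<nu>. \<Theta> \<nu> b - \<Theta> \<mu> b) \<longlongrightarrow> 0) (at \<mu>)"
  proof (rule Lim_null_comparison)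
    show "((\<lambda>\<nu>. \<bar>\<nu> - \<mu>\<bar> * M) \<longlongrightarrow> 0) (at \<mu>)" by (auto intro!: tendsto_eq_intros)
  qed (use bd in auto)
  then show "isCont (\<lambda>\<nu>. \<Theta> \<nu> b) \<mu>" unfolding isCont_def by (simp add: LIM_zero_iff)
qed

text \<open>Shooting. Each interior zero raises the end angle at \<open>\<nu>0\<close> by \<open>\<pi>\<close>, so that angle exceeds \<open>k\<pi>\<close> for every
  \<open>k \<le> card F\<close>, while for very negative parameters it stays below \<open>\<pi>\<close>. Every value \<open>k\<pi>\<close> is therefore taken at some
  \<open>\<nu> < \<nu>0\<close>, and different \<open>k\<close> belong to different \<open>\<nu>\<close>.\<close>
lemma eigenvalues_below_from_zeros:
  fixes q :: "real \<Rightarrow> real"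
  assumes a: "0 < a" "a < b" and q: "continuous_on {a..b} q"
    and \<phi>: "radial_sol n q \<nu>0 a b \<phi> g" "\<phi> a = 0" "\<exists>r\<in>{a..b}. \<phi> r \<noteq> 0"
    and F: "finite F" "F \<subseteq> {a<..<b}" "\<And>r. r \<in> F \<Longrightarrow> \<phi> r = 0"
  shows "\<exists>S. finite S \<and> card S = card F \<and> (\<forall>\<nu>\<in>S. \<nu> < \<nu>0 \<and>
    (\<exists>\<phi> g. radial_sol n q \<nu> a b \<phi> g \<and> \<phi> a = 0 \<and> \<phi> b = 0 \<and> (\<exists>r\<in>{a<..<b}. \<phi> r \<noteq> 0)))"
proof -
  have P: "\<And>r. r \<in> {a..b} \<Longrightarrow> r ^ n > 0" using a by auto
  have cP: "continuous_on {a..b} (\<lambda>r. r ^ n)" by (intro continuous_intros)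
  note cG = continuous_on_radial_coefficient[OF a(1) q, of n]
  define \<Theta> where "\<Theta> \<nu> = (SOME \<theta>. pruefer_angle (\<lambda>r. r ^ n) (\<lambda>r. r ^ n * (q r + \<nu> / r\<^sup>2)) a b \<theta>)" for \<nu>
  have \<Theta>: "pruefer_angle (\<lambda>r. r ^ n) (\<lambda>r. r ^ n * (q r + \<nu> / r\<^sup>2)) a b (\<Theta> \<nu>)" for \<nu>
    unfolding \<Theta>_def by (rule someI_ex[OF pruefer_angle_exists[OF less_imp_le[OF a(2)] P cP cG]])
  have \<Theta>a: "\<Theta> \<nu> a = 0" for \<nu> using \<Theta>[of \<nu>] by (simp add: pruefer_angle_def)
  have sF: "sin (\<Theta> \<nu>0 r) = 0" if r: "r \<in> F" for r
  proof -
    obtain \<rho> where \<rho>: "\<And>r. \<rho> r > 0"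
      "sl_sol (\<lambda>r. r ^ n) (\<lambda>r. r ^ n * (q r + \<nu>0 / r\<^sup>2)) a b (\<lambda>r. \<rho> r * sin (\<Theta> \<nu>0 r)) (\<lambda>r. \<rho> r * cos (\<Theta> \<nu>0 r))"
      using sl_sol_of_pruefer[OF \<Theta>[of \<nu>0] less_imp_le[OF a(2)] P cP cG] by blast
    have rab: "r \<in> {a..b}" "a < r" using r F a by auto
    define W where "W r = g r * (\<rho> r * sin (\<Theta> \<nu>0 r)) - \<phi> r * (\<rho> r * cos (\<Theta> \<nu>0 r))" for r
    have dW: "(W has_real_derivative 0) (at x within {a..b})" if "x \<in> {a..b}" for x
      using sl_sol_wronskian[OF \<phi>(1)[unfolded radial_sol_def] \<rho>(2) P that] unfolding W_def by simp
    have "\<exists>c. \<forall>x\<in>{a..b}. W x = c"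
      by (rule has_field_derivative_zero_constant) (use dW in auto)
    then have "W r = W a" using rab a by force
    also have "W a = 0" using \<phi>(2) \<Theta>a by (simp add: W_def)
    finally have "g r * (\<rho> r * sin (\<Theta> \<nu>0 r)) = 0" using F(3)[OF r] by (simp add: W_def)
    moreover obtain c where "c \<in> {a..b}" "\<phi> c \<noteq> 0" using \<phi>(3) by blast
    then have "g r \<noteq> 0"
      using sl_sol_nontrivial[OF \<phi>(1)[unfolded radial_sol_def] P cP cG] rab F(3)[OF r] by blast
    ultimately show ?thesis using \<rho>(1)[of r] by simp
  qed
  have up: "\<Theta> \<nu>0 b > real (card F) * pi"
    by (rule pruefer_angle_counts_zeros[OF \<Theta>[of \<nu>0] P F(1,2)]) (use sF F a in auto)
  obtain B where B: "B \<ge> 0" "\<And>r. r \<in> {a..b} \<Longrightarrow> \<bar>q r\<bar> \<le> B" using continuous_on_interval_bounded[OF q] by blast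
  \<comment> \<open>With this parameter the coefficient is negative on all of \<open>{a..b}\<close>.\<close>
  define \<nu>1 where "\<nu>1 = min \<nu>0 (- (B + 1) * b\<^sup>2)"
  have lo: "\<Theta> \<nu>1 b < pi"
  proof (rule pruefer_angle_small[OF \<Theta> a(2)])
    fix r assume r: "r \<in> {a..b}"
    then have r2: "0 < r\<^sup>2" "r\<^sup>2 \<le> b\<^sup>2" using a by (auto intro: power_mono)
    have "\<nu>1 \<le> - (B + 1) * b\<^sup>2" by (simp add: \<nu>1_def)
    also have "\<dots> \<le> - (B + 1) * r\<^sup>2" using r2 B by (intro mult_left_mono_neg) auto
    finally have "\<nu>1 / r\<^sup>2 \<le> - (B + 1)" using r2 by (simp add: pos_divide_le_eq)
    then have "q r + \<nu>1 / r\<^sup>2 < 0" using B(2)[OF r] by linarith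
    then show "r ^ n * (q r + \<nu>1 / r\<^sup>2) < 0" using P[OF r] by (simp add: mult_less_0_iff)
  qed
  have "\<exists>\<nu>. \<nu> < \<nu>0 \<and> \<Theta> \<nu> b = real k * pi" if k: "k \<in> {1..card F}" for k
  proof -
    have "1 * pi \<le> real k * pi" using k by (intro mult_right_mono) auto
    then have "\<Theta> \<nu>1 b \<le> real k * pi" using lo by linarith
    moreover have kF: "real k * pi \<le> real (card F) * pi" using k by (intro mult_right_mono) auto
    moreover have "real k * pi \<le> \<Theta> \<nu>0 b" using up kF by linarith
    moreover have "\<nu>1 \<le> \<nu>0" by (simp add: \<nu>1_def)
    moreover have "continuous_on {\<nu>1..\<nu>0} (\<lambda>\<nu>. \<Theta> \<nu> b)"
      using pruefer_endpoint_continuous[OF a q \<Theta>] by (rule continuous_on_subset) auto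
    ultimately obtain \<nu> where "\<nu>1 \<le> \<nu>" "\<nu> \<le> \<nu>0" "\<Theta> \<nu> b = real k * pi"
      using IVT'[of "\<lambda>\<nu>. \<Theta> \<nu> b" \<nu>1 "real k * pi" \<nu>0] by blast
    then show ?thesis using up kF by (intro exI[of _ \<nu>]) (cases "\<nu> = \<nu>0", auto)
  qed
  then obtain N where N: "\<And>k. k \<in> {1..card F} \<Longrightarrow> N k < \<nu>0 \<and> \<Theta> (N k) b = real k * pi" by metis
  have "inj_on N {1..card F}"
  proof (rule inj_onI)
    fix i j assume "i \<in> {1..card F}" "j \<in> {1..card F}" "N i = N j"
    then have "real i * pi = real j * pi" using N by metis
    then show "i = j" by simp
  qed
  then have "card (N ` {1..card F}) = card F" by (simp add: card_image)
  moreover have "\<forall>\<nu>\<in>N ` {1..card F}. \<nu> < \<nu>0 \<and> (\<exists>\<phi> g. radial_sol n q \<nu> a b \<phi> g \<and> \<phi> a = 0 \<and> \<phi> b = 0 \<and> (\<exists>r\<in>{a<..<b}. \<phi> r \<noteq> 0))"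
  proof safe
    fix k assume k: "k \<in> {1..card F}"
    show "N k < \<nu>0" using N[OF k] by blast
    have "sin (\<Theta> (N k) b) = 0" using N[OF k] by simp
    then show "\<exists>\<phi> g. radial_sol n q (N k) a b \<phi> g \<and> \<phi> a = 0 \<and> \<phi> b = 0 \<and> (\<exists>r\<in>{a<..<b}. \<phi> r \<noteq> 0)"
      by (rule pruefer_multiple_imp_eigenfunction[OF a q \<Theta>])
  qed
  ultimately show ?thesis by (intro exI[of _ "N ` {1..card F}"]) auto
qed

text \<open>Sturm comparison in the spectral parameter. For equal parameters the Wronskian is constant, so its value at \<open>a\<close> decides
  independence.\<close>
lemma radial_sol_sturm:
  assumes a: "0 < a" and q: "continuous_on {a..b} q"
    and \<phi>: "radial_sol n q \<nu> a b \<phi> g" and \<psi>: "radial_sol n q \<mu> a b \<psi> h"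
    and nz: "\<exists>r\<in>{a..b}. \<phi> r \<noteq> 0"
    and cmp: "\<nu> < \<mu> \<or> \<nu> = \<mu> \<and> g a * \<psi> a - \<phi> a * h a \<noteq> 0"
    and st: "a \<le> s" "s < t" "t \<le> b" and z: "\<phi> s = 0" "\<phi> t = 0"
  shows "\<exists>r\<in>{s<..<t}. \<psi> r = 0"
proof -
  have P: "\<And>r. r \<in> {a..b} \<Longrightarrow> r ^ n > 0" using a by auto
  have cP: "continuous_on {a..b} (\<lambda>r. r ^ n)" by (intro continuous_intros)
  obtain c where c: "c \<in> {a..b}" "\<phi> c \<noteq> 0" using nz by blast
  show ?thesis
  proof (rule sturm_comparison[OF \<phi>[unfolded radial_sol_def] \<psi>[unfolded radial_sol_def] P cP
        continuous_on_radial_coefficient[OF a q] st z c(2,1)])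
    fix r assume r: "s < r" "r < t"
    then have "r > 0" using a st by auto
    moreover have "\<nu> \<le> \<mu>" using cmp by auto
    ultimately show "r ^ n * (q r + \<nu> / r\<^sup>2) \<le> r ^ n * (q r + \<mu> / r\<^sup>2)"
      by (intro mult_left_mono add_left_mono divide_right_mono) auto
  next
    show "(\<forall>r. s < r \<and> r < t \<longrightarrow> r ^ n * (q r + \<nu> / r\<^sup>2) < r ^ n * (q r + \<mu> / r\<^sup>2)) \<or>
      (\<forall>r\<in>{s..t}. g r * \<psi> r - \<phi> r * h r \<noteq> 0)"
    proof (cases "\<nu> < \<mu>")
      case True
      then have "r ^ n * (q r + \<nu> / r\<^sup>2) < r ^ n * (q r + \<mu> / r\<^sup>2)" if "s < r" for r
        using that a st by (intro mult_strict_left_mono add_strict_left_mono divide_strict_right_mono) auto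
      then show ?thesis by blast
    next
      case False
      then have eq: "\<nu> = \<mu>" and W0: "g a * \<psi> a - \<phi> a * h a \<noteq> 0" using cmp by auto
      define W where "W r = g r * \<psi> r - \<phi> r * h r" for r
      have dW: "(W has_real_derivative 0) (at x within {a..b})" if "x \<in> {a..b}" for x
        using sl_sol_wronskian[OF \<phi>[unfolded radial_sol_def] \<psi>[unfolded radial_sol_def] P that] eq
        unfolding W_def by simp
      have "\<exists>c. \<forall>x\<in>{a..b}. W x = c"
        by (rule has_field_derivative_zero_constant) (use dW in auto)
      then have "W r = W a" if "r \<in> {s..t}" for r using that st by force
      then show ?thesis using W0 unfolding W_def by metis
    qed
  qed
qed

lemma components_open_interval:
  fixes u :: "real \<Rightarrow> real"
  assumes cont: "continuous_on {a..b} u" and z: "u a = 0" "u b = 0"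
    and D: "D \<in> components {r\<in>{a<..<b}. u r \<noteq> 0}"
  shows "\<exists>s t. a \<le> s \<and> s < t \<and> t \<le> b \<and> D = {s<..<t} \<and> u s = 0 \<and> u t = 0 \<and> (\<forall>r\<in>{s<..<t}. u r \<noteq> 0)"
proof -
  define U where "U = {r\<in>{a<..<b}. u r \<noteq> 0}"
  have "open ({a<..<b} \<inter> u -` (- {0}))"
    by (rule continuous_open_preimage[OF continuous_on_subset[OF cont]]) auto
  moreover have "{a<..<b} \<inter> u -` (- {0}) = U" by (auto simp: U_def)
  ultimately have oU: "open U" by simp
  have DU: "D \<in> components U" using D by (simp add: U_def)
  have D1: "D \<subseteq> U" "D \<noteq> {}" "connected D" "open D"
    using in_components_subset[OF DU] in_components_nonempty[OF DU] in_components_connected[OF DU]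
      open_components[OF oU DU] by auto
  have sub: "a < x" "x < b" if "x \<in> D" for x using D1(1) that by (auto simp: U_def)
  have bd: "bdd_below D" "bdd_above D"
    using sub by (meson bdd_belowI bdd_aboveI less_imp_le)+
  define s t where "s = Inf D" and "t = Sup D"
  have notin: "x \<notin> D" if "x \<in> {s, t}" for x
  proof
    assume x: "x \<in> D"
    obtain e where e: "e > 0" "ball x e \<subseteq> D" using D1(4) x open_contains_ball by blast
    have "x - e/2 \<in> D" "x + e/2 \<in> D" using e by (auto simp: subset_iff dist_real_def)
    then show False using that e(1) cInf_lower[OF _ bd(1), of "x - e/2"] cSup_upper[OF _ bd(2), of "x + e/2"]
      by (auto simp: s_def t_def)
  qed
  have "D = {s<..<t}"
  proof safe
    fix x assume x: "x \<in> D"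
    have "s \<le> x" "x \<le> t" using x bd by (auto simp: s_def t_def intro: cInf_lower cSup_upper)
    moreover have "x \<noteq> s" "x \<noteq> t" using notin x by auto
    ultimately show "x \<in> {s<..<t}" by auto
  next
    fix x assume "x \<in> {s<..<t}"
    then have x: "s < x" "x < t" by auto
    obtain y where "y \<in> D" "y < x" using x(1) cInf_lessD[OF D1(2), of x] by (auto simp: s_def)
    moreover obtain w where "w \<in> D" "x < w" using x(2) less_cSupD[OF D1(2), of x] by (auto simp: t_def)
    ultimately show "x \<in> D" using D1(3) unfolding connected_iff_interval by (meson less_imp_le)
  qed
  moreover have "s < t" using \<open>D = {s<..<t}\<close> D1(2) by auto
  moreover have ab: "a \<le> s" "t \<le> b"
    unfolding s_def t_def using cInf_greatest[OF D1(2), of a] cSup_least[OF D1(2), of b] sub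
    by (meson less_imp_le)+
  moreover have "u x = 0" if x: "x \<in> {s, t}" for x
  proof (rule ccontr)
    assume u: "u x \<noteq> 0"
    then have "x \<noteq> a" "x \<noteq> b" using z by auto
    then have xU: "x \<in> U" using x u ab \<open>s < t\<close> by (auto simp: U_def)
    have "x \<in> closure D" using x \<open>D = {s<..<t}\<close> \<open>s < t\<close> by auto
    then have "connected (insert x D)"
      using D1(3) by (intro connected_intermediate_closure[of D "insert x D"]) (auto intro: closure_subset[THEN subsetD])
    then have "insert x D \<subseteq> D"
      using components_maximal[OF DU, of "insert x D"] D1(1,2) xU by auto
    then show False using notin[OF x] by auto
  qed
  ultimately show ?thesis using D1(1) by (intro exI[of _ s] exI[of _ t]) (auto simp: U_def)
qed

text \<open>Since \<open>p > 1\<close>, this holds at the origin as well, where the powers are not smooth; it lets the profile be differentiated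
  three times across its nodes.\<close>
lemma power_nonlinearity_derivative:
  fixes p :: real
  assumes p: "p > 1"
  shows "((\<lambda>s. \<bar>s\<bar> powr (p - 1) * s) has_real_derivative p * \<bar>x\<bar> powr (p - 1)) (at x)"
proof -
  consider "x > 0" | "x < 0" | "x = 0" by linarith
  then show ?thesis
  proof cases
    case 1
    have "((\<lambda>s. s powr (p - 1) * s) has_real_derivative (p - 1) * x powr (p - 1 - 1) * x + x powr (p - 1)) (at x)"
      using 1 by (auto intro!: derivative_eq_intros)
    moreover have "(p - 1) * x powr (p - 1 - 1) * x + x powr (p - 1) = p * x powr (p - 1)"
      using 1 by (simp add: powr_diff field_simps power2_eq_square)
    ultimately have "((\<lambda>s. s powr (p - 1) * s) has_real_derivative p * x powr (p - 1)) (at x)" by simp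
    then have "((\<lambda>s. \<bar>s\<bar> powr (p - 1) * s) has_real_derivative p * x powr (p - 1)) (at x)"
      by (rule has_field_derivative_transform_within_open[where S = "{0<..}"]) (use 1 in auto)
    then show ?thesis using 1 by simp
  next
    case 2
    have "((\<lambda>s. (- s) powr (p - 1) * s) has_real_derivative - ((p - 1) * (- x) powr (p - 1 - 1)) * x + (- x) powr (p - 1)) (at x)"
      using 2 by (auto intro!: derivative_eq_intros)
    moreover have "- ((p - 1) * (- x) powr (p - 1 - 1)) * x + (- x) powr (p - 1) = p * (- x) powr (p - 1)"
      using 2 by (simp add: powr_diff field_simps power2_eq_square)
    ultimately have "((\<lambda>s. (- s) powr (p - 1) * s) has_real_derivative p * (- x) powr (p - 1)) (at x)" by simp
    then have "((\<lambda>s. \<bar>s\<bar> powr (p - 1) * s) has_real_derivative p * (- x) powr (p - 1)) (at x)"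
      by (rule has_field_derivative_transform_within_open[where S = "{..<0}"]) (use 2 in auto)
    then show ?thesis using 2 by simp
  next
    case 3
    have "((\<lambda>h::real. \<bar>h\<bar> powr (p - 1)) \<longlongrightarrow> \<bar>0\<bar> powr (p - 1)) (at 0)"
      by (intro tendsto_powr' tendsto_intros) (use p in auto)
    then have "((\<lambda>h::real. \<bar>h\<bar> powr (p - 1)) \<longlongrightarrow> 0) (at 0)" using p by simp
    then have "((\<lambda>h. (\<bar>h\<bar> powr (p - 1) * h) / h) \<longlongrightarrow> 0) (at 0)"
      by (rule Lim_transform_eventually) (auto simp: eventually_at_filter)
    then show ?thesis using 3 p by (simp add: DERIV_def)
  qed
qed

section \<open>The Lane--Emden profile and its two companion solutions\<close>

text \<open>The radial profile in dimension \<open>n + 1\<close>, with \<open>g = r\<^sup>n u'\<close> and \<open>m\<close> nodal intervals.\<close>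
locale lane_emden_profile =
  fixes n :: nat and p a b :: real and u g :: "real \<Rightarrow> real" and m :: nat
  assumes p: "p > 1" and a: "0 < a" "a < b"
    and sol: "radial_sol n (\<lambda>r. \<bar>u r\<bar> powr (p - 1)) 0 a b u g"
    and ends: "u a = 0" "u b = 0"
    and zones: "finite (components {r\<in>{a<..<b}. u r \<noteq> 0})" "card (components {r\<in>{a<..<b}. u r \<noteq> 0}) = m"
    and m: "m \<ge> 1"
begin

abbreviation q :: "real \<Rightarrow> real" where "q r \<equiv> p * \<bar>u r\<bar> powr (p - 1)"

definition \<alpha> :: real where "\<alpha> = 2 / (p - 1)"

text \<open>The generator of the dilations \<open>u(r) \<mapsto> t\<^sup>\<alpha> u(tr)\<close>, which preserve the equation.\<close>
definition z :: "real \<Rightarrow> real" where "z r = r * (g r / r ^ n) + \<alpha> * u r"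

lemma alpha: "\<alpha> * p = \<alpha> + 2" "\<alpha> > 0"
  using p by (auto simp: \<alpha>_def field_simps)

lemma u_cont: "continuous_on {a..b} u" and g_cont: "continuous_on {a..b} g"
  using sl_sol_continuous sol unfolding radial_sol_def by blast+

lemma q_cont: "continuous_on {a..b} (\<lambda>r. p * \<bar>u r\<bar> powr (p - 1))"
  using p by (intro continuous_intros u_cont continuous_on_powr') auto

lemma q1_cont: "continuous_on {a..b} (\<lambda>r. \<bar>u r\<bar> powr (p - 1))"
  using p by (intro continuous_intros u_cont continuous_on_powr') auto

lemma powpos: "r \<in> {a..b} \<Longrightarrow> r ^ n > 0" using a by auto

lemma u_deriv: "r \<in> {a..b} \<Longrightarrow> (u has_real_derivative g r / r ^ n) (at r within {a..b})"
  and g_deriv: "r \<in> {a..b} \<Longrightarrow> (g has_real_derivative - (r ^ n * (\<bar>u r\<bar> powr (p - 1) * u r))) (at r within {a..b})"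
  using sol unfolding radial_sol_def sl_sol_def by (auto simp: mult.assoc)

lemma f_deriv:
  "r \<in> {a..b} \<Longrightarrow> ((\<lambda>r. \<bar>u r\<bar> powr (p - 1) * u r) has_real_derivative p * \<bar>u r\<bar> powr (p - 1) * (g r / r ^ n)) (at r within {a..b})"
  using DERIV_chain2[OF power_nonlinearity_derivative[OF p] u_deriv] .

lemma u_nontrivial: "\<exists>r\<in>{a..b}. u r \<noteq> 0"
proof -
  have "components {r\<in>{a<..<b}. u r \<noteq> 0} \<noteq> {}" using zones m by (metis card.empty not_one_le_zero)
  then have "{r\<in>{a<..<b}. u r \<noteq> 0} \<noteq> {}" by (metis components_empty)
  then show ?thesis by force
qed

lemma g_nonzero:
  assumes "r \<in> {a..b}" "u r = 0"
  shows "g r \<noteq> 0"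
proof -
  obtain c where c: "c \<in> {a..b}" "u c \<noteq> 0" using u_nontrivial by blast
  show ?thesis
    by (rule sl_sol_nontrivial[OF sol[unfolded radial_sol_def] powpos _ continuous_on_radial_coefficient[OF a(1) q1_cont] c assms])
       (auto intro!: continuous_intros)
qed

text \<open>Differentiating the equation for \<open>u\<close>: the term \<open>(n/r)' u' = -n/r\<^sup>2 u'\<close> appears as the spectral parameter \<open>-n\<close>. The
  geometric reason is that \<open>u' x\<^sub>i/|x|\<close>, a partial derivative of the solution, solves the linearized equation.\<close>
lemma deriv_sol: "radial_sol n q (- real n) a b (\<lambda>r. g r / r ^ n)
   (\<lambda>r. - (real n * g r / r) - r ^ n * (\<bar>u r\<bar> powr (p - 1) * u r))"
  unfolding radial_sol_def sl_sol_def
proof (intro ballI conjI)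
  fix r assume r: "r \<in> {a..b}"
  then have r0: "r \<noteq> 0" using a by auto
  define f where "f = \<bar>u r\<bar> powr (p - 1) * u r"
  define Q where "Q = \<bar>u r\<bar> powr (p - 1)"
  have "((\<lambda>r. g r / r ^ n) has_real_derivative ((- (r ^ n * f)) * r ^ n - g r * (real n * r ^ n / r)) / (r ^ n * r ^ n)) (at r within {a..b})"
    unfolding f_def by (rule DERIV_divide[OF g_deriv[OF r] power_real_derivative[OF r0]]) (use r0 in auto)
  moreover have "((- (r ^ n * f)) * r ^ n - g r * (real n * r ^ n / r)) / (r ^ n * r ^ n) = (- (real n * g r / r) - r ^ n * f) / r ^ n"
    using r0 by (simp add: field_simps)
  ultimately show "((\<lambda>r. g r / r ^ n) has_real_derivative (- (real n * g r / r) - r ^ n * (\<bar>u r\<bar> powr (p - 1) * u r)) / r ^ n) (at r within {a..b})"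
    by (simp add: f_def)
  have 1: "((\<lambda>r. real n * g r / r) has_real_derivative ((real n * (- (r ^ n * f))) * r - real n * g r * 1) / (r * r)) (at r within {a..b})"
    unfolding f_def by (intro DERIV_divide DERIV_cmult g_deriv[OF r] DERIV_ident r0)
  have 2: "((\<lambda>r. r ^ n * (\<bar>u r\<bar> powr (p - 1) * u r)) has_real_derivative real n * r ^ n / r * f + p * Q * (g r / r ^ n) * r ^ n) (at r within {a..b})"
    unfolding f_def Q_def by (intro DERIV_mult power_real_derivative[OF r0] f_deriv[OF r])
  have "- (((real n * (- (r ^ n * f))) * r - real n * g r * 1) / (r * r)) - (real n * r ^ n / r * f + p * Q * (g r / r ^ n) * r ^ n)
     = - (r ^ n * (p * Q + - real n / r\<^sup>2) * (g r / r ^ n))"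
    using r0 by (simp add: field_simps power2_eq_square)
  with DERIV_diff[OF DERIV_minus[OF 1] 2]
  show "((\<lambda>r. - (real n * g r / r) - r ^ n * (\<bar>u r\<bar> powr (p - 1) * u r)) has_real_derivative
     - (r ^ n * (p * \<bar>u r\<bar> powr (p - 1) + - real n / r\<^sup>2) * (g r / r ^ n))) (at r within {a..b})"
    by (simp add: Q_def)
qed

lemma z_deriv:
  assumes r: "r \<in> {a..b}"
  shows "(z has_real_derivative ((1 + \<alpha> - real n) * g r - r * r ^ n * (\<bar>u r\<bar> powr (p - 1) * u r)) / r ^ n) (at r within {a..b})"
proof -
  have r0: "r \<noteq> 0" using a r by auto
  define f where "f = \<bar>u r\<bar> powr (p - 1) * u r"
  have 1: "((\<lambda>r. g r / r ^ n) has_real_derivative (- (real n * g r / r) - r ^ n * f) / r ^ n) (at r within {a..b})"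
    using deriv_sol r unfolding radial_sol_def sl_sol_def f_def by blast
  have "(z has_real_derivative 1 * (g r / r ^ n) + (- (real n * g r / r) - r ^ n * f) / r ^ n * r + \<alpha> * (g r / r ^ n)) (at r within {a..b})"
    unfolding z_def by (intro DERIV_add DERIV_mult DERIV_cmult DERIV_ident 1 u_deriv[OF r])
  moreover have "1 * (g r / r ^ n) + (- (real n * g r / r) - r ^ n * f) / r ^ n * r + \<alpha> * (g r / r ^ n) = ((1 + \<alpha> - real n) * g r - r * r ^ n * f) / r ^ n"
    using r0 by (simp add: field_simps)
  ultimately show ?thesis by (simp add: f_def)
qed

text \<open>Holds because \<open>\<alpha> + 2 = \<alpha> p\<close>, the condition for dilations with weight \<open>\<alpha>\<close> to preserve the equation.\<close>
lemma scaling_sol: "radial_sol n q 0 a b z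
   (\<lambda>r. (1 + \<alpha> - real n) * g r - r * r ^ n * (\<bar>u r\<bar> powr (p - 1) * u r))"
  unfolding radial_sol_def sl_sol_def
proof (intro ballI conjI z_deriv)
  fix r assume r: "r \<in> {a..b}"
  then have r0: "r \<noteq> 0" using a by auto
  define f where "f = \<bar>u r\<bar> powr (p - 1) * u r"
  define Q where "Q = \<bar>u r\<bar> powr (p - 1)"
  have fQ: "f = Q * u r" by (simp add: f_def Q_def)
  have 2: "((\<lambda>r. r * r ^ n * (\<bar>u r\<bar> powr (p - 1) * u r)) has_real_derivative (1 * r ^ n + real n * r ^ n / r * r) * f + p * Q * (g r / r ^ n) * (r * r ^ n)) (at r within {a..b})"
    unfolding f_def Q_def by (intro DERIV_mult DERIV_ident power_real_derivative[OF r0] f_deriv[OF r])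
  have 1: "((\<lambda>r. (1 + \<alpha> - real n) * g r) has_real_derivative (1 + \<alpha> - real n) * - (r ^ n * f)) (at r within {a..b})"
    unfolding f_def by (intro DERIV_cmult g_deriv[OF r])
  have "(1 + \<alpha> - real n) * - (r ^ n * f) - ((1 * r ^ n + real n * r ^ n / r * r) * f + p * Q * (g r / r ^ n) * (r * r ^ n))
     = - (r ^ n * Q * ((\<alpha> + 2) * u r + p * (r * (g r / r ^ n))))"
    using r0 by (simp add: field_simps fQ)
  also have "\<dots> = - (r ^ n * (p * Q + 0 / r\<^sup>2) * z r)"
    unfolding alpha(1)[symmetric] by (simp add: z_def algebra_simps)
  finally have eq: "(1 + \<alpha> - real n) * - (r ^ n * f) - ((1 * r ^ n + real n * r ^ n / r * r) * f + p * Q * (g r / r ^ n) * (r * r ^ n)) = - (r ^ n * (p * Q + 0 / r\<^sup>2) * z r)" .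
  from DERIV_diff[OF 1 2, unfolded eq]
  show "((\<lambda>r. (1 + \<alpha> - real n) * g r - r * r ^ n * (\<bar>u r\<bar> powr (p - 1) * u r)) has_real_derivative
     - (r ^ n * (p * \<bar>u r\<bar> powr (p - 1) + 0 / r\<^sup>2) * z r)) (at r within {a..b})"
    by (simp add: Q_def)
qed

text \<open>With \<open>t = log r\<close> and \<open>y = r\<^sup>\<alpha> u\<close> (so that the derivative of \<open>y\<close> in \<open>t\<close> is \<open>r\<^sup>\<alpha> z\<close>), the equation becomes the autonomous
  \<open>y'' + (n-1-2\<alpha>) y' - c y + |y|\<^sup>p\<^sup>-\<^sup>1 y = 0\<close> with \<open>c = \<alpha>(n-1-\<alpha>)\<close>. This is its mechanical energy, kinetic plus
  potential, written in \<open>r\<close>.\<close>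
definition energy :: "real \<Rightarrow> real" where
  "energy r = r powr (2 * \<alpha>) * ((z r)\<^sup>2 / 2 - \<alpha> * (real n - 1 - \<alpha>) * (u r)\<^sup>2 / 2
     + r\<^sup>2 * (\<bar>u r\<bar> powr (p - 1) * u r * u r) / (p + 1))"

text \<open>The energy changes only through the damping \<open>n - 1 - 2\<alpha>\<close>, whose sign is fixed.\<close>
lemma energy_deriv:
  assumes r: "r \<in> {a..b}"
  shows "(energy has_real_derivative - (real n - 1 - 2 * \<alpha>) * (r powr (2 * \<alpha>) * (z r)\<^sup>2 / r)) (at r within {a..b})"
proof -
  have r0: "r > 0" using a r by auto
  define f where "f = \<bar>u r\<bar> powr (p - 1) * u r"
  define Q where "Q = \<bar>u r\<bar> powr (p - 1)"
  define U where "U = u r" define U' where "U' = g r / r ^ n"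
  define c where "c = \<alpha> * (real n - 1 - \<alpha>)"
  define Z' where "Z' = (1 + \<alpha> - real n) * U' - r * (Q * U)"
  have fQ: "f = Q * U" by (simp add: f_def Q_def U_def)
  have zU: "z r = r * U' + \<alpha> * U" by (simp add: z_def U_def U'_def)
  have dz: "(z has_real_derivative Z') (at r within {a..b})"
    using z_deriv[OF r] r0 by (simp add: Z'_def U'_def U_def Q_def diff_divide_distrib)
  have du: "(u has_real_derivative U') (at r within {a..b})" using u_deriv[OF r] by (simp add: U'_def)
  have df: "((\<lambda>r. \<bar>u r\<bar> powr (p - 1) * u r) has_real_derivative p * Q * U') (at r within {a..b})"
    using f_deriv[OF r] by (simp add: U'_def Q_def)
  have dr: "((\<lambda>r. r powr (2 * \<alpha>)) has_real_derivative 2 * \<alpha> * r powr (2 * \<alpha>) / r) (at r within {a..b})"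
    using r0 by (auto intro!: derivative_eq_intros simp: powr_diff)
  have p1: "p + 1 \<noteq> 0" using p by simp
  define fn where "fn r = \<bar>u r\<bar> powr (p - 1) * u r" for r
  define k where "k = 1 / (p + 1)"
  have k: "k * (p + 1) = 1" using p1 by (simp add: k_def)
  \<comment> \<open>The weight \<open>\<alpha>\<close> is the one for which the potential term scales like the kinetic term.\<close>
  have "2 * \<alpha> * k + 2 * k = (\<alpha> + (\<alpha> + 2)) * k" by (simp add: algebra_simps)
  also have "\<dots> = \<alpha> * (k * (p + 1))" unfolding alpha(1)[symmetric] by (simp add: algebra_simps)
  finally have coeff: "2 * \<alpha> * k + 2 * k = \<alpha>" unfolding k by simp
  have e1: "((\<lambda>r. (z r)\<^sup>2 / 2) has_real_derivative z r * Z') (at r within {a..b})"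
    by (rule DERIV_cong[OF DERIV_cdivide[OF DERIV_power[OF dz]]]) simp
  have e2: "((\<lambda>r. c * (u r)\<^sup>2 / 2) has_real_derivative c * U * U') (at r within {a..b})"
    by (rule DERIV_cong[OF DERIV_cdivide[OF DERIV_cmult[OF DERIV_power[OF du]]]]) (simp add: U_def)
  have e3: "((\<lambda>r. fn r * u r) has_real_derivative (p + 1) * (Q * U * U')) (at r within {a..b})"
    by (rule DERIV_cong[OF DERIV_mult[OF df[folded fn_def] du]])
       (use fQ in \<open>simp add: U_def f_def fn_def algebra_simps\<close>)
  have e4: "((\<lambda>r. r\<^sup>2 * (fn r * u r)) has_real_derivative 2 * r * (Q * U * U) + r\<^sup>2 * ((p + 1) * (Q * U * U'))) (at r within {a..b})"
    by (rule DERIV_cong[OF DERIV_mult[OF DERIV_power[OF DERIV_ident] e3]])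
       (use fQ in \<open>simp add: U_def f_def fn_def\<close>)
  have E1: "((\<lambda>r. (z r)\<^sup>2 / 2 - c * (u r)\<^sup>2 / 2 + r\<^sup>2 * (fn r * u r) * k)
     has_real_derivative z r * Z' - c * U * U' + (2 * r * (Q * U * U) + r\<^sup>2 * ((p + 1) * (Q * U * U'))) * k) (at r within {a..b})"
    by (intro DERIV_add DERIV_diff e1 e2 DERIV_cmult_right e4)
  have E2: "(energy has_real_derivative 2 * \<alpha> * r powr (2 * \<alpha>) / r * ((z r)\<^sup>2 / 2 - c * U\<^sup>2 / 2 + r\<^sup>2 * (f * U) * k)
     + (z r * Z' - c * U * U' + (2 * r * (Q * U * U) + r\<^sup>2 * ((p + 1) * (Q * U * U'))) * k) * r powr (2 * \<alpha>)) (at r within {a..b})"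
  proof -
    have "energy = (\<lambda>r. r powr (2 * \<alpha>) * ((z r)\<^sup>2 / 2 - c * (u r)\<^sup>2 / 2 + r\<^sup>2 * (fn r * u r) * k))"
      by (rule ext) (simp only: energy_def c_def fn_def k_def times_divide_eq_right mult_1_right)
    then show ?thesis using DERIV_mult[OF dr E1] by (simp only: U_def f_def fn_def)
  qed
  define Y where "Y = z r * Z' - c * U * U' + (2 * r * (Q * U * U) + r\<^sup>2 * ((p + 1) * (Q * U * U'))) * k"
  define X where "X = (z r)\<^sup>2 / 2 - c * U\<^sup>2 / 2 + r\<^sup>2 * (f * U) * k"
  have Y: "Y = z r * Z' - c * U * U' + 2 * r * (Q * U * U) * k + r\<^sup>2 * (Q * U * U')"
  proof -
    have "(2 * r * (Q * U * U) + r\<^sup>2 * ((p + 1) * (Q * U * U'))) * k = 2 * r * (Q * U * U) * k + r\<^sup>2 * (Q * U * U') * (k * (p + 1))"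
      by (simp only: algebra_simps)
    then show ?thesis unfolding Y_def k by simp
  qed
  have "2 * \<alpha> * X + r * Y = \<alpha> * (z r)\<^sup>2 - \<alpha> * c * U\<^sup>2 + (z r * (r * Z') - c * U * (r * U')) + r\<^sup>2 * (Q * U * (r * U'))
     + (2 * \<alpha> * k + 2 * k) * (r\<^sup>2 * (Q * U\<^sup>2))"
    unfolding X_def Y fQ by (simp add: algebra_simps power2_eq_square)
  also have "\<dots> = - (real n - 1 - 2 * \<alpha>) * (z r)\<^sup>2"
    unfolding coeff zU Z'_def c_def by (simp add: algebra_simps power2_eq_square)
  finally have XY: "2 * \<alpha> * X + r * Y = - (real n - 1 - 2 * \<alpha>) * (z r)\<^sup>2" .
  have "2 * \<alpha> * r powr (2 * \<alpha>) / r * X + Y * r powr (2 * \<alpha>) = (2 * \<alpha> * X + r * Y) * (r powr (2 * \<alpha>) / r)"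
    using r0 by (simp add: distrib_right add_divide_distrib)
  also have "\<dots> = - (real n - 1 - 2 * \<alpha>) * (r powr (2 * \<alpha>) * (z r)\<^sup>2 / r)"
    unfolding XY by simp
  finally show ?thesis using E2 unfolding X_def[symmetric] Y_def[symmetric] by simp
qed

end

section \<open>The negative radial spectrum\<close>

context lane_emden_profile
begin

abbreviation eigenfunction :: "real \<Rightarrow> (real \<Rightarrow> real) \<Rightarrow> (real \<Rightarrow> real) \<Rightarrow> bool" where
  "eigenfunction \<nu> \<phi> h \<equiv> radial_sol n q \<nu> a b \<phi> h \<and> \<phi> a = 0 \<and> \<phi> b = 0 \<and> (\<exists>r\<in>{a<..<b}. \<phi> r \<noteq> 0)"

lemma z_nonzero_at_node:
  assumes "r \<in> {a..b}" "u r = 0"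
  shows "z r \<noteq> 0"
  using g_nonzero[OF assms] assms a powpos[of r] by (auto simp: z_def)

text \<open>The energy is monotone, in one direction or the other, and at both ends it is purely kinetic and positive.\<close>
lemma energy_pos:
  assumes r: "r \<in> {a..b}"
  shows "energy r > 0"
proof -
  have node: "energy s > 0" if "s \<in> {a, b}" for s
    using that z_nonzero_at_node[of s] ends a by (auto simp: energy_def)
  have ci: "continuous_on {a..b} energy" using energy_deriv by (intro DERIV_continuous_on) blast
  have d: "(energy has_real_derivative - (real n - 1 - 2 * \<alpha>) * (x powr (2 * \<alpha>) * (z x)\<^sup>2 / x)) (at x)"
    if "a < x" "x < b" for x
    using energy_deriv[of x] that at_within_interior[of x "{a..b}"] by simp
  have nn: "x powr (2 * \<alpha>) * (z x)\<^sup>2 / x \<ge> 0" if "a < x" for x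
    using that a by (intro divide_nonneg_nonneg mult_nonneg_nonneg) auto
  show ?thesis
  proof (cases "real n - 1 - 2 * \<alpha> \<ge> 0")
    case True
    have "energy b \<le> energy r"
    proof (rule DERIV_nonpos_imp_decreasing_open[of r b energy])
      fix x assume "r < x" "x < b"
      then have x: "a < x" "x < b" using r by auto
      show "\<exists>y. (energy has_real_derivative y) (at x) \<and> y \<le> 0"
        using d[OF x] mult_nonpos_nonneg[OF _ nn[OF x(1)]] True by (metis neg_le_0_iff_le)
    qed (use r ci in \<open>auto elim: continuous_on_subset\<close>)
    then show ?thesis using node[of b] by simp
  next
    case False
    have "energy a \<le> energy r"
    proof (rule DERIV_nonneg_imp_increasing_open[of a r energy])
      fix x assume "a < x" "x < r"
      then have x: "a < x" "x < b" using r by auto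
      show "\<exists>y. (energy has_real_derivative y) (at x) \<and> 0 \<le> y"
        using d[OF x] mult_nonneg_nonneg[OF _ nn[OF x(1)]] False by (metis neg_0_le_iff_le le_cases)
    qed (use r ci in \<open>auto elim: continuous_on_subset\<close>)
    then show ?thesis using node[of a] by simp
  qed
qed

text \<open>A zero of \<open>z\<close> is a critical point of \<open>y = r\<^sup>\<alpha> u\<close> in the variable \<open>log r\<close>. Positive energy there means \<open>|y|\<^sup>p\<^sup>-\<^sup>1 > c(p+1)/2\<close>,
  hence \<open>|y|\<^sup>p\<^sup>-\<^sup>1 > c\<close> whatever the sign of \<open>c\<close>, so \<open>y'' = cy - |y|\<^sup>p\<^sup>-\<^sup>1 y\<close> has the sign opposite to \<open>y\<close>: every critical point
  of \<open>|y|\<close> is a strict maximum.\<close>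
lemma z_slope:
  assumes r: "r \<in> {a..b}" and z0: "z r = 0"
  shows "\<exists>d. (z has_real_derivative d) (at r within {a..b}) \<and> d * u r < 0"
proof -
  have r0: "r > 0" using a r by auto
  define Q where "Q = \<bar>u r\<bar> powr (p - 1)"
  define U' where "U' = g r / r ^ n"
  define c where "c = \<alpha> * (real n - 1 - \<alpha>)"
  define d where "d = (1 + \<alpha> - real n) * U' - r * (Q * u r)"
  have dz: "(z has_real_derivative d) (at r within {a..b})"
    using z_deriv[OF r] r0 by (simp add: d_def U'_def Q_def diff_divide_distrib)
  have un: "u r \<noteq> 0" using z_nonzero_at_node[OF r] z0 by blast
  then have Q0: "Q > 0" "(u r)\<^sup>2 > 0" by (auto simp: Q_def)
  have "energy r = r powr (2 * \<alpha>) * ((r\<^sup>2 * Q / (p + 1) - c / 2) * (u r)\<^sup>2)"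
    using z0 by (simp add: energy_def Q_def c_def algebra_simps power2_eq_square)
  then have "r\<^sup>2 * Q / (p + 1) - c / 2 > 0"
    using energy_pos[OF r] r0 Q0 by (simp add: zero_less_mult_iff)
  then have 1: "r\<^sup>2 * Q > c * ((p + 1) / 2)" using p by (simp add: field_simps)
  have "r\<^sup>2 * Q > c"
  proof (cases "c > 0")
    case True
    then have "c * 1 \<le> c * ((p + 1) / 2)" using p by (intro mult_left_mono) auto
    then show ?thesis using 1 by linarith
  next
    case False
    moreover have "r\<^sup>2 * Q > 0" using Q0 r0 by simp
    ultimately show ?thesis by linarith
  qed
  then have "(c - r\<^sup>2 * Q) * (u r)\<^sup>2 < 0" using Q0 by (simp add: mult_less_0_iff)
  have "r * U' = - \<alpha> * u r" using z0 by (simp add: z_def U'_def)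
  moreover have "r * d = (1 + \<alpha> - real n) * (r * U') - r\<^sup>2 * (Q * u r)"
    unfolding d_def by (simp add: algebra_simps power2_eq_square)
  ultimately have rd: "r * d = (1 + \<alpha> - real n) * (- \<alpha> * u r) - r\<^sup>2 * (Q * u r)" by simp
  have "r * (d * u r) = r * d * u r" by simp
  also have "\<dots> = (c - r\<^sup>2 * Q) * (u r)\<^sup>2"
    unfolding rd by (simp add: c_def algebra_simps power2_eq_square)
  finally have "r * (d * u r) = (c - r\<^sup>2 * Q) * (u r)\<^sup>2" .
  with \<open>(c - r\<^sup>2 * Q) * (u r)\<^sup>2 < 0\<close> have "r * (d * u r) < 0" by simp
  then have "d * u r < 0" using r0 by (metis mult_less_0_iff not_less_iff_gr_or_eq)
  then show ?thesis using dz by blast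
qed

text \<open>Between two zeros of \<open>u\<close> the product \<open>-z u\<close> can only cross zero upwards.\<close>
lemma z_zero_unique:
  assumes x: "a \<le> x" "x < y" "y \<le> b" and nz: "\<And>r. r \<in> {x..y} \<Longrightarrow> u r \<noteq> 0" and z: "z x = 0" "z y = 0"
  shows False
proof -
  have zc: "continuous_on {x..y} z"
    using continuous_on_subset[OF sl_sol_continuous(1)[OF scaling_sol[unfolded radial_sol_def]], of "{x..y}"] x by auto
  have "0 < - (z y * u y)"
  proof (rule crosses_upwards_once[OF x(2), of "\<lambda>r. - (z r * u r)"])
    show "continuous_on {x..y} (\<lambda>r. - (z r * u r))"
      using zc u_cont x by (auto intro!: continuous_intros elim: continuous_on_subset)
    fix r assume r: "r \<in> {x..y}" "- (z r * u r) = 0"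
    then have z0: "z r = 0" using nz by auto
    have rab: "r \<in> {a..b}" using r x by auto
    obtain d where d: "(z has_real_derivative d) (at r within {a..b})" "d * u r < 0"
      using z_slope[OF rab z0] by blast
    have "((\<lambda>r. - (z r * u r)) has_real_derivative - (d * u r + g r / r ^ n * z r)) (at r within {a..b})"
      by (intro DERIV_minus DERIV_mult d u_deriv rab)
    then have "((\<lambda>r. - (z r * u r)) has_real_derivative - (d * u r + g r / r ^ n * z r)) (at r within {x..y})"
      by (rule DERIV_subset) (use x in auto)
    then show "\<exists>d>0. ((\<lambda>r. - (z r * u r)) has_real_derivative d) (at r within {x..y})"
      using d(2) z0 by (intro exI[of _ "- (d * u r)"]) auto
  qed (use z in auto)
  then show False using z by simp
qed

text \<open>Every zero of \<open>z\<close> lies in a nodal interval, since \<open>u'\<close> does not vanish at the nodes, and no nodal interval contains two.\<close>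
lemma z_zeros_card:
  assumes F: "finite F" "F \<subseteq> {a..b}" "\<And>r. r \<in> F \<Longrightarrow> z r = 0"
  shows "card F \<le> m"
proof -
  define U where "U = {r\<in>{a<..<b}. u r \<noteq> 0}"
  have FU: "r \<in> U" if "r \<in> F" for r
  proof -
    have "r \<in> {a..b}" "u r \<noteq> 0" using F that z_nonzero_at_node by blast+
    moreover from this have "r \<noteq> a" "r \<noteq> b" using ends by auto
    ultimately show ?thesis by (auto simp: U_def)
  qed
  have "inj_on (connected_component_set U) F"
  proof (rule linorder_inj_onI)
    fix x y assume xy: "x < y" "x \<in> F" "y \<in> F"
    show "connected_component_set U x \<noteq> connected_component_set U y"
    proof
      assume "connected_component_set U x = connected_component_set U y"
      then have "connected_component U x y"
        using FU[OF xy(3)] by (metis connected_component_refl mem_Collect_eq)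
      then obtain T where T: "connected T" "T \<subseteq> U" "x \<in> T" "y \<in> T"
        unfolding connected_component_def by blast
      then have "{x..y} \<subseteq> U" by (meson connected_contains_Icc subset_trans)
      then have "\<And>r. r \<in> {x..y} \<Longrightarrow> u r \<noteq> 0" by (auto simp: U_def)
      then show False using z_zero_unique[of x y] xy F by (meson atLeastAtMost_iff subsetD)
    qed
  qed (use linorder_linear in auto)
  moreover have "connected_component_set U ` F \<subseteq> components U"
    using FU by (auto simp: components_def)
  ultimately show ?thesis using card_inj_on_le[of _ F "components U"] zones by (simp add: U_def)
qed

lemma zero_in_each_nodal_interval:
  assumes Q: "\<And>s t. a \<le> s \<Longrightarrow> s < t \<Longrightarrow> t \<le> b \<Longrightarrow> u s = 0 \<Longrightarrow> u t = 0 \<Longrightarrow> (\<forall>r\<in>{s<..<t}. u r \<noteq> 0) \<Longrightarrow>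
    \<exists>r\<in>{s<..<t}. Q r"
  shows "\<exists>F. finite F \<and> card F = m \<and> F \<subseteq> {a<..<b} \<and> (\<forall>r\<in>F. Q r)"
proof -
  define C where "C = components {r\<in>{a<..<b}. u r \<noteq> 0}"
  have "\<exists>r\<in>D. Q r" if "D \<in> C" for D
    using components_open_interval[OF u_cont ends that[unfolded C_def]] Q by blast
  then obtain r where r: "\<And>D. D \<in> C \<Longrightarrow> r D \<in> D \<and> Q (r D)" by metis
  have "inj_on r C"
  proof (rule inj_onI)
    fix D E assume "D \<in> C" "E \<in> C" "r D = r E"
    then have "D \<inter> E \<noteq> {}" using r by (metis IntI empty_iff)
    then show "D = E" using \<open>D \<in> C\<close> \<open>E \<in> C\<close> components_eq unfolding C_def by blast
  qed
  then have "card (r ` C) = m" using zones by (simp add: card_image C_def)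
  moreover have "r ` C \<subseteq> {a<..<b}"
  proof
    fix x assume "x \<in> r ` C"
    then obtain D where "D \<in> C" "x = r D" by blast
    then show "x \<in> {a<..<b}" using r[of D] in_components_subset[of D] unfolding C_def by blast
  qed
  ultimately show ?thesis using r zones by (intro exI[of _ "r ` C"]) (auto simp: C_def)
qed

lemma eigenfunction_slope_nonzero:
  assumes "radial_sol n q \<nu> a b \<phi> h" "\<phi> a = 0" "\<exists>r\<in>{a..b}. \<phi> r \<noteq> 0"
  shows "h a \<noteq> 0"
proof -
  obtain c where c: "c \<in> {a..b}" "\<phi> c \<noteq> 0" using assms(3) by blast
  show ?thesis
    by (rule sl_sol_nontrivial[OF assms(1)[unfolded radial_sol_def] powpos _
          continuous_on_radial_coefficient[OF a(1) q_cont] c])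
       (use assms a in \<open>auto intro!: continuous_intros\<close>)
qed

text \<open>The zeros of \<open>\<phi>\<close>, with the two end points added, leave \<open>card F + 1\<close> gaps, each of which contains a zero of \<open>z\<close>. For
  \<open>\<nu> = 0\<close> the two solutions are independent because \<open>z(a) \<noteq> 0\<close>.\<close>
lemma z_zeros_between:
  assumes \<phi>: "eigenfunction \<nu> \<phi> h" and \<nu>: "\<nu> \<le> 0"
    and F: "finite F" "F \<subseteq> {a<..<b}" "\<And>r. r \<in> F \<Longrightarrow> \<phi> r = 0"
  shows "card F + 1 \<le> m"
proof -
  have nz: "\<exists>r\<in>{a..b}. \<phi> r \<noteq> 0" using \<phi> by force
  have ha: "h a \<noteq> 0" using eigenfunction_slope_nonzero \<phi> nz by blast
  have "z a \<noteq> 0" using z_nonzero_at_node[of a] ends a by auto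
  then have W: "\<nu> < 0 \<or> \<nu> = 0 \<and> h a * z a - \<phi> a * ((1 + \<alpha> - real n) * g a - a * a ^ n * (\<bar>u a\<bar> powr (p - 1) * u a)) \<noteq> 0"
    using ha \<nu> \<phi> by auto
  define F' where "F' = insert a (insert b F)"
  have "a \<notin> F" "b \<notin> F" using F(2) by auto
  then have fin: "finite F'" and card: "card F' = Suc (card F + 1)" using F(1) a by (auto simp: F'_def)
  have "\<exists>x\<in>{s<..<t}. z x = 0" if "s \<in> F'" "t \<in> F'" "s < t" for s t
    by (rule radial_sol_sturm[OF a(1) q_cont conjunct1[OF \<phi>] scaling_sol nz W]) (use that \<phi> F a in \<open>auto simp: F'_def\<close>)
  from finite_gap_points[OF fin card this] obtain G where
    G: "finite G" "card G = card F + 1" "G \<subseteq> {Min F'<..<Max F'}" "\<forall>x\<in>G. z x = 0" by auto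
  have "Min F' \<ge> a" "Max F' \<le> b" using fin F a by (auto simp: F'_def)
  then have "G \<subseteq> {a..b}" using G(3) by (auto dest!: subsetD[OF G(3)])
  then show ?thesis using z_zeros_card[OF G(1)] G by auto
qed

text \<open>The coefficient \<open>p|u|\<^sup>p\<^sup>-\<^sup>1\<close> beats the coefficient \<open>|u|\<^sup>p\<^sup>-\<^sup>1\<close> of the equation for \<open>u\<close> itself, so \<open>\<phi>\<close> would vanish in each of
  the \<open>m\<close> nodal intervals, and \<open>z\<close> would have \<open>m + 1\<close> zeros.\<close>
lemma zero_not_eigenvalue: "\<not> eigenfunction 0 \<phi> h"
proof
  assume \<phi>: "eigenfunction 0 \<phi> h"
  have "\<exists>F. finite F \<and> card F = m \<and> F \<subseteq> {a<..<b} \<and> (\<forall>r\<in>F. \<phi> r = 0)"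
  proof (rule zero_in_each_nodal_interval)
    fix s t assume st: "a \<le> s" "s < t" "t \<le> b" "u s = 0" "u t = 0" and nz: "\<forall>r\<in>{s<..<t}. u r \<noteq> 0"
    obtain c where c: "c \<in> {a..b}" "u c \<noteq> 0" using u_nontrivial by blast
    have lt: "r ^ n * (\<bar>u r\<bar> powr (p - 1) + 0 / r\<^sup>2) < r ^ n * (p * \<bar>u r\<bar> powr (p - 1) + 0 / r\<^sup>2)" if "s < r" "r < t" for r
    proof -
      have "r ^ n > 0" using that st powpos[of r] by auto
      moreover have "1 * \<bar>u r\<bar> powr (p - 1) < p * \<bar>u r\<bar> powr (p - 1)"
        using p nz that by (intro mult_strict_right_mono) auto
      ultimately show ?thesis by simp
    qed
    show "\<exists>r\<in>{s<..<t}. \<phi> r = 0"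
      by (rule sturm_comparison[OF sol[unfolded radial_sol_def] \<phi>[THEN conjunct1, unfolded radial_sol_def] powpos _
            continuous_on_radial_coefficient[OF a(1) q1_cont] st c(2,1)])
         (use lt in \<open>auto intro!: continuous_intros intro: less_imp_le\<close>)
  qed
  then show False using z_zeros_between[OF \<phi>] by fastforce
qed

definition spectrum :: "real set" where "spectrum = {\<nu>. \<exists>\<phi> h. eigenfunction \<nu> \<phi> h}"

text \<open>By comparison each step up in the spectrum adds an interior zero.\<close>
lemma eigenfunction_zeros:
  assumes "finite T" "card T = Suc k" "T \<subseteq> spectrum" "eigenfunction (Max T) \<phi> h"
  shows "\<exists>F. finite F \<and> card F = k \<and> F \<subseteq> {a<..<b} \<and> (\<forall>r\<in>F. \<phi> r = 0)"
  using assms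
proof (induction k arbitrary: T \<phi> h)
  case 0
  then show ?case by (intro exI[of _ "{}"]) auto
next
  case (Suc k)
  define M where "M = Max T"
  define T1 where "T1 = T - {M}"
  have MT: "M \<in> T" using Suc.prems by (auto simp: M_def intro!: Max_in)
  have T1: "finite T1" "card T1 = Suc k" using Suc.prems MT by (auto simp: T1_def)
  then have M1: "Max T1 \<in> T1" by (intro Max_in) auto
  then have lt: "Max T1 < M"
    using Suc.prems(1) by (auto simp: T1_def M_def order.strict_iff_order)
  obtain \<psi> k1 where \<psi>: "eigenfunction (Max T1) \<psi> k1"
    using M1 Suc.prems(3) unfolding T1_def spectrum_def by blast
  obtain F where F: "finite F" "card F = k" "F \<subseteq> {a<..<b}" "\<forall>r\<in>F. \<psi> r = 0"
    using Suc.IH[OF T1 _ \<psi>] Suc.prems(3) by (auto simp: T1_def)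
  define F' where "F' = insert a (insert b F)"
  have "a \<notin> F" "b \<notin> F" using F(3) by auto
  then have fin: "finite F'" and card: "card F' = Suc (k + 1)" using F(1,2) a by (auto simp: F'_def)
  have nz: "\<exists>r\<in>{a..b}. \<psi> r \<noteq> 0" using \<psi> by force
  have "\<exists>x\<in>{s<..<t}. \<phi> x = 0" if "s \<in> F'" "t \<in> F'" "s < t" for s t
    by (rule radial_sol_sturm[OF a(1) q_cont conjunct1[OF \<psi>] conjunct1[OF Suc.prems(4)] nz])
       (use that \<psi> F a lt in \<open>auto simp: F'_def M_def\<close>)
  from finite_gap_points[OF fin card this] obtain G where
    G: "finite G" "card G = k + 1" "G \<subseteq> {Min F'<..<Max F'}" "\<forall>x\<in>G. \<phi> x = 0" by auto
  have "Min F' \<ge> a" "Max F' \<le> b" using fin F a by (auto simp: F'_def)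
  then have "{Min F'<..<Max F'} \<subseteq> {a<..<b}" by auto
  then show ?case using G by (intro exI[of _ G]) auto
qed

lemma nonpositive_spectrum_card:
  assumes T: "finite T" "T \<subseteq> spectrum" "\<And>\<nu>. \<nu> \<in> T \<Longrightarrow> \<nu> \<le> 0"
  shows "card T \<le> m"
proof (cases "T = {}")
  case False
  then obtain k where k: "card T = Suc k" using T(1) by (metis card_0_eq not0_implies_Suc)
  have MT: "Max T \<in> T" using T False by simp
  obtain \<phi> h where \<phi>: "eigenfunction (Max T) \<phi> h" using MT T(2) unfolding spectrum_def by blast
  obtain F where F: "finite F" "card F = k" "F \<subseteq> {a<..<b}" "\<forall>r\<in>F. \<phi> r = 0"
    using eigenfunction_zeros[OF T(1) k T(2) \<phi>] by blast
  then show ?thesis using z_zeros_between[OF \<phi> T(3)[OF MT] F(1,3)] k by auto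
qed simp

lemma nonpositive_spectrum:
  "finite {\<nu>\<in>spectrum. \<nu> \<le> 0}" "card {\<nu>\<in>spectrum. \<nu> \<le> 0} \<le> m"
proof -
  show fin: "finite {\<nu>\<in>spectrum. \<nu> \<le> 0}"
  proof (rule ccontr)
    assume "\<not> ?thesis"
    then obtain T where "finite T" "card T = Suc m" "T \<subseteq> {\<nu>\<in>spectrum. \<nu> \<le> 0}"
      using infinite_arbitrarily_large by blast
    then show False using nonpositive_spectrum_card[of T] by auto
  qed
  show "card {\<nu>\<in>spectrum. \<nu> \<le> 0} \<le> m" by (rule nonpositive_spectrum_card[OF fin]) auto
qed

text \<open>By Rolle \<open>u'\<close> has a zero in each nodal interval, and an eigenfunction for \<open>-n\<close> solves the same equation as \<open>u'\<close>. So it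
  has at least \<open>m - 1\<close> interior zeros, and these give \<open>m - 1\<close> smaller eigenvalues.\<close>
lemma translation_eigenvalue_index:
  assumes "- real n \<in> spectrum"
  shows "m \<le> card {\<nu>\<in>spectrum. \<nu> \<le> - real n}"
proof -
  obtain \<phi> h where \<phi>: "eigenfunction (- real n) \<phi> h" using assms unfolding spectrum_def by blast
  have nz: "\<exists>r\<in>{a..b}. \<phi> r \<noteq> 0" using \<phi> by force
  have ha: "h a \<noteq> 0" using eigenfunction_slope_nonzero \<phi> nz by blast
  have ga: "g a / a ^ n \<noteq> 0" using g_nonzero[of a] ends a by auto
  \<comment> \<open>Rolle, applied to \<open>u\<close> in each nodal interval; \<open>g r / r ^ n\<close> is \<open>u'\<close>.\<close>
  have "\<exists>F. finite F \<and> card F = m \<and> F \<subseteq> {a<..<b} \<and> (\<forall>r\<in>F. g r / r ^ n = 0)"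
  proof (rule zero_in_each_nodal_interval)
    fix s t assume st: "a \<le> s" "s < t" "t \<le> b" "u s = 0" "u t = 0" and nz: "\<forall>r\<in>{s<..<t}. u r \<noteq> 0"
    have d: "(u has_real_derivative g r / r ^ n) (at r)" if "s < r" "r < t" for r
      using u_deriv[of r] that st at_within_interior[of r "{a..b}"] by simp
    have "\<exists>r>s. r < t \<and> (*) (g r / r ^ n) = (\<lambda>v. 0)"
      by (rule Rolle_deriv[OF st(2), of u])
         (use st d u_cont in \<open>auto simp: has_field_derivative_def elim: continuous_on_subset\<close>)
    then obtain r where "s < r" "r < t" "(*) (g r / r ^ n) = (\<lambda>v. 0)" by blast
    then show "\<exists>r\<in>{s<..<t}. g r / r ^ n = 0" by (intro bexI[of _ r]) (auto dest: fun_cong[of _ _ 1])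
  qed
  then obtain F where F: "finite F" "card F = m" "F \<subseteq> {a<..<b}" "\<forall>r\<in>F. g r / r ^ n = 0" by blast
  obtain k where k: "m = Suc k" using m by (cases m) auto
  have cF: "card F = Suc k" using F k by simp
  have gap: "\<exists>x\<in>{s<..<t}. \<phi> x = 0" if "s \<in> F" "t \<in> F" "s < t" for s t
    by (rule radial_sol_sturm[OF a(1) q_cont deriv_sol conjunct1[OF \<phi>]])
       (use that \<phi> F a ha ga in auto)
  from finite_gap_points[OF F(1) cF gap] obtain G where
    G: "finite G" "card G = k" "G \<subseteq> {Min F<..<Max F}" "\<forall>x\<in>G. \<phi> x = 0" by auto
  have "F \<noteq> {}" using cF by auto
  then have "Min F \<in> {a<..<b}" "Max F \<in> {a<..<b}" using F(1,3) Min_in Max_in by blast+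
  then have "{Min F<..<Max F} \<subseteq> {a<..<b}" using F(3) by auto
  then have Gab: "G \<subseteq> {a<..<b}" using G(3) by blast
  obtain S where S: "finite S" "card S = card G" "\<forall>\<nu>\<in>S. \<nu> < - real n \<and> (\<exists>\<phi> g. eigenfunction \<nu> \<phi> g)"
    using eigenvalues_below_from_zeros[OF a q_cont conjunct1[OF \<phi>] _ nz G(1) Gab] G(4) \<phi> by blast
  have sub: "insert (- real n) S \<subseteq> {\<nu>\<in>spectrum. \<nu> \<le> - real n}"
    using S(3) assms unfolding spectrum_def by force
  have "card (insert (- real n) S) = m" using S G k by (subst card_insert_disjoint) auto
  moreover have "finite {\<nu>\<in>spectrum. \<nu> \<le> - real n}"
    by (rule finite_subset[OF _ nonpositive_spectrum(1)]) auto
  ultimately show ?thesis using card_mono[OF _ sub] by metis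
qed

lemma spectrum_iff: "radial_eigenvalue (Suc n) p a b u \<nu> \<longleftrightarrow> \<nu> \<in> spectrum"
  unfolding spectrum_def radial_eigenvalue_iff[OF a q_cont] by simp

theorem negative_eigenvalue_index:
  assumes "radial_eigenvalue (Suc n) p a b u \<nu>" "\<nu> \<le> 0"
  shows "\<exists>l\<in>{1..m}. nth_radial_eigenvalue (Suc n) p a b u l \<nu>"
proof -
  define S where "S = {\<mu>. radial_eigenvalue (Suc n) p a b u \<mu> \<and> \<mu> \<le> \<nu>}"
  have sub: "S \<subseteq> {\<nu>\<in>spectrum. \<nu> \<le> 0}" using assms(2) by (auto simp: S_def spectrum_iff)
  have "finite S" using finite_subset[OF sub nonpositive_spectrum(1)] .
  moreover have "card S \<le> m" using card_mono[OF nonpositive_spectrum(1) sub] nonpositive_spectrum(2) by simp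
  moreover have "\<nu> \<in> S" using assms by (simp add: S_def)
  then have "card S \<ge> 1" using \<open>finite S\<close> by (metis One_nat_def Suc_leI card_gt_0_iff empty_iff)
  ultimately show ?thesis using assms(1)
    by (intro bexI[of _ "card S"]) (auto simp: nth_radial_eigenvalue_def S_def)
qed

theorem translation_eigenvalue_nth:
  assumes "radial_eigenvalue (Suc n) p a b u (- real n)"
  shows "nth_radial_eigenvalue (Suc n) p a b u m (- real n)"
proof -
  obtain l where l: "l \<in> {1..m}" "nth_radial_eigenvalue (Suc n) p a b u l (- real n)"
    using negative_eigenvalue_index[OF assms] by auto
  moreover have "m \<le> l"
    using translation_eigenvalue_index assms l(2) unfolding nth_radial_eigenvalue_def spectrum_iff by auto
  ultimately have "l = m" by simp
  then show ?thesis using l by simp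
qed

theorem zero_not_radial_eigenvalue: "\<not> radial_eigenvalue (Suc n) p a b u 0"
  unfolding spectrum_iff spectrum_def using zero_not_eigenvalue by blast

end

section \<open>Homogeneous polynomials and the Laplacian\<close>

lemma partial_deriv_eq: "(f has_derivative f') (at x) \<Longrightarrow> partial_deriv i f x = f' i"
  unfolding partial_deriv_def by (metis frechet_derivative_at)

lemma sum_Basis_inner_left:
  fixes F :: "'a::euclidean_space \<Rightarrow> real"
  assumes "i \<in> Basis"
  shows "(\<Sum>j\<in>Basis. (i \<bullet> j) * F j) = F i"
proof -
  have "(\<Sum>j\<in>Basis. (i \<bullet> j) * F j) = (\<Sum>j\<in>Basis. if j = i then F j else 0)"
    using assms by (intro sum.cong) (auto simp: inner_Basis)
  then show ?thesis using assms by simp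
qed

lemma sum_Basis_inner_inner: "(\<Sum>i\<in>Basis. (h \<bullet> i) * (i \<bullet> b)) = h \<bullet> b" for h b :: "'a::euclidean_space"
proof -
  have "(\<Sum>i\<in>Basis. (h \<bullet> i) * (i \<bullet> b)) = (\<Sum>i\<in>Basis. (h \<bullet> i) * (b \<bullet> i))"
    by (simp add: inner_commute)
  also have "\<dots> = h \<bullet> b" by (rule euclidean_inner[symmetric])
  finally show ?thesis .
qed

lemma has_derivative_partial_deriv:
  fixes f :: "'a::euclidean_space \<Rightarrow> real"
  assumes "f differentiable (at x)"
  shows "(f has_derivative (\<lambda>h. \<Sum>i\<in>Basis. (h \<bullet> i) * partial_deriv i f x)) (at x)"
proof -
  let ?D = "frechet_derivative f (at x)"
  have d: "(f has_derivative ?D) (at x)" using assms frechet_derivative_works by blast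
  then interpret bounded_linear ?D by (rule has_derivative_bounded_linear)
  have "?D h = (\<Sum>i\<in>Basis. (h \<bullet> i) * partial_deriv i f x)" for h
  proof -
    have "?D h = ?D (\<Sum>i\<in>Basis. (h \<bullet> i) *\<^sub>R i)" by (simp add: euclidean_representation)
    also have "\<dots> = (\<Sum>i\<in>Basis. (h \<bullet> i) * partial_deriv i f x)"
      by (simp add: sum scaleR partial_deriv_def)
    finally show ?thesis .
  qed
  then have "?D = (\<lambda>h. \<Sum>i\<in>Basis. (h \<bullet> i) * partial_deriv i f x)" by blast
  with d show ?thesis by metis
qed

text \<open>Derivatives are supplied as functions \<open>F\<close> and \<open>H\<close> that are only required to be derivatives inside \<open>S\<close>; outside \<open>S\<close> they
  may differ from the partial derivatives.\<close>
lemma C2_onI: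
  fixes f :: "'a::euclidean_space \<Rightarrow> real"
  assumes S: "open S"
    and f: "\<And>x. x \<in> S \<Longrightarrow> (f has_derivative (\<lambda>h. \<Sum>i\<in>Basis. (h \<bullet> i) * F i x)) (at x)"
    and F: "\<And>i x. i \<in> Basis \<Longrightarrow> x \<in> S \<Longrightarrow> (F i has_derivative (\<lambda>h. \<Sum>j\<in>Basis. (h \<bullet> j) * H j i x)) (at x)"
    and H: "\<And>i j. i \<in> Basis \<Longrightarrow> j \<in> Basis \<Longrightarrow> continuous_on S (H j i)"
  shows "C2_on S f" "\<And>x i. x \<in> S \<Longrightarrow> i \<in> Basis \<Longrightarrow> partial_deriv i f x = F i x"
    "\<And>x i j. x \<in> S \<Longrightarrow> i \<in> Basis \<Longrightarrow> j \<in> Basis \<Longrightarrow> partial_deriv j (partial_deriv i f) x = H j i x"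
    "\<And>x. x \<in> S \<Longrightarrow> laplacian f x = (\<Sum>i\<in>Basis. H i i x)"
proof -
  show 1: "partial_deriv i f x = F i x" if "x \<in> S" "i \<in> Basis" for x i
    using partial_deriv_eq[OF f[OF that(1)], of i] sum_Basis_inner_left[OF that(2)] by simp
  have 2: "(partial_deriv i f has_derivative (\<lambda>h. \<Sum>j\<in>Basis. (h \<bullet> j) * H j i x)) (at x)"
    if "x \<in> S" "i \<in> Basis" for x i
    by (rule has_derivative_transform_within_open[OF F[OF that(2,1)] S that(1)]) (use 1 that in auto)
  show 3: "partial_deriv j (partial_deriv i f) x = H j i x" if "x \<in> S" "i \<in> Basis" "j \<in> Basis" for x i j
    using partial_deriv_eq[OF 2[OF that(1,2)], of j] sum_Basis_inner_left[OF that(3)] by simp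
  show "laplacian f x = (\<Sum>i\<in>Basis. H i i x)" if "x \<in> S" for x
    unfolding laplacian_def using 3 that by (intro sum.cong) auto
  have "continuous_on S (partial_deriv j (partial_deriv i f))" if "i \<in> Basis" "j \<in> Basis" for i j
    using H[OF that] 3 that by (metis (no_types, lifting) continuous_on_cong)
  then show "C2_on S f"
    unfolding C2_on_def differentiable_on_def
    using f 2 by (meson differentiableI differentiable_at_imp_differentiable_on differentiable_at_withinI)
qed

lemma C2_on_derivatives:
  fixes f :: "'a::euclidean_space \<Rightarrow> real"
  assumes "C2_on S f" "open S" "x \<in> S"
  shows "(f has_derivative (\<lambda>h. \<Sum>i\<in>Basis. (h \<bullet> i) * partial_deriv i f x)) (at x)"
    "i \<in> Basis \<Longrightarrow> (partial_deriv i f has_derivative (\<lambda>h. \<Sum>j\<in>Basis. (h \<bullet> j) * partial_deriv j (partial_deriv i f) x)) (at x)"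
proof -
  have *: "g differentiable (at x)" if "g differentiable_on S" for g :: "'a \<Rightarrow> real"
    using that assms by (simp add: differentiable_on_eq_differentiable_at)
  show "(f has_derivative (\<lambda>h. \<Sum>i\<in>Basis. (h \<bullet> i) * partial_deriv i f x)) (at x)"
    using assms by (intro has_derivative_partial_deriv *) (auto simp: C2_on_def)
  show "(partial_deriv i f has_derivative (\<lambda>h. \<Sum>j\<in>Basis. (h \<bullet> j) * partial_deriv j (partial_deriv i f) x)) (at x)"
    if "i \<in> Basis"
    using assms that by (intro has_derivative_partial_deriv *) (auto simp: C2_on_def)
qed

text \<open>Homogeneous polynomials of a given degree, as functions. Building them by coordinate multiplication makes the
  stability under differentiation, with Euler's identity, an easy induction.\<close>
inductive hpoly :: "nat \<Rightarrow> ('a::euclidean_space \<Rightarrow> real) \<Rightarrow> bool" where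
  const: "hpoly 0 (\<lambda>x. c)"
| coord: "hpoly k p \<Longrightarrow> b \<in> Basis \<Longrightarrow> hpoly (Suc k) (\<lambda>x. (x \<bullet> b) * p x)"
| add: "hpoly k p \<Longrightarrow> hpoly k q \<Longrightarrow> hpoly k (\<lambda>x. p x + q x)"

lemma hpoly_scale: "hpoly k p \<Longrightarrow> hpoly k (\<lambda>x. c * p x)"
proof (induction rule: hpoly.induct)
  case (const c')
  show ?case by (rule hpoly.const)
next
  case (coord k p b)
  then show ?case using hpoly.coord[OF coord.IH] by (simp add: mult.left_commute)
next
  case (add k p q)
  then show ?case using hpoly.add by (simp add: distrib_left)
qed

lemma hpoly_zero: "hpoly k (\<lambda>x::'a::euclidean_space. 0)"
proof (induction k)
  case (Suc k)
  obtain b :: 'a where "b \<in> Basis" using nonempty_Basis by blast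
  from hpoly.coord[OF Suc this] show ?case by simp
qed (rule hpoly.const)

lemma hpoly_sum: "finite I \<Longrightarrow> (\<And>i. i \<in> I \<Longrightarrow> hpoly k (P i)) \<Longrightarrow> hpoly k (\<lambda>x. \<Sum>i\<in>I. P i x)"
  by (induction rule: finite_induct) (auto intro: hpoly_zero hpoly.add)

lemma has_derivative_coord_mult:
  fixes p :: "'a::euclidean_space \<Rightarrow> real"
  assumes "(p has_derivative (\<lambda>h. \<Sum>i\<in>Basis. (h \<bullet> i) * P i)) (at x)" "b \<in> Basis"
  shows "((\<lambda>x. (x \<bullet> b) * p x) has_derivative (\<lambda>h. \<Sum>i\<in>Basis. (h \<bullet> i) * ((i \<bullet> b) * p x + (x \<bullet> b) * P i))) (at x)"
proof -
  have "((\<lambda>x. (x \<bullet> b) * p x) has_derivative (\<lambda>h. (x \<bullet> b) * (\<Sum>i\<in>Basis. (h \<bullet> i) * P i) + (h \<bullet> b) * p x)) (at x)"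
    by (rule has_derivative_mult[OF _ assms(1)]) (auto intro!: derivative_eq_intros)
  moreover have "(x \<bullet> b) * (\<Sum>i\<in>Basis. (h \<bullet> i) * P i) + (h \<bullet> b) * p x = (\<Sum>i\<in>Basis. (h \<bullet> i) * ((i \<bullet> b) * p x + (x \<bullet> b) * P i))" for h
  proof -
    note sum_Basis_inner_inner[of h b]
    then show ?thesis by (simp add: sum.distrib distrib_left sum_distrib_left sum_distrib_right mult_ac)
        (simp add: sum_distrib_left[symmetric] sum_distrib_right[symmetric] mult_ac)
  qed
  ultimately show ?thesis by simp
qed

text \<open>For \<open>k = 0\<close> the truncated degree \<open>k - 1\<close> is again \<open>0\<close>, so the vanishing of the derivatives has to be recorded
  separately.\<close>
lemma hpoly_derivative:
  assumes "hpoly k p"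
  shows "\<exists>P. (\<forall>i\<in>Basis. hpoly (k - 1) (P i)) \<and> (k = 0 \<longrightarrow> (\<forall>i\<in>Basis. P i = (\<lambda>x. 0))) \<and>
    (\<forall>x. (p has_derivative (\<lambda>h. \<Sum>i\<in>Basis. (h \<bullet> i) * P i x)) (at x)) \<and>
    (\<forall>x. (\<Sum>i\<in>Basis. (x \<bullet> i) * P i x) = real k * p x)"
  using assms
proof (induction rule: hpoly.induct)
  case (const c)
  show ?case by (intro exI[of _ "\<lambda>i x. 0"]) (auto intro: hpoly_zero)
next
  case (coord k p b)
  then obtain P where P: "\<And>i. i \<in> Basis \<Longrightarrow> hpoly (k - 1) (P i)" "k = 0 \<Longrightarrow> (\<forall>i\<in>Basis. P i = (\<lambda>x. 0))"
    "\<And>x. (p has_derivative (\<lambda>h. \<Sum>i\<in>Basis. (h \<bullet> i) * P i x)) (at x)"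
    "\<And>x. (\<Sum>i\<in>Basis. (x \<bullet> i) * P i x) = real k * p x" by blast
  define P' where "P' i x = (i \<bullet> b) * p x + (x \<bullet> b) * P i x" for i x
  have "hpoly k (P' i)" if i: "i \<in> Basis" for i
    unfolding P'_def
  proof (intro hpoly.add hpoly_scale coord.hyps)
    show "hpoly k (\<lambda>x. (x \<bullet> b) * P i x)"
      using hpoly.coord[OF P(1)[OF i] coord.hyps(2)] P(2) i by (cases k) (auto intro: hpoly_zero)
  qed
  moreover have "((\<lambda>x. (x \<bullet> b) * p x) has_derivative (\<lambda>h. \<Sum>i\<in>Basis. (h \<bullet> i) * P' i x)) (at x)" for x
    unfolding P'_def by (rule has_derivative_coord_mult[OF P(3) coord.hyps(2)])
  moreover have "(\<Sum>i\<in>Basis. (x \<bullet> i) * P' i x) = real (Suc k) * ((x \<bullet> b) * p x)" for x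
  proof -
    have "(\<Sum>i\<in>Basis. (x \<bullet> i) * P' i x) = (\<Sum>i\<in>Basis. (x \<bullet> i) * (i \<bullet> b)) * p x + (x \<bullet> b) * (\<Sum>i\<in>Basis. (x \<bullet> i) * P i x)"
      by (simp add: P'_def sum.distrib distrib_left sum_distrib_left sum_distrib_right mult_ac)
    also have "(\<Sum>i\<in>Basis. (x \<bullet> i) * (i \<bullet> b)) = x \<bullet> b" by (rule sum_Basis_inner_inner)
    finally show ?thesis using P(4)[of x] by (simp add: algebra_simps)
  qed
  ultimately show ?case by (intro exI[of _ P']) auto
next
  case (add k p q)
  from add.IH obtain P Q where P: "\<And>i. i \<in> Basis \<Longrightarrow> hpoly (k - 1) (P i)" "k = 0 \<Longrightarrow> (\<forall>i\<in>Basis. P i = (\<lambda>x. 0))"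
    "\<And>x. (p has_derivative (\<lambda>h. \<Sum>i\<in>Basis. (h \<bullet> i) * P i x)) (at x)"
    "\<And>x. (\<Sum>i\<in>Basis. (x \<bullet> i) * P i x) = real k * p x"
    and Q: "\<And>i. i \<in> Basis \<Longrightarrow> hpoly (k - 1) (Q i)" "k = 0 \<Longrightarrow> (\<forall>i\<in>Basis. Q i = (\<lambda>x. 0))"
    "\<And>x. (q has_derivative (\<lambda>h. \<Sum>i\<in>Basis. (h \<bullet> i) * Q i x)) (at x)"
    "\<And>x. (\<Sum>i\<in>Basis. (x \<bullet> i) * Q i x) = real k * q x" by blast
  have "((\<lambda>x. p x + q x) has_derivative (\<lambda>h. \<Sum>i\<in>Basis. (h \<bullet> i) * (P i x + Q i x))) (at x)" for x
    using has_derivative_add[OF P(3) Q(3)] by (simp add: distrib_left sum.distrib)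
  then show ?case
    using P Q by (intro exI[of _ "\<lambda>i x. P i x + Q i x"]) (auto intro!: hpoly.add simp: distrib_left sum.distrib)
qed

lemma hpoly_has_derivative:
  assumes "hpoly k p"
  shows "(p has_derivative (\<lambda>h. \<Sum>i\<in>Basis. (h \<bullet> i) * partial_deriv i p x)) (at x)"
  using hpoly_derivative[OF assms] by (intro has_derivative_partial_deriv) (auto simp: differentiable_def)

lemma hpoly_partial_deriv:
  assumes "hpoly k p" "i \<in> Basis"
  shows "hpoly (k - 1) (partial_deriv i p)" "k = 0 \<Longrightarrow> partial_deriv i p = (\<lambda>x. 0)"
    "(\<Sum>i\<in>Basis. (x \<bullet> i) * partial_deriv i p x) = real k * p x"
proof -
  obtain P where P: "\<And>i. i \<in> Basis \<Longrightarrow> hpoly (k - 1) (P i)" "k = 0 \<Longrightarrow> (\<forall>i\<in>Basis. P i = (\<lambda>x. 0))"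
    "\<And>x. (p has_derivative (\<lambda>h. \<Sum>i\<in>Basis. (h \<bullet> i) * P i x)) (at x)"
    "\<And>x. (\<Sum>i\<in>Basis. (x \<bullet> i) * P i x) = real k * p x"
    using hpoly_derivative[OF assms(1)] by blast
  have eq: "partial_deriv i p = P i" if "i \<in> Basis" for i
    using partial_deriv_eq[OF P(3), of i] sum_Basis_inner_left[OF that] by (auto simp: fun_eq_iff)
  show "hpoly (k - 1) (partial_deriv i p)" "k = 0 \<Longrightarrow> partial_deriv i p = (\<lambda>x. 0)"
    "(\<Sum>i\<in>Basis. (x \<bullet> i) * partial_deriv i p x) = real k * p x"
    using P assms(2) eq by auto
qed

lemma hpoly_continuous: "hpoly k p \<Longrightarrow> continuous_on S p"
  by (meson hpoly_has_derivative continuous_at_imp_continuous_on has_derivative_continuous)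

lemma hpoly_laplacian:
  assumes "hpoly k p"
  shows "hpoly (k - 2) (laplacian p)" "k < 2 \<Longrightarrow> laplacian p = (\<lambda>x. 0)"
proof -
  have "hpoly (k - 1 - 1) (partial_deriv i (partial_deriv i p))" if "i \<in> Basis" for i
    using hpoly_partial_deriv(1)[OF hpoly_partial_deriv(1)[OF assms that] that] .
  then show "hpoly (k - 2) (laplacian p)"
    unfolding laplacian_def[abs_def] by (intro hpoly_sum) (auto simp: numeral_2_eq_2)
  have "partial_deriv i (partial_deriv i p) = (\<lambda>x. 0)" if "i \<in> Basis" "k < 2" for i
    using hpoly_partial_deriv(2)[OF hpoly_partial_deriv(1)[OF assms that(1)] that(1)] that(2) by auto
  then show "k < 2 \<Longrightarrow> laplacian p = (\<lambda>x. 0)" by (auto simp: laplacian_def fun_eq_iff)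
qed

lemma hpoly_partial_coord_mult:
  assumes "hpoly k p" "b \<in> Basis" "i \<in> Basis"
  shows "partial_deriv i (\<lambda>x. (x \<bullet> b) * p x) = (\<lambda>x. (i \<bullet> b) * p x + (x \<bullet> b) * partial_deriv i p x)"
  using partial_deriv_eq[OF has_derivative_coord_mult[OF hpoly_has_derivative[OF assms(1)] assms(2)], of i]
    sum_Basis_inner_left[OF assms(3)] by (auto simp: fun_eq_iff)

lemma hpoly_partial_add:
  assumes "hpoly k p" "hpoly l q"
  shows "partial_deriv i (\<lambda>x. p x + c * q x) = (\<lambda>x. partial_deriv i p x + c * partial_deriv i q x)"
proof
  fix x
  have "((\<lambda>x. p x + c * q x) has_derivative (\<lambda>h. (\<Sum>i\<in>Basis. (h \<bullet> i) * partial_deriv i p x) + c * (\<Sum>i\<in>Basis. (h \<bullet> i) * partial_deriv i q x))) (at x)"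
    by (intro has_derivative_add has_derivative_mult_right hpoly_has_derivative[OF assms(1)] hpoly_has_derivative[OF assms(2)])
  from partial_deriv_eq[OF this, of i] partial_deriv_eq[OF hpoly_has_derivative[OF assms(1)], of i x]
    partial_deriv_eq[OF hpoly_has_derivative[OF assms(2)], of i x]
  show "partial_deriv i (\<lambda>x. p x + c * q x) x = partial_deriv i p x + c * partial_deriv i q x" by simp
qed

lemma hpoly_laplacian_coord_mult:
  assumes "hpoly k p" "b \<in> Basis"
  shows "laplacian (\<lambda>x. (x \<bullet> b) * p x) x = 2 * partial_deriv b p x + (x \<bullet> b) * laplacian p x"
proof -
  have "partial_deriv i (partial_deriv i (\<lambda>x. (x \<bullet> b) * p x)) x
      = 2 * ((i \<bullet> b) * partial_deriv i p x) + (x \<bullet> b) * partial_deriv i (partial_deriv i p) x" if i: "i \<in> Basis" for i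
  proof -
    have h: "hpoly (k - 1) (partial_deriv i p)" by (rule hpoly_partial_deriv(1)[OF assms(1) i])
    have "partial_deriv i (\<lambda>x. (x \<bullet> b) * p x) = (\<lambda>x. (x \<bullet> b) * partial_deriv i p x + (i \<bullet> b) * p x)"
      unfolding hpoly_partial_coord_mult[OF assms i] by (simp add: add.commute)
    then show ?thesis
      unfolding \<open>partial_deriv i (\<lambda>x. (x \<bullet> b) * p x) = _\<close> hpoly_partial_add[OF hpoly.coord[OF h assms(2)] assms(1)]
        hpoly_partial_coord_mult[OF h assms(2) i] by simp
  qed
  then have "laplacian (\<lambda>x. (x \<bullet> b) * p x) x = (\<Sum>i\<in>Basis. 2 * ((i \<bullet> b) * partial_deriv i p x) + (x \<bullet> b) * partial_deriv i (partial_deriv i p) x)"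
    unfolding laplacian_def by (intro sum.cong) auto
  also have "\<dots> = 2 * (\<Sum>i\<in>Basis. (b \<bullet> i) * partial_deriv i p x) + (x \<bullet> b) * laplacian p x"
    by (simp add: sum.distrib sum_distrib_left laplacian_def inner_commute)
  finally show ?thesis by (simp add: sum_Basis_inner_left[OF assms(2)])
qed

lemma hpoly_laplacian_add:
  assumes "hpoly k p" "hpoly l q"
  shows "laplacian (\<lambda>x. p x + c * q x) x = laplacian p x + c * laplacian q x"
proof -
  have "partial_deriv i (partial_deriv i (\<lambda>x. p x + c * q x)) x = partial_deriv i (partial_deriv i p) x + c * partial_deriv i (partial_deriv i q) x"
    if "i \<in> Basis" for i
    unfolding hpoly_partial_add[OF assms]
    by (simp add: hpoly_partial_add[OF hpoly_partial_deriv(1)[OF assms(1) that] hpoly_partial_deriv(1)[OF assms(2) that]])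
  then show ?thesis unfolding laplacian_def by (simp add: sum.distrib sum_distrib_left)
qed

text \<open>The real part of \<open>(x\<^sub>1 + i x\<^sub>2)\<^sup>j\<close>, built together with the imaginary part. The Cauchy--Riemann equations between the two parts carry
  the induction.\<close>
lemma harmonic_hpoly_exists:
  assumes e: "e1 \<in> Basis" "e2 \<in> Basis" "e1 \<noteq> (e2::'a::euclidean_space)"
  shows "\<exists>c :: 'a \<Rightarrow> real. hpoly j c \<and> laplacian c = (\<lambda>x. 0) \<and> (\<forall>t. c (t *\<^sub>R e1) = t ^ j)"
proof -
  have e0: "e1 \<bullet> e2 = 0" "e2 \<bullet> e1 = 0" "e1 \<bullet> e1 = 1" "e2 \<bullet> e2 = 1" using e by (auto simp: inner_Basis)
  have "\<exists>c s :: 'a \<Rightarrow> real. hpoly j c \<and> hpoly j s \<and> laplacian c = (\<lambda>x. 0) \<and> laplacian s = (\<lambda>x. 0) \<and>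
    partial_deriv e1 c = partial_deriv e2 s \<and> partial_deriv e1 s = (\<lambda>x. - partial_deriv e2 c x) \<and>
    (\<forall>t. c (t *\<^sub>R e1) = t ^ j) \<and> (\<forall>t. s (t *\<^sub>R e1) = 0)"
  proof (induction j)
    case 0
    have h: "hpoly 0 (\<lambda>x::'a. c)" for c by (rule hpoly.const)
    show ?case
      by (intro exI[of _ "\<lambda>x. 1"] exI[of _ "\<lambda>x. 0"])
         (use h hpoly_laplacian(2)[OF h] hpoly_partial_deriv(2)[OF h e(1)] hpoly_partial_deriv(2)[OF h e(2)] in auto)
  next
    case (Suc j)
    then obtain c s :: "'a \<Rightarrow> real" where h: "hpoly j c" "hpoly j s" and l: "laplacian c = (\<lambda>x. 0)" "laplacian s = (\<lambda>x. 0)"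
      and cr: "partial_deriv e1 c = partial_deriv e2 s" "partial_deriv e1 s = (\<lambda>x. - partial_deriv e2 c x)"
      and v: "\<And>t. c (t *\<^sub>R e1) = t ^ j" "\<And>t. s (t *\<^sub>R e1) = 0" by blast
    define c' where "c' x = (x \<bullet> e1) * c x + (- 1) * ((x \<bullet> e2) * s x)" for x
    define s' where "s' x = (x \<bullet> e1) * s x + 1 * ((x \<bullet> e2) * c x)" for x
    note hc = hpoly.coord[OF h(1) e(1)] hpoly.coord[OF h(1) e(2)] hpoly.coord[OF h(2) e(1)] hpoly.coord[OF h(2) e(2)]
    have "hpoly (Suc j) c'" "hpoly (Suc j) s'" unfolding c'_def s'_def
      by (intro hpoly.add hpoly_scale hc)+
    moreover have "laplacian c' = (\<lambda>x. 0)" "laplacian s' = (\<lambda>x. 0)"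
      unfolding c'_def s'_def fun_eq_iff hpoly_laplacian_add[OF hc(1,4)] hpoly_laplacian_add[OF hc(3,2)]
        hpoly_laplacian_coord_mult[OF h(1) e(1)] hpoly_laplacian_coord_mult[OF h(1) e(2)]
        hpoly_laplacian_coord_mult[OF h(2) e(1)] hpoly_laplacian_coord_mult[OF h(2) e(2)] by (auto simp: l cr)
    moreover have "partial_deriv e1 c' = partial_deriv e2 s'" "partial_deriv e1 s' = (\<lambda>x. - partial_deriv e2 c' x)"
      unfolding c'_def s'_def hpoly_partial_add[OF hc(1,4)] hpoly_partial_add[OF hc(3,2)]
        hpoly_partial_coord_mult[OF h(1) e(1) e(1)] hpoly_partial_coord_mult[OF h(1) e(2) e(1)]
        hpoly_partial_coord_mult[OF h(2) e(1) e(1)] hpoly_partial_coord_mult[OF h(2) e(2) e(1)]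
        hpoly_partial_coord_mult[OF h(1) e(1) e(2)] hpoly_partial_coord_mult[OF h(1) e(2) e(2)]
        hpoly_partial_coord_mult[OF h(2) e(1) e(2)] hpoly_partial_coord_mult[OF h(2) e(2) e(2)]
      by (auto simp: cr e0 fun_eq_iff)
    moreover have "c' (t *\<^sub>R e1) = t ^ Suc j" "s' (t *\<^sub>R e1) = 0" for t
      by (simp_all add: c'_def s'_def v e0)
    ultimately show ?case by blast
  qed
  then show ?thesis by blast
qed

section \<open>Radial functions times homogeneous polynomials\<close>

abbreviation has_gradient :: "('a::euclidean_space \<Rightarrow> real) \<Rightarrow> ('a \<Rightarrow> real) \<Rightarrow> 'a \<Rightarrow> bool" where
  "has_gradient f A x \<equiv> (f has_derivative (\<lambda>h. \<Sum>i\<in>Basis. (h \<bullet> i) * A i)) (at x)"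

lemma has_gradient_cong: "has_gradient f A x \<Longrightarrow> (\<And>i. i \<in> Basis \<Longrightarrow> A i = B i) \<Longrightarrow> has_gradient f B x"
  by (simp cong: sum.cong)

lemma has_gradient_add:
  "has_gradient f A x \<Longrightarrow> has_gradient g B x \<Longrightarrow> has_gradient (\<lambda>x. f x + g x) (\<lambda>i. A i + B i) x"
  using has_derivative_add[of f _ "at x" g] by (simp add: distrib_left sum.distrib)

lemma has_gradient_mult:
  assumes "has_gradient f A x" "has_gradient g B x"
  shows "has_gradient (\<lambda>x. f x * g x) (\<lambda>i. A i * g x + f x * B i) x"
proof -
  have "((\<lambda>x. f x * g x) has_derivative
    (\<lambda>h. f x * (\<Sum>i\<in>Basis. (h \<bullet> i) * B i) + (\<Sum>i\<in>Basis. (h \<bullet> i) * A i) * g x)) (at x)"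
    by (rule has_derivative_mult[OF assms])
  moreover have "f x * (\<Sum>i\<in>Basis. (h \<bullet> i) * B i) + (\<Sum>i\<in>Basis. (h \<bullet> i) * A i) * g x
     = (\<Sum>i\<in>Basis. (h \<bullet> i) * (A i * g x + f x * B i))" for h
    by (simp add: sum_distrib_left sum_distrib_right distrib_left sum.distrib mult_ac)
  ultimately show ?thesis by simp
qed

lemma has_gradient_radial:
  assumes "(\<psi> has_real_derivative d) (at (norm x))" "x \<noteq> 0"
  shows "has_gradient (\<lambda>x. \<psi> (norm x)) (\<lambda>i. d / norm x * (x \<bullet> i)) x"
proof -
  have "(\<psi> has_derivative (*) d) (at (norm x))" using assms(1) by (simp add: has_field_derivative_def)
  from has_derivative_compose[OF has_derivative_norm[OF assms(2)] this]
  have "((\<lambda>x. \<psi> (norm x)) has_derivative (\<lambda>h. d * (h \<bullet> sgn x))) (at x)" .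
  moreover have "d * (h \<bullet> sgn x) = (\<Sum>i\<in>Basis. (h \<bullet> i) * (d / norm x * (x \<bullet> i)))" for h
  proof -
    have "(\<Sum>i\<in>Basis. (h \<bullet> i) * (d / norm x * (x \<bullet> i))) = d / norm x * (h \<bullet> x)"
      unfolding euclidean_inner[of h x] by (simp add: sum_distrib_left mult_ac)
    then show ?thesis by (simp add: sgn_div_norm divide_inverse)
  qed
  ultimately show ?thesis by simp
qed

lemma open_annulus: "open (annulus a b)"
  unfolding annulus_def by (intro open_Collect_conj open_Collect_less continuous_intros)

text \<open>The mixed term of the Laplacian of the product is \<open>2 \<psi>'/r\<close> times \<open>x \<bullet> \<nabla>p = k p\<close>, by Euler's identity. With \<open>p = 1\<close>
  this is the Laplacian of a radial function.\<close>
lemma radial_times_hpoly: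
  fixes p :: "'a::euclidean_space \<Rightarrow> real"
  assumes a: "0 < a" and p: "hpoly k p"
    and d1: "\<And>r. r \<in> {a<..<b} \<Longrightarrow> (\<psi> has_real_derivative \<psi>' r) (at r)"
    and d2: "\<And>r. r \<in> {a<..<b} \<Longrightarrow> (\<psi>' has_real_derivative \<psi>'' r) (at r)"
    and c2: "continuous_on {a<..<b} \<psi>''"
    and f: "\<And>x. x \<in> annulus a b \<Longrightarrow> f x = \<psi> (norm x) * p x"
  shows "C2_on (annulus a b) f"
    "\<And>x. x \<in> annulus a b \<Longrightarrow> laplacian f x =
       (\<psi>'' (norm x) + (real DIM('a) - 1 + 2 * real k) / norm x * \<psi>' (norm x)) * p x + \<psi> (norm x) * laplacian p x"
proof -
  define \<zeta> where "\<zeta> r = \<psi>' r / r" for r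
  define \<zeta>' where "\<zeta>' r = \<psi>'' r / r - \<psi>' r / r\<^sup>2" for r
  define P where "P i = partial_deriv i p" for i
  define PP where "PP j i = partial_deriv j (partial_deriv i p)" for i j
  define F where "F i x = \<zeta> (norm x) * ((x \<bullet> i) * p x) + \<psi> (norm x) * P i x" for i x
  define H where "H j i x = \<zeta>' (norm x) / norm x * (x \<bullet> j) * ((x \<bullet> i) * p x) + \<zeta> (norm x) * ((j \<bullet> i) * p x + (x \<bullet> i) * P j x)
     + (\<psi>' (norm x) / norm x * (x \<bullet> j) * P i x + \<psi> (norm x) * PP j i x)" for i j x
  have A: "norm x \<in> {a<..<b}" "x \<noteq> 0" if "x \<in> annulus a b" for x :: 'a
    using that a by (auto simp: annulus_def)
  have P: "has_gradient p (\<lambda>i. P i x) x" for x unfolding P_def by (rule hpoly_has_derivative[OF p])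
  have PP: "has_gradient (P i) (\<lambda>j. PP j i x) x" if "i \<in> Basis" for i x
    unfolding PP_def P_def by (rule hpoly_has_derivative[OF hpoly_partial_deriv(1)[OF p that]])
  have d\<zeta>: "(\<zeta> has_real_derivative \<zeta>' r) (at r)" if r: "r \<in> {a<..<b}" for r
  proof -
    have r0: "r \<noteq> 0" using r a by auto
    have "(\<zeta> has_real_derivative (\<psi>'' r * r - \<psi>' r * 1) / (r * r)) (at r)"
      unfolding \<zeta>_def by (rule DERIV_divide[OF d2[OF r] DERIV_ident r0])
    then show ?thesis using r0 by (simp add: \<zeta>'_def diff_divide_distrib power2_eq_square)
  qed
  have f1: "has_gradient f (\<lambda>i. F i x) x" if x: "x \<in> annulus a b" for x
  proof -
    have "has_gradient (\<lambda>x. \<psi> (norm x) * p x) (\<lambda>i. F i x) x"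
      by (rule has_gradient_cong[OF has_gradient_mult[OF has_gradient_radial[OF d1[OF A(1)[OF x]] A(2)[OF x]] P]])
         (simp add: F_def \<zeta>_def)
    then show ?thesis
      by (rule has_derivative_transform_within_open[OF _ open_annulus x]) (use f in auto)
  qed
  have f2: "has_gradient (F i) (\<lambda>j. H j i x) x" if i: "i \<in> Basis" and x: "x \<in> annulus a b" for i x
    unfolding F_def
    by (rule has_gradient_cong[OF has_gradient_add[OF
          has_gradient_mult[OF has_gradient_radial[OF d\<zeta>[OF A(1)[OF x]] A(2)[OF x]] has_derivative_coord_mult[OF P i]]
          has_gradient_mult[OF has_gradient_radial[OF d1[OF A(1)[OF x]] A(2)[OF x]] PP[OF i]]]])
       (simp add: H_def)
  have nc: "continuous_on (annulus a b :: 'a set) (\<lambda>x. \<eta> (norm x))" if "continuous_on {a<..<b} \<eta>" for \<eta> :: "real \<Rightarrow> real"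
    by (rule continuous_on_compose2[OF that]) (use A in \<open>auto intro!: continuous_intros\<close>)
  have c0: "continuous_on {a<..<b} \<psi>" "continuous_on {a<..<b} \<psi>'"
    using d1 d2 by (meson DERIV_isCont continuous_at_imp_continuous_on)+
  have cc: "continuous_on {a<..<b} \<zeta>" "continuous_on {a<..<b} \<zeta>'"
    unfolding \<zeta>_def \<zeta>'_def using a by (intro continuous_intros c0 c2; auto)+
  have pc: "continuous_on S p" "i \<in> Basis \<Longrightarrow> continuous_on S (P i)" "i \<in> Basis \<Longrightarrow> j \<in> Basis \<Longrightarrow> continuous_on S (PP j i)" for S i j
    unfolding P_def PP_def using hpoly_continuous hpoly_partial_deriv(1) p by blast+
  have HC: "continuous_on (annulus a b) (H j i)" if "i \<in> Basis" "j \<in> Basis" for i j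
    unfolding H_def using A that
    by (intro continuous_intros nc[OF cc(1)] nc[OF cc(2)] nc[OF c0(1)] nc[OF c0(2)] pc) auto
  show "C2_on (annulus a b) f" by (rule C2_onI(1)[OF open_annulus f1 f2 HC])
  fix x :: 'a assume x: "x \<in> annulus a b"
  have r0: "norm x > 0" using A(2)[OF x] by simp
  have e1: "(\<Sum>i\<in>Basis. (x \<bullet> i) * (x \<bullet> i)) = (norm x)\<^sup>2"
    using euclidean_inner[of x x] by (simp add: power2_norm_eq_inner)
  have e2: "(\<Sum>i\<in>Basis. (x \<bullet> i) * P i x) = real k * p x" unfolding P_def
    using hpoly_partial_deriv(3)[OF p] nonempty_Basis by blast
  have "laplacian f x = (\<Sum>i\<in>Basis. H i i x)" by (rule C2_onI(4)[OF open_annulus f1 f2 HC x])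
  also have "\<dots> = (\<Sum>i\<in>Basis. \<zeta>' (norm x) / norm x * p x * ((x \<bullet> i) * (x \<bullet> i)) + \<zeta> (norm x) * p x + \<zeta> (norm x) * ((x \<bullet> i) * P i x)
      + \<psi>' (norm x) / norm x * ((x \<bullet> i) * P i x) + \<psi> (norm x) * PP i i x)"
    by (intro sum.cong refl) (simp add: H_def inner_Basis algebra_simps)
  also have "\<dots> = \<zeta>' (norm x) / norm x * p x * (norm x)\<^sup>2 + real DIM('a) * (\<zeta> (norm x) * p x) + \<zeta> (norm x) * (real k * p x)
      + \<psi>' (norm x) / norm x * (real k * p x) + \<psi> (norm x) * laplacian p x"
    unfolding sum.distrib sum_distrib_left[symmetric] e1 e2 by (simp add: laplacian_def PP_def)
  also have "\<dots> = (\<psi>'' (norm x) + (real DIM('a) - 1 + 2 * real k) / norm x * \<psi>' (norm x)) * p x + \<psi> (norm x) * laplacian p x"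
    using r0 by (simp add: \<zeta>_def \<zeta>'_def field_simps power2_eq_square)
  finally show "laplacian f x =
       (\<psi>'' (norm x) + (real DIM('a) - 1 + 2 * real k) / norm x * \<psi>' (norm x)) * p x + \<psi> (norm x) * laplacian p x" .
qed

text \<open>Along a coordinate axis the profile is the restriction of \<open>f\<close>, so it inherits two derivatives from \<open>f\<close>.\<close>
lemma radial_profile_derivatives:
  fixes f :: "'a::euclidean_space \<Rightarrow> real"
  assumes a: "0 < a" and C2: "C2_on (annulus a b) f" and f: "\<And>x. x \<in> annulus a b \<Longrightarrow> f x = \<phi> (norm x)"
  shows "\<exists>\<phi>' \<phi>''. (\<forall>r\<in>{a<..<b}. (\<phi> has_real_derivative \<phi>' r) (at r) \<and> (\<phi>' has_real_derivative \<phi>'' r) (at r)) \<and>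
    (\<forall>x\<in>annulus a b. laplacian f x = \<phi>'' (norm x) + (real DIM('a) - 1) / norm x * \<phi>' (norm x))"
proof -
  obtain e :: 'a where e: "e \<in> Basis" using nonempty_Basis by blast
  have ne: "r *\<^sub>R e \<in> annulus a b" "norm (r *\<^sub>R e) = r" if "r \<in> {a<..<b}" for r
    using that a e by (auto simp: annulus_def)
  define \<phi>' where "\<phi>' r = partial_deriv e f (r *\<^sub>R e)" for r
  define \<phi>'' where "\<phi>'' r = partial_deriv e (partial_deriv e f) (r *\<^sub>R e)" for r
  have line: "((\<lambda>r. F (r *\<^sub>R e)) has_real_derivative partial_deriv e F (r *\<^sub>R e)) (at r)"
    if "has_gradient F (\<lambda>i. partial_deriv i F (r *\<^sub>R e)) (r *\<^sub>R e)" for F r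
  proof -
    have "((\<lambda>r. r *\<^sub>R e) has_derivative (\<lambda>h. h *\<^sub>R e)) (at r)" by (auto intro!: derivative_eq_intros)
    from has_derivative_compose[OF this that]
    have "((\<lambda>r. F (r *\<^sub>R e)) has_derivative (\<lambda>h. \<Sum>i\<in>Basis. (h *\<^sub>R e \<bullet> i) * partial_deriv i F (r *\<^sub>R e))) (at r)" .
    moreover have "(\<Sum>i\<in>Basis. (h *\<^sub>R e \<bullet> i) * partial_deriv i F (r *\<^sub>R e)) = partial_deriv e F (r *\<^sub>R e) * h" for h
      using sum_Basis_inner_left[OF e, of "\<lambda>i. partial_deriv i F (r *\<^sub>R e)"]
      by (simp add: sum_distrib_left[symmetric] mult.assoc mult.commute)
    ultimately show ?thesis by (simp add: has_field_derivative_def)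
  qed
  have d1: "(\<phi> has_real_derivative \<phi>' r) (at r)" if r: "r \<in> {a<..<b}" for r
  proof -
    have "((\<lambda>r. f (r *\<^sub>R e)) has_real_derivative \<phi>' r) (at r)"
      unfolding \<phi>'_def by (rule line[OF C2_on_derivatives(1)[OF C2 open_annulus ne(1)[OF r]]])
    then show ?thesis
      by (rule has_field_derivative_transform_within_open[where S = "{a<..<b}"]) (use f ne r in auto)
  qed
  have d2: "(\<phi>' has_real_derivative \<phi>'' r) (at r)" if r: "r \<in> {a<..<b}" for r
    unfolding \<phi>'_def \<phi>''_def by (rule line[OF C2_on_derivatives(2)[OF C2 open_annulus ne(1)[OF r] e]])
  have "continuous_on {a<..<b} \<phi>''" unfolding \<phi>''_def
  proof (rule continuous_on_compose2[of "annulus a b" _ _ "\<lambda>r. r *\<^sub>R e"])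
    show "continuous_on (annulus a b) (partial_deriv e (partial_deriv e f))" using C2 e by (simp add: C2_on_def)
  qed (use ne in \<open>auto intro!: continuous_intros\<close>)
  note cont = this
  have h1: "hpoly 0 (\<lambda>x::'a. 1)" by (rule hpoly.const)
  have "laplacian (\<lambda>x::'a. 1 :: real) = (\<lambda>x. 0)" using hpoly_laplacian(2)[OF h1] by simp
  then have "\<forall>x\<in>annulus a b. laplacian f x = \<phi>'' (norm x) + (real DIM('a) - 1) / norm x * \<phi>' (norm x)"
    using radial_times_hpoly(2)[OF a h1 d1 d2 cont, of f] f by simp
  then show ?thesis using d1 d2 by blast
qed

lemma closure_annulus:
  assumes "0 < a" "a < b"
  shows "closure (annulus a b) = {x::'a::euclidean_space. a \<le> norm x \<and> norm x \<le> b}" (is "_ = ?K")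
proof
  have "closed ?K" by (intro closed_Collect_conj closed_Collect_le continuous_intros)
  then show "closure (annulus a b) \<subseteq> ?K" by (rule closure_minimal[rotated]) (auto simp: annulus_def)
  show "?K \<subseteq> closure (annulus a b)"
  proof
    fix x :: 'a assume x: "x \<in> ?K"
    then have x0: "norm x > 0" using assms by auto
    define T where "T r = (r / norm x) *\<^sub>R x" for r
    have "T ` closure {a<..<b} \<subseteq> closure (T ` {a<..<b})"
      by (rule image_closure_subset[OF _ closed_closure closure_subset]) (use x0 in \<open>auto simp: T_def intro!: continuous_intros\<close>)
    moreover have "T ` {a<..<b} \<subseteq> annulus a b" using x0 assms by (auto simp: T_def annulus_def)
    then have "closure (T ` {a<..<b}) \<subseteq> closure (annulus a b)" by (rule closure_mono)
    ultimately have sub: "T ` {a..b} \<subseteq> closure (annulus a b)"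
      unfolding closure_greaterThanLessThan[OF assms(2)] by (rule subset_trans)
    have "T (norm x) \<in> T ` {a..b}" using x by (intro imageI) auto
    then have "T (norm x) \<in> closure (annulus a b)" using sub by (rule subsetD[rotated])
    moreover have "T (norm x) = x" using x0 by (simp add: T_def)
    ultimately show "x \<in> closure (annulus a b)" by simp
  qed
qed

lemma frontier_annulus:
  assumes "0 < a" "a < b"
  shows "frontier (annulus a b) = {x::'a::euclidean_space. norm x = a \<or> norm x = b}"
  unfolding frontier_def interior_open[OF open_annulus] closure_annulus[OF assms]
  using assms by (auto simp: annulus_def)

text \<open>Separation of variables: \<open>\<phi>(|x|) |x|\<^sup>-\<^sup>j\<close> times a harmonic homogeneous polynomial of degree \<open>j\<close> solves the linearized
  problem, since \<open>j(N-2+j)\<close> is the eigenvalue of the spherical Laplacian on such polynomials.\<close>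
lemma degenerate_of_radial_eigenvalue:
  fixes v :: "'a::euclidean_space \<Rightarrow> real"
  assumes N: "DIM('a) \<ge> 2" and a: "0 < a" "a < b" and p: "p > 1"
    and v: "\<And>x. x \<in> annulus a b \<Longrightarrow> v x = u (norm x)" and u: "continuous_on {a<..<b} u"
    and ev: "radial_eigenvalue DIM('a) p a b u (- (real j * (real DIM('a) - 2 + real j)))"
  shows "degenerate p (annulus a b) v"
proof -
  define \<nu> where "\<nu> = - (real j * (real DIM('a) - 2 + real j))"
  obtain \<phi> \<phi>' \<phi>'' where h: "continuous_on {a..b} \<phi>" "\<phi> a = 0" "\<phi> b = 0" "\<exists>r\<in>{a<..<b}. \<phi> r \<noteq> 0"
    and d: "\<And>r. r \<in> {a<..<b} \<Longrightarrow> (\<phi> has_real_derivative \<phi>' r) (at r)"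
      "\<And>r. r \<in> {a<..<b} \<Longrightarrow> (\<phi>' has_real_derivative \<phi>'' r) (at r)"
      "\<And>r. r \<in> {a<..<b} \<Longrightarrow> - \<phi>'' r - (real DIM('a) - 1) / r * \<phi>' r = (p * \<bar>u r\<bar> powr (p - 1) + \<nu> / r\<^sup>2) * \<phi> r"
    using ev unfolding radial_eigenvalue_def \<nu>_def by blast
  obtain e1 e2 :: 'a where e: "e1 \<in> Basis" "e2 \<in> Basis" "e1 \<noteq> e2"
    using N card_le_Suc0_iff_eq[of "Basis :: 'a set"] by (auto simp: numeral_2_eq_2 not_less_eq_eq[symmetric])
  obtain c :: "'a \<Rightarrow> real" where c: "hpoly j c" "laplacian c = (\<lambda>x. 0)" "\<And>t. c (t *\<^sub>R e1) = t ^ j"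
    using harmonic_hpoly_exists[OF e] by blast
  define \<psi> where "\<psi> r = \<phi> r / r ^ j" for r
  define \<psi>' where "\<psi>' r = \<phi>' r / r ^ j - real j * \<phi> r / r ^ (j + 1)" for r
  define \<psi>'' where "\<psi>'' r = \<phi>'' r / r ^ j - 2 * real j * \<phi>' r / r ^ (j + 1) + real j * (real j + 1) * \<phi> r / r ^ (j + 2)" for r
  have pw: "((\<lambda>r. \<eta> r / r ^ i) has_real_derivative \<eta>' / r ^ i - real i * \<eta> r / r ^ (i + 1)) (at r)"
    if "(\<eta> has_real_derivative \<eta>') (at r)" "r \<in> {a<..<b}" for \<eta> \<eta>' i r
  proof -
    have r0: "r \<noteq> 0" using that a by auto
    have pp: "((\<lambda>r. r ^ i) has_real_derivative real i * r ^ i / r) (at r)"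
      by (rule power_real_derivative[OF r0])
    have "((\<lambda>r. \<eta> r / r ^ i) has_real_derivative (\<eta>' * r ^ i - \<eta> r * (real i * r ^ i / r)) / (r ^ i * r ^ i)) (at r)"
      by (rule DERIV_divide[OF that(1) pp]) (use r0 in auto)
    moreover have "(\<eta>' * r ^ i - \<eta> r * (real i * r ^ i / r)) / (r ^ i * r ^ i) = \<eta>' / r ^ i - real i * \<eta> r / r ^ (i + 1)"
      using r0 by (simp add: field_simps)
    ultimately show ?thesis by simp
  qed
  have d1: "(\<psi> has_real_derivative \<psi>' r) (at r)" if r: "r \<in> {a<..<b}" for r
    unfolding \<psi>_def \<psi>'_def by (rule pw[OF d(1)[OF r] r])
  have d2: "(\<psi>' has_real_derivative \<psi>'' r) (at r)" if r: "r \<in> {a<..<b}" for r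
  proof -
    have "(\<psi>' has_real_derivative (\<phi>'' r / r ^ j - real j * \<phi>' r / r ^ (j + 1)) - (real j * \<phi>' r / r ^ (j + 1) - real (j + 1) * (real j * \<phi> r) / r ^ (j + 1 + 1))) (at r)"
      unfolding \<psi>'_def by (intro DERIV_diff pw d(2)[OF r] DERIV_cmult d(1)[OF r] r)
    then show ?thesis by (simp add: \<psi>''_def algebra_simps add_divide_distrib)
  qed
  have cphi: "continuous_on {a<..<b} \<phi>" "continuous_on {a<..<b} \<phi>'"
    using d(1,2) by (meson DERIV_isCont continuous_at_imp_continuous_on)+
  have "continuous_on {a<..<b} (\<lambda>r. - ((real DIM('a) - 1) / r * \<phi>' r) - (p * \<bar>u r\<bar> powr (p - 1) + \<nu> / r\<^sup>2) * \<phi> r)"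
    using a p by (intro continuous_intros cphi continuous_on_powr' u) auto
  moreover have "- ((real DIM('a) - 1) / r * \<phi>' r) - (p * \<bar>u r\<bar> powr (p - 1) + \<nu> / r\<^sup>2) * \<phi> r = \<phi>'' r" if "r \<in> {a<..<b}" for r
    using d(3)[OF that] by linarith
  \<comment> \<open>The equation itself makes the second derivative continuous.\<close>
  ultimately have "continuous_on {a<..<b} \<phi>''" by (metis (no_types, lifting) continuous_on_cong)
  then have c2: "continuous_on {a<..<b} \<psi>''" unfolding \<psi>''_def
    using a by (intro continuous_intros cphi) auto
  define w where "w x = \<psi> (norm x) * c x" for x
  have w: "\<And>x. x \<in> annulus a b \<Longrightarrow> w x = \<psi> (norm x) * c x" by (simp add: w_def)
  have "C2_on (annulus a b) w" by (rule radial_times_hpoly(1)[OF a(1) c(1) d1 d2 c2 w])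
  moreover have "- laplacian w x = p * \<bar>v x\<bar> powr (p - 1) * w x" if x: "x \<in> annulus a b" for x
  proof -
    define r where "r = norm x"
    have r: "r \<in> {a<..<b}" "r > 0" using x a by (auto simp: annulus_def r_def)
    have "\<psi>'' r + (real DIM('a) - 1 + 2 * real j) / r * \<psi>' r
        = (\<phi>'' r + (real DIM('a) - 1) / r * \<phi>' r + \<nu> / r\<^sup>2 * \<phi> r) / r ^ j"
      using r(2) by (simp add: \<psi>''_def \<psi>'_def \<nu>_def field_simps power2_eq_square)
    also have "\<phi>'' r + (real DIM('a) - 1) / r * \<phi>' r + \<nu> / r\<^sup>2 * \<phi> r = - (p * \<bar>u r\<bar> powr (p - 1) * \<phi> r)"
      using d(3)[OF r(1)] by (simp add: algebra_simps)
    finally have "\<psi>'' r + (real DIM('a) - 1 + 2 * real j) / r * \<psi>' r = - (p * \<bar>u r\<bar> powr (p - 1)) * \<psi> r"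
      by (simp add: \<psi>_def)
    moreover have "laplacian w x = (\<psi>'' r + (real DIM('a) - 1 + 2 * real j) / r * \<psi>' r) * c x + \<psi> r * laplacian c x"
      unfolding r_def by (rule radial_times_hpoly(2)[OF a(1) c(1) d1 d2 c2 w x])
    ultimately show ?thesis using c(2) v[OF x] by (simp add: w_def r_def)
  qed
  moreover have "continuous_on (closure (annulus a b)) w"
    unfolding closure_annulus[OF a] w_def \<psi>_def
    by (intro continuous_intros continuous_on_compose2[OF h(1)] hpoly_continuous[OF c(1)]) (use a in auto)
  moreover have "\<forall>x\<in>frontier (annulus a b). w x = 0"
    unfolding frontier_annulus[OF a] w_def \<psi>_def using h by auto
  ultimately have "linearized_solution p (annulus a b) v w"
    unfolding linearized_solution_def dirichlet_solution_def by blast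
  moreover obtain r where r: "r \<in> {a<..<b}" "\<phi> r \<noteq> 0" using h(4) by blast
  then have "r *\<^sub>R e1 \<in> annulus a b" "w (r *\<^sub>R e1) \<noteq> 0"
    using a e by (auto simp: annulus_def w_def \<psi>_def c)
  ultimately show ?thesis unfolding degenerate_def by blast
qed

section \<open>A rotation-invariant measure on the sphere\<close>

lemma nn_integral_lborel_translate:
  fixes c :: "'a::euclidean_space"
  assumes "f \<in> borel_measurable borel"
  shows "(\<integral>\<^sup>+x. f (c + x) \<partial>lborel) = (\<integral>\<^sup>+x. f x \<partial>lborel)"
proof -
  have "(\<integral>\<^sup>+x. f x \<partial>lborel) = (\<integral>\<^sup>+x. f x \<partial>distr lborel borel ((+) c))" by (simp add: lborel_distr_plus)
  also have "\<dots> = (\<integral>\<^sup>+x. f (c + x) \<partial>lborel)" by (rule nn_integral_distr) (use assms in auto)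
  finally show ?thesis by simp
qed

text \<open>Uniqueness of translation-invariant measures. The image measure is translation invariant too, because \<open>R\<close> is linear and
  onto. Evaluating a double integral of \<open>1\<^sub>A(Rt) 1\<^sub>B(Rt + y)\<close> in both orders shows that it agrees with the Lebesgue
  measure up to a factor, and the factor is \<open>1\<close> because \<open>R\<close> preserves the unit ball \<open>A\<close>.\<close>
lemma lborel_distr_orthogonal:
  fixes R :: "'a::euclidean_space \<Rightarrow> 'a"
  assumes R: "orthogonal_transformation R"
  shows "distr lborel borel R = lborel"
proof (rule measure_eqI)
  show "sets (distr lborel borel R) = sets lborel" by simp
  fix B assume "B \<in> sets (distr lborel borel R)"
  then have B[measurable]: "B \<in> sets borel" by simp
  have lin: "linear R" using R by (simp add: orthogonal_transformation_def)
  have Rm[measurable]: "R \<in> borel_measurable borel"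
    by (intro borel_measurable_continuous_onI linear_continuous_on linear_conv_bounded_linear[THEN iffD1] lin)
  define A :: "'a set" where "A = ball 0 1"
  have A[measurable]: "A \<in> sets borel" by (simp add: A_def)
  have sym: "- x \<in> A \<longleftrightarrow> x \<in> A" for x by (simp add: A_def)
  have RA: "R x \<in> A \<longleftrightarrow> x \<in> A" for x using R by (simp add: A_def orthogonal_transformation_norm)
  let ?i = "indicator :: 'a set \<Rightarrow> 'a \<Rightarrow> ennreal"
  let ?l = "emeasure lborel"
  have "?l A * ?l B = (\<integral>\<^sup>+t. ?i A (R t) * ?l B \<partial>lborel)"
    by (subst nn_integral_multc) (auto simp: RA indicator_def[of A] simp flip: nn_integral_indicator)
  also have "\<dots> = (\<integral>\<^sup>+t. (\<integral>\<^sup>+y. ?i A (R t) * ?i B (R t + y) \<partial>lborel) \<partial>lborel)"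
    by (intro nn_integral_cong) (simp add: nn_integral_cmult nn_integral_lborel_translate)
  also have "\<dots> = (\<integral>\<^sup>+y. (\<integral>\<^sup>+t. ?i A (R t) * ?i B (R t + y) \<partial>lborel) \<partial>lborel)"
    by (rule lborel_pair.Fubini') measurable
  also have "\<dots> = (\<integral>\<^sup>+y. (\<integral>\<^sup>+t. ?i A (y - R t) * ?i B (R t) \<partial>lborel) \<partial>lborel)"
  proof (rule nn_integral_cong)
    fix y :: 'a
    obtain d where d: "y = R d" using orthogonal_transformation_surj[OF R] by (metis surjD)
    \<comment> \<open>Shifting \<open>t\<close> by \<open>d\<close> shifts \<open>R t\<close> by \<open>y\<close>; the unit ball is symmetric.\<close>
    have "(\<integral>\<^sup>+t. ?i A (R t) * ?i B (R t + y) \<partial>lborel) = (\<integral>\<^sup>+t. ?i A (R (- d + t)) * ?i B (R (- d + t) + y) \<partial>lborel)"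
      by (rule nn_integral_lborel_translate[symmetric]) measurable
    also have "\<dots> = (\<integral>\<^sup>+t. ?i A (y - R t) * ?i B (R t) \<partial>lborel)"
    proof (rule nn_integral_cong)
      fix t
      have e: "R (- d + t) = - (y - R t)" using lin by (simp add: d linear_diff)
      show "?i A (R (- d + t)) * ?i B (R (- d + t) + y) = ?i A (y - R t) * ?i B (R t)"
        unfolding e by (simp add: indicator_def sym del: minus_diff_eq)
    qed
    finally show "(\<integral>\<^sup>+t. ?i A (R t) * ?i B (R t + y) \<partial>lborel) = (\<integral>\<^sup>+t. ?i A (y - R t) * ?i B (R t) \<partial>lborel)" .
  qed
  also have "\<dots> = (\<integral>\<^sup>+t. (\<integral>\<^sup>+y. ?i A (y - R t) * ?i B (R t) \<partial>lborel) \<partial>lborel)"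
    by (rule lborel_pair.Fubini') measurable
  also have "\<dots> = (\<integral>\<^sup>+t. ?l A * ?i B (R t) \<partial>lborel)"
  proof (rule nn_integral_cong)
    fix t
    have "(\<integral>\<^sup>+y. ?i A (y - R t) * ?i B (R t) \<partial>lborel) = (\<integral>\<^sup>+y. ?i A (- R t + y) \<partial>lborel) * ?i B (R t)"
      by (subst nn_integral_multc) (auto simp: algebra_simps)
    also have "(\<integral>\<^sup>+y. ?i A (- R t + y) \<partial>lborel) = ?l A"
      by (subst nn_integral_lborel_translate) auto
    finally show "(\<integral>\<^sup>+y. ?i A (y - R t) * ?i B (R t) \<partial>lborel) = ?l A * ?i B (R t)" .
  qed
  also have "\<dots> = ?l A * emeasure (distr lborel borel R) B"
  proof -
    have "(\<integral>\<^sup>+t. ?i B (R t) \<partial>lborel) = (\<integral>\<^sup>+t. ?i B t \<partial>distr lborel borel R)"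
      by (subst nn_integral_distr) auto
    then show ?thesis by (subst nn_integral_cmult) auto
  qed
  finally have eq: "?l A * ?l B = ?l A * emeasure (distr lborel borel R) B" .
  have "?l A \<noteq> 0"
    using content_ball_pos[of 1 "0::'a"] by (auto simp: A_def measure_def)
  moreover have "?l A \<noteq> \<infinity>" using emeasure_lborel_ball_finite[of "0::'a" 1] by (simp add: A_def)
  ultimately show "emeasure (distr lborel borel R) B = ?l B"
    using eq by (simp add: ennreal_mult_cancel_left)
qed

definition shell :: "'a::euclidean_space set" where "shell = {x. 1 \<le> norm x \<and> norm x \<le> 2}"

lemma inverse_norm_mult_norm: "1 \<le> norm x \<Longrightarrow> inverse (norm x) * norm x = 1"
  by (intro left_inverse) auto

text \<open>Any finite rotation-invariant measure with full support on the sphere serves. The shell avoids the origin, where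
  \<open>x/|x|\<close> is discontinuous.\<close>
definition sphere_measure :: "'a::euclidean_space measure" where
  "sphere_measure = distr (restrict_space lborel shell) (restrict_space borel (sphere 0 1)) (\<lambda>x. x /\<^sub>R norm x)"

lemma shell_borel[measurable]: "shell \<in> sets borel"
proof -
  have "shell = {x::'a. 1 \<le> norm x} \<inter> {x. norm x \<le> 2}" by (auto simp: shell_def)
  moreover have "closed {x::'a. 1 \<le> norm x}" "closed {x::'a. norm x \<le> 2}"
    by (intro closed_Collect_le continuous_intros)+
  ultimately show ?thesis by (metis borel_closed sets.Int)
qed

lemma normalize_measurable:
  "(\<lambda>x. x /\<^sub>R norm x) \<in> measurable (restrict_space lborel shell) (restrict_space borel (sphere 0 (1::real) :: 'a::euclidean_space set))"
proof (rule measurable_restrict_space2)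
  show "(\<lambda>x::'a. x /\<^sub>R norm x) \<in> measurable (restrict_space lborel shell) borel"
    by (intro measurable_restrict_space1) simp
qed (auto simp: shell_def space_restrict_space inverse_norm_mult_norm)

lemma space_sphere_measure [simp]: "space sphere_measure = sphere 0 1"
  by (simp add: sphere_measure_def space_restrict_space)

lemma sets_sphere_measure [measurable_cong]: "sets sphere_measure = sets (restrict_space borel (sphere 0 1))"
  by (simp add: sphere_measure_def)

lemma finite_measure_sphere: "finite_measure (sphere_measure :: 'a::euclidean_space measure)"
proof -
  have "emeasure (restrict_space lborel shell) (space (restrict_space lborel (shell::'a set))) = emeasure lborel (shell::'a set)"
    by (subst emeasure_restrict_space) (auto simp: space_restrict_space)
  also have "\<dots> \<le> emeasure lborel (cball (0::'a) 2)"
    by (rule emeasure_mono) (auto simp: shell_def)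
  also have "\<dots> < \<infinity>" by (rule emeasure_lborel_cball_finite)
  finally have "finite_measure (restrict_space lborel (shell::'a set))" by (intro finite_measureI) auto
  then show ?thesis
    unfolding sphere_measure_def by (rule finite_measure.finite_measure_distr[OF _ normalize_measurable])
qed

lemma continuous_on_sphere_measurable:
  fixes f :: "'a::euclidean_space \<Rightarrow> real"
  assumes "continuous_on (sphere 0 1) f"
  shows "f \<in> borel_measurable sphere_measure"
  using borel_measurable_continuous_on_restrict[OF assms] measurable_cong_sets[OF sets_sphere_measure refl] by blast

lemma continuous_on_sphere_integrable:
  fixes f :: "'a::euclidean_space \<Rightarrow> real"
  assumes "continuous_on (sphere 0 1) f"
  shows "integrable sphere_measure f"
proof -
  have "bounded (f ` sphere 0 1)" by (intro compact_imp_bounded compact_continuous_image assms) simp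
  then obtain B where "\<forall>x\<in>f ` sphere 0 1. norm x \<le> B" unfolding bounded_iff by blast
  then show ?thesis
    by (intro finite_measure.integrable_const_bound[OF finite_measure_sphere, of _ B] continuous_on_sphere_measurable assms) auto
qed

lemma integral_sphere_measure:
  fixes f :: "'a::euclidean_space \<Rightarrow> real"
  assumes "continuous_on (sphere 0 1) f"
  shows "integral\<^sup>L sphere_measure f = (\<integral>x. indicator shell x * f (x /\<^sub>R norm x) \<partial>lborel)"
proof -
  have "integral\<^sup>L sphere_measure f = (\<integral>x. f (x /\<^sub>R norm x) \<partial>restrict_space lborel shell)"
    unfolding sphere_measure_def
    by (rule integral_distr[OF normalize_measurable]) (rule borel_measurable_continuous_on_restrict[OF assms])
  then show ?thesis by (simp add: integral_restrict_space)
qed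

lemma shell_function_measurable:
  fixes f :: "'a::euclidean_space \<Rightarrow> real"
  assumes "continuous_on (sphere 0 1) f"
  shows "(\<lambda>x. indicator shell x * f (x /\<^sub>R norm x)) \<in> borel_measurable borel"
proof -
  have "continuous_on shell (\<lambda>x::'a. f (x /\<^sub>R norm x))"
    by (rule continuous_on_compose2[OF assms]) (auto simp: shell_def inverse_norm_mult_norm intro!: continuous_intros)
  from borel_measurable_continuous_on_indicator[OF shell_borel this] show ?thesis by simp
qed

lemma integral_sphere_orthogonal:
  fixes f :: "'a::euclidean_space \<Rightarrow> real" and R :: "'a \<Rightarrow> 'a"
  assumes f: "continuous_on (sphere 0 1) f" and R: "orthogonal_transformation R"
  shows "(\<integral>x. f (R x) \<partial>sphere_measure) = (\<integral>x. f x \<partial>sphere_measure)"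
proof -
  have lin: "linear R" using R by (simp add: orthogonal_transformation_def)
  have Rc: "continuous_on S R" for S
    by (intro linear_continuous_on linear_conv_bounded_linear[THEN iffD1] lin)
  have Rm: "R \<in> measurable lborel borel" using borel_measurable_continuous_onI[OF Rc] by simp
  have nR: "norm (R x) = norm x" for x using R by (rule orthogonal_transformation_norm)
  have fR: "continuous_on (sphere 0 1) (\<lambda>x. f (R x))"
    by (rule continuous_on_compose2[OF f Rc]) (auto simp: nR)
  have "(\<integral>x. f x \<partial>sphere_measure) = (\<integral>x. indicator shell x * f (x /\<^sub>R norm x) \<partial>distr lborel borel R)"
    unfolding integral_sphere_measure[OF f] lborel_distr_orthogonal[OF R] ..
  also have "\<dots> = (\<integral>x. indicator shell (R x) * f (R x /\<^sub>R norm (R x)) \<partial>lborel)"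
    by (rule integral_distr[OF Rm shell_function_measurable[OF f]])
  also have "\<dots> = (\<integral>x. indicator shell x * f (R (x /\<^sub>R norm x)) \<partial>lborel)"
    by (intro Bochner_Integration.integral_cong) (auto simp: nR shell_def indicator_def linear_scale[OF lin])
  also have "\<dots> = (\<integral>x. f (R x) \<partial>sphere_measure)" by (rule integral_sphere_measure[OF fR, symmetric])
  finally show ?thesis by simp
qed

text \<open>If \<open>f\<close> were nonzero somewhere, it would be nonzero on an open subset of the shell, which is not a null set.\<close>
lemma integral_sphere_square_zero:
  fixes f :: "'a::euclidean_space \<Rightarrow> real"
  assumes f: "continuous_on (sphere 0 1) f" and z: "(\<integral>x. f x * f x \<partial>sphere_measure) = 0" and x: "norm x = 1"
  shows "f x = 0"
proof (rule ccontr)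
  assume fx: "f x \<noteq> 0"
  have c2: "continuous_on (sphere 0 1) (\<lambda>x. f x * f x)" by (intro continuous_intros f)
  define g where "g x = indicator shell x * (f (x /\<^sub>R norm x) * f (x /\<^sub>R norm x))" for x
  have "integrable (restrict_space lborel shell) (\<lambda>x. f (x /\<^sub>R norm x) * f (x /\<^sub>R norm x))"
    using continuous_on_sphere_integrable[OF c2] integrable_distr[OF normalize_measurable, of "\<lambda>x. f x * f x"]
    unfolding sphere_measure_def by simp
  then have "integrable lborel g"
    unfolding g_def by (subst (asm) integrable_restrict_space) auto
  moreover have "integral\<^sup>L lborel g = 0" using z unfolding integral_sphere_measure[OF c2] g_def .
  ultimately have "AE x in lborel. g x = 0"
    by (subst (asm) integral_nonneg_eq_0_iff_AE) (auto simp: g_def)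
  define V where "V = {x. 1 < norm x \<and> norm x < 2} \<inter> (\<lambda>x. f (x /\<^sub>R norm x)) -` (- {0})"
  have "open V" unfolding V_def
  proof (rule continuous_open_preimage)
    show "continuous_on {x::'a. 1 < norm x \<and> norm x < 2} (\<lambda>x. f (x /\<^sub>R norm x))"
      by (rule continuous_on_compose2[OF f]) (auto intro!: continuous_intros simp: inverse_norm_mult_norm)
    show "open {x::'a. 1 < norm x \<and> norm x < 2}"
      by (intro open_Collect_conj open_Collect_less continuous_intros)
  qed auto
  moreover have "(3/2) *\<^sub>R x \<in> V" using x fx by (auto simp: V_def)
  ultimately have "\<not> negligible V" using open_not_negligible by blast
  moreover have "V \<in> null_sets lborel"
  proof -
    from \<open>AE x in lborel. g x = 0\<close> have "AE x in lborel. x \<notin> V"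
      by (rule AE_mp) (auto simp: V_def g_def shell_def)
    moreover have "V \<in> sets lborel" using \<open>open V\<close> by simp
    ultimately show ?thesis by (subst AE_iff_null_sets) auto
  qed
  then have "negligible V" by (simp add: negligible_iff_null_sets null_sets_completionI)
  ultimately show False by blast
qed

lemma (in finite_measure) has_real_derivative_integral:
  fixes f :: "real \<Rightarrow> 'a \<Rightarrow> real"
  assumes t0: "t0 \<in> {c<..<d}"
    and d: "\<And>t x. t \<in> {c<..<d} \<Longrightarrow> x \<in> space M \<Longrightarrow> ((\<lambda>t. f t x) has_real_derivative f' t x) (at t)"
    and i: "\<And>t. t \<in> {c<..<d} \<Longrightarrow> integrable M (f t)"
    and m: "f' t0 \<in> borel_measurable M"
    and B: "\<And>t x. t \<in> {c<..<d} \<Longrightarrow> x \<in> space M \<Longrightarrow> \<bar>f' t x\<bar> \<le> B"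
  shows "((\<lambda>t. \<integral>x. f t x \<partial>M) has_real_derivative (\<integral>x. f' t0 x \<partial>M)) (at t0)"
proof -
  have w: "at t0 = at t0 within {c<..<d}"
    by (rule at_within_open[symmetric]) (use t0 in auto)
  have lip: "\<bar>f s x - f t0 x\<bar> \<le> B * \<bar>s - t0\<bar>" if s: "s \<in> {c<..<d}" and x: "x \<in> space M" for s x
  proof -
    have "norm (f s x - f t0 x) \<le> B * norm (s - t0)"
      by (rule field_differentiable_bound[of "{c<..<d}" "\<lambda>t. f t x" "\<lambda>t. f' t x"])
         (use d B s t0 x in \<open>auto intro: has_field_derivative_at_within\<close>)
    then show ?thesis by simp
  qed
  show ?thesis unfolding has_field_derivative_iff w tendsto_at_iff_sequentially comp_def
  proof (intro allI impI)
    fix X :: "nat \<Rightarrow> real" assume X: "\<forall>i. X i \<in> {c<..<d} - {t0}" "X \<longlonglongrightarrow> t0"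
    have "(\<lambda>i. \<integral>x. (f (X i) x - f t0 x) / (X i - t0) \<partial>M) \<longlonglongrightarrow> (\<integral>x. f' t0 x \<partial>M)"
    proof (rule integral_dominated_convergence[where w = "\<lambda>_. B"])
      show "(\<lambda>x. (f (X i) x - f t0 x) / (X i - t0)) \<in> borel_measurable M" for i
        using i X(1) t0 by (intro borel_measurable_divide borel_measurable_diff borel_measurable_integrable borel_measurable_const) auto
      show "AE x in M. (\<lambda>i. (f (X i) x - f t0 x) / (X i - t0)) \<longlonglongrightarrow> f' t0 x"
      proof (rule AE_I2)
        fix x assume x: "x \<in> space M"
        from d[OF t0 x] have "((\<lambda>y. (f y x - f t0 x) / (y - t0)) \<longlongrightarrow> f' t0 x) (at t0)"
          by (simp add: has_field_derivative_iff)
        then show "(\<lambda>i. (f (X i) x - f t0 x) / (X i - t0)) \<longlonglongrightarrow> f' t0 x"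
          unfolding w tendsto_at_iff_sequentially comp_def using X by blast
      qed
      show "AE x in M. norm ((f (X i) x - f t0 x) / (X i - t0)) \<le> B" for i
      proof (rule AE_I2)
        fix x assume x: "x \<in> space M"
        have "\<bar>X i - t0\<bar> > 0" using X(1) by auto
        then show "norm ((f (X i) x - f t0 x) / (X i - t0)) \<le> B"
          using lip[of "X i" x] X(1) x by (simp add: pos_divide_le_eq)
      qed
    qed (use m in auto)
    moreover have "(\<integral>x. (f (X i) x - f t0 x) / (X i - t0) \<partial>M) = ((\<integral>x. f (X i) x \<partial>M) - (\<integral>x. f t0 x \<partial>M)) / (X i - t0)" for i
      using i X(1) t0 by (simp add: Bochner_Integration.integral_diff)
    ultimately show "(\<lambda>i. ((\<integral>x. f (X i) x \<partial>M) - (\<integral>x. f t0 x \<partial>M)) / (X i - t0)) \<longlonglongrightarrow> (\<integral>x. f' t0 x \<partial>M)"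
      by (simp only:)
  qed
qed

lemma (in finite_measure) continuous_on_integral:
  fixes f :: "real \<Rightarrow> 'a \<Rightarrow> real"
  assumes c: "\<And>x. x \<in> space M \<Longrightarrow> continuous_on S (\<lambda>t. f t x)"
    and m: "\<And>t. t \<in> S \<Longrightarrow> f t \<in> borel_measurable M"
    and B: "\<And>t x. t \<in> S \<Longrightarrow> x \<in> space M \<Longrightarrow> \<bar>f t x\<bar> \<le> B"
  shows "continuous_on S (\<lambda>t. \<integral>x. f t x \<partial>M)"
  unfolding continuous_on_def tendsto_at_iff_sequentially comp_def
proof (intro ballI allI impI)
  fix t X assume t: "t \<in> S" and X: "\<forall>i::nat. X i \<in> S - {t}" "X \<longlonglongrightarrow> t"
  show "(\<lambda>i. \<integral>x. f (X i) x \<partial>M) \<longlonglongrightarrow> (\<integral>x. f t x \<partial>M)"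
  proof (rule integral_dominated_convergence[where w = "\<lambda>_. B"])
    show "AE x in M. (\<lambda>i. f (X i) x) \<longlonglongrightarrow> f t x"
    proof (rule AE_I2)
      fix x assume "x \<in> space M"
      from c[OF this] t have "((\<lambda>t. f t x) \<longlongrightarrow> f t x) (at t within S)" by (simp add: continuous_on_def)
      then show "(\<lambda>i. f (X i) x) \<longlonglongrightarrow> f t x"
        unfolding tendsto_at_iff_sequentially comp_def using X by blast
    qed
  qed (use m B t X in auto)
qed

section \<open>Spherical moments and angular derivatives\<close>

lemma continuous_on_sphere_scaled:
  assumes "continuous_on (annulus a b) G" "0 < a" "r \<in> {a<..<b}"
  shows "continuous_on (sphere 0 1) (\<lambda>\<theta>. G (r *\<^sub>R \<theta>))"
  by (rule continuous_on_compose2[OF assms(1)]) (use assms in \<open>auto simp: annulus_def intro!: continuous_intros\<close>)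

lemma compact_bound:
  fixes f :: "real \<Rightarrow> 'a::euclidean_space \<Rightarrow> real"
  assumes "continuous_on ({c..d} \<times> sphere 0 1) (\<lambda>z. f (fst z) (snd z))"
  obtains B where "\<And>t \<theta>. t \<in> {c..d} \<Longrightarrow> norm \<theta> = 1 \<Longrightarrow> \<bar>f t \<theta>\<bar> \<le> B"
proof -
  let ?g = "\<lambda>z. f (fst z) (snd z)"
  have "bounded (?g ` ({c..d} \<times> sphere 0 1))"
    by (intro compact_imp_bounded compact_continuous_image assms compact_Times) auto
  then obtain B where B: "\<forall>y\<in>?g ` ({c..d} \<times> sphere 0 1). norm y \<le> B" unfolding bounded_iff by blast
  show ?thesis
  proof (rule that)
    fix t \<theta> assume "t \<in> {c..d}" "norm (\<theta> :: 'a) = 1"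
    then have "?g (t, \<theta>) \<in> ?g ` ({c..d} \<times> sphere 0 1)" by (intro imageI) auto
    then show "\<bar>f t \<theta>\<bar> \<le> B" using B by (metis fst_conv snd_conv real_norm_def)
  qed
qed

lemma has_gradient_along_curve:
  assumes "has_gradient F A (\<gamma> t)" "(\<gamma> has_vector_derivative v) (at t)"
  shows "((\<lambda>t. F (\<gamma> t)) has_real_derivative (\<Sum>i\<in>Basis. (v \<bullet> i) * A i)) (at t)"
proof -
  have "((\<lambda>t. F (\<gamma> t)) has_derivative (\<lambda>h. \<Sum>i\<in>Basis. ((h *\<^sub>R v) \<bullet> i) * A i)) (at t)"
    by (rule has_derivative_compose[OF assms(2)[unfolded has_vector_derivative_def] assms(1)])
  moreover have "(\<Sum>i\<in>Basis. ((h *\<^sub>R v) \<bullet> i) * A i) = (\<Sum>i\<in>Basis. (v \<bullet> i) * A i) * h" for h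
    by (simp add: sum_distrib_left mult_ac)
  ultimately show ?thesis by (simp add: has_field_derivative_def)
qed

text \<open>For \<open>p\<close> a spherical harmonic this is a multiple of a Fourier coefficient of \<open>F\<close> on the sphere of radius \<open>r\<close>.\<close>
definition sphere_moment :: "('a::euclidean_space \<Rightarrow> real) \<Rightarrow> ('a \<Rightarrow> real) \<Rightarrow> real \<Rightarrow> real" where
  "sphere_moment F p r = (\<integral>\<theta>. F (r *\<^sub>R \<theta>) * p \<theta> \<partial>sphere_measure)"

lemma sphere_moment_derivative:
  fixes F :: "'a::euclidean_space \<Rightarrow> real"
  assumes a: "0 < a" and F: "\<And>x. x \<in> annulus a b \<Longrightarrow> has_gradient F (\<lambda>i. D i x) x"
    and D: "\<And>i. i \<in> Basis \<Longrightarrow> continuous_on (annulus a b) (D i)"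
    and p: "continuous_on (sphere 0 1) p" and r: "r \<in> {a<..<b}"
  shows "(sphere_moment F p has_real_derivative (\<Sum>i\<in>Basis. sphere_moment (D i) (\<lambda>\<theta>. (\<theta> \<bullet> i) * p \<theta>) r)) (at r)"
proof -
  define c d where "c = (a + r) / 2" and "d = (r + b) / 2"
  have cd: "a < c" "c < r" "r < d" "d < b" using r by (auto simp: c_def d_def)
  have ann: "t *\<^sub>R \<theta> \<in> annulus a b" if "t \<in> {c..d}" "norm \<theta> = 1" for t and \<theta> :: 'a
    using that cd a by (auto simp: annulus_def)
  have Fc: "continuous_on (annulus a b) F"
    using F by (meson continuous_at_imp_continuous_on has_derivative_continuous)
  have ab: "t \<in> {a<..<b}" if "t \<in> {c<..<d}" for t using that cd by auto
  define f' where "f' t \<theta> = (\<Sum>i\<in>Basis. (\<theta> \<bullet> i) * D i (t *\<^sub>R \<theta>)) * p \<theta>" for t \<theta>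
  have "continuous_on ({c..d} \<times> sphere 0 1) (\<lambda>z. f' (fst z) (snd z))" unfolding f'_def
    by (intro continuous_intros continuous_on_compose2[OF D] continuous_on_compose2[OF p]) (use ann in auto)
  then obtain B where B: "\<And>t \<theta>. t \<in> {c..d} \<Longrightarrow> norm \<theta> = 1 \<Longrightarrow> \<bar>f' t \<theta>\<bar> \<le> B"
    using compact_bound[of c d f'] by blast
  have f'c: "continuous_on (sphere 0 1) (f' r)" unfolding f'_def
    by (intro continuous_intros p continuous_on_sphere_scaled[OF D a r])
  have "(sphere_moment F p has_real_derivative (\<integral>\<theta>. f' r \<theta> \<partial>sphere_measure)) (at r)"
    unfolding sphere_moment_def[abs_def]
  proof (rule finite_measure.has_real_derivative_integral[OF finite_measure_sphere, of r c d])
    fix t and \<theta> :: 'a assume t: "t \<in> {c<..<d}" and th: "\<theta> \<in> space sphere_measure"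
    have g: "has_gradient F (\<lambda>i. D i (t *\<^sub>R \<theta>)) (t *\<^sub>R \<theta>)" using ann[of t \<theta>] t th by (intro F) auto
    have "((\<lambda>t. F (t *\<^sub>R \<theta>)) has_real_derivative (\<Sum>i\<in>Basis. (\<theta> \<bullet> i) * D i (t *\<^sub>R \<theta>))) (at t)"
      by (rule has_gradient_along_curve[where \<gamma> = "\<lambda>t. t *\<^sub>R \<theta>", OF g]) (auto intro!: derivative_eq_intros)
    then show "((\<lambda>t. F (t *\<^sub>R \<theta>) * p \<theta>) has_real_derivative f' t \<theta>) (at t)"
      unfolding f'_def by (intro DERIV_cmult_right)
    show "\<bar>f' t \<theta>\<bar> \<le> B" using B[of t \<theta>] t th by auto
  next
    fix t assume t: "t \<in> {c<..<d}"
    show "integrable sphere_measure (\<lambda>\<theta>. F (t *\<^sub>R \<theta>) * p \<theta>)"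
      by (intro continuous_on_sphere_integrable continuous_intros continuous_on_sphere_scaled[OF Fc a ab[OF t]] p)
  qed (use cd f'c in \<open>auto intro: continuous_on_sphere_measurable\<close>)
  moreover have "(\<integral>\<theta>. f' r \<theta> \<partial>sphere_measure) = (\<Sum>i\<in>Basis. sphere_moment (D i) (\<lambda>\<theta>. (\<theta> \<bullet> i) * p \<theta>) r)"
  proof -
    have "(\<integral>\<theta>. f' r \<theta> \<partial>sphere_measure) = (\<integral>\<theta>. (\<Sum>i\<in>Basis. D i (r *\<^sub>R \<theta>) * ((\<theta> \<bullet> i) * p \<theta>)) \<partial>sphere_measure)"
      by (intro Bochner_Integration.integral_cong) (auto simp: f'_def sum_distrib_left mult_ac)
    also have "\<dots> = (\<Sum>i\<in>Basis. (\<integral>\<theta>. D i (r *\<^sub>R \<theta>) * ((\<theta> \<bullet> i) * p \<theta>) \<partial>sphere_measure))"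
      by (intro Bochner_Integration.integral_sum continuous_on_sphere_integrable continuous_intros p continuous_on_sphere_scaled[OF D a r])
    finally show ?thesis by (simp add: sphere_moment_def)
  qed
  ultimately show ?thesis by simp
qed

definition plane_rotation :: "'a::euclidean_space \<Rightarrow> 'a \<Rightarrow> real \<Rightarrow> 'a \<Rightarrow> 'a" where
  "plane_rotation i j t x = x + (cos t - 1) *\<^sub>R ((x \<bullet> i) *\<^sub>R i + (x \<bullet> j) *\<^sub>R j) + sin t *\<^sub>R ((x \<bullet> i) *\<^sub>R j - (x \<bullet> j) *\<^sub>R i)"

lemma orthogonal_plane_rotation:
  assumes "i \<in> Basis" "j \<in> Basis" "i \<noteq> j"
  shows "orthogonal_transformation (plane_rotation i j t)"
  unfolding orthogonal_transformation
proof (intro conjI allI)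
  show "linear (plane_rotation i j t)"
    unfolding plane_rotation_def by (rule linearI) (simp_all add: algebra_simps inner_add_left)
  fix x :: 'a
  have e: "i \<bullet> j = 0" "j \<bullet> i = 0" "i \<bullet> i = 1" "j \<bullet> j = 1" using assms by (auto simp: inner_Basis)
  define A where "A = (x \<bullet> i) *\<^sub>R i + (x \<bullet> j) *\<^sub>R j"
  define B where "B = (x \<bullet> i) *\<^sub>R j - (x \<bullet> j) *\<^sub>R i"
  define s where "s = (x \<bullet> i)\<^sup>2 + (x \<bullet> j)\<^sup>2"
  have p: "x \<bullet> A = s" "A \<bullet> A = s" "x \<bullet> B = 0" "A \<bullet> B = 0" "B \<bullet> B = s" "A \<bullet> x = s" "B \<bullet> x = 0" "B \<bullet> A = 0"
    by (simp_all add: A_def B_def s_def inner_add_left inner_add_right inner_diff_left inner_diff_right e power2_eq_square inner_commute[of _ x])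
  have "plane_rotation i j t x \<bullet> plane_rotation i j t x = x \<bullet> x + s * ((cos t)\<^sup>2 + (sin t)\<^sup>2 - 1)"
    unfolding plane_rotation_def A_def[symmetric] B_def[symmetric]
    by (simp add: inner_add_left inner_add_right p algebra_simps power2_eq_square del: sin_cos_squared_add sin_cos_squared_add2 sin_cos_squared_add3)
  also have "\<dots> = x \<bullet> x" by simp
  finally show "norm (plane_rotation i j t x) = norm x" by (simp add: norm_eq_sqrt_inner)
qed

text \<open>The derivative of a function with gradient \<open>D\<close> along the rotations in the plane of \<open>i\<close> and \<open>j\<close>.\<close>
definition angular :: "'a::euclidean_space \<Rightarrow> 'a \<Rightarrow> ('a \<Rightarrow> 'a \<Rightarrow> real) \<Rightarrow> 'a \<Rightarrow> real" where
  "angular i j D x = (x \<bullet> i) * D j x - (x \<bullet> j) * D i x"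

text \<open>Rotating both factors does not change the integral of their product; the derivative in the angle at \<open>0\<close> gives the identity.
  The radius \<open>r\<close> is absorbed because the angular derivative at \<open>r\<theta>\<close> already carries the factor \<open>r\<close>.\<close>
lemma angular_skew_adjoint:
  fixes F p :: "'a::euclidean_space \<Rightarrow> real"
  assumes a: "0 < a" and F: "\<And>x. x \<in> annulus a b \<Longrightarrow> has_gradient F (\<lambda>i. D i x) x"
    and D: "\<And>i. i \<in> Basis \<Longrightarrow> continuous_on (annulus a b) (D i)"
    and p: "\<And>x. has_gradient p (\<lambda>i. E i x) x" and E: "\<And>i. i \<in> Basis \<Longrightarrow> continuous_on UNIV (E i)"
    and r: "r \<in> {a<..<b}" and ij: "i \<in> Basis" "j \<in> Basis"
  shows "sphere_moment (angular i j D) p r = - sphere_moment F (angular i j E) r"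
proof (cases "i = j")
  case True
  then show ?thesis by (simp add: angular_def sphere_moment_def)
next
  case False
  define R where "R = plane_rotation i j"
  have orth: "orthogonal_transformation (R t)" for t unfolding R_def by (rule orthogonal_plane_rotation[OF ij False])
  have nR: "norm (R t x) = norm x" for t x by (rule orthogonal_transformation_norm[OF orth])
  have ra: "r > 0" using r a by auto
  have ann: "r *\<^sub>R R t \<theta> \<in> annulus a b" if "norm \<theta> = 1" for t and \<theta> :: 'a
    using that r ra by (auto simp: annulus_def nR)
  define A where "A x = (x \<bullet> i) *\<^sub>R i + (x \<bullet> j) *\<^sub>R j" for x
  define B where "B x = (x \<bullet> i) *\<^sub>R j - (x \<bullet> j) *\<^sub>R i" for x
  define V where "V t x = - sin t *\<^sub>R A x + cos t *\<^sub>R B x" for t x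
  have dR: "((\<lambda>t. R t x) has_vector_derivative V t x) (at t)" for t x
    unfolding R_def plane_rotation_def A_def[symmetric] B_def[symmetric] V_def
    by (auto intro!: derivative_eq_intros)
  have cR: "continuous_on S (\<lambda>z. R (fst z) (snd z))" "continuous_on S (\<lambda>z. V (fst z) (snd z))" for S
    unfolding R_def plane_rotation_def V_def A_def B_def by (intro continuous_intros)+
  have Fc: "continuous_on (annulus a b) F"
    using F by (meson continuous_at_imp_continuous_on has_derivative_continuous)
  have pc: "continuous_on S p" for S
    using p by (meson continuous_at_imp_continuous_on has_derivative_continuous)
  define f where "f t \<theta> = F (r *\<^sub>R R t \<theta>) * p (R t \<theta>)" for t \<theta>
  define f' where "f' t \<theta> = (\<Sum>k\<in>Basis. (r *\<^sub>R V t \<theta> \<bullet> k) * D k (r *\<^sub>R R t \<theta>)) * p (R t \<theta>)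
      + F (r *\<^sub>R R t \<theta>) * (\<Sum>k\<in>Basis. (V t \<theta> \<bullet> k) * E k (R t \<theta>))" for t \<theta>
  have f'c: "continuous_on ({-1..1} \<times> sphere 0 1) (\<lambda>z. f' (fst z) (snd z))" unfolding f'_def
    by (intro continuous_intros cR continuous_on_compose2[OF D] continuous_on_compose2[OF E] continuous_on_compose2[OF Fc]
        continuous_on_compose2[OF pc[of UNIV]]) (use ann in auto)
  then obtain M where M: "\<And>t \<theta>. t \<in> {-1..1} \<Longrightarrow> norm \<theta> = 1 \<Longrightarrow> \<bar>f' t \<theta>\<bar> \<le> M"
    using compact_bound[of "-1" 1 f'] by blast
  have gc: "continuous_on (sphere 0 1) (\<lambda>\<theta>. F (r *\<^sub>R \<theta>) * p \<theta>)"
    by (intro continuous_intros pc continuous_on_sphere_scaled[OF Fc a r])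
  have Rc: "continuous_on S (R t)" for t S
    using orth[of t] unfolding orthogonal_transformation_def linear_conv_bounded_linear by (auto intro: linear_continuous_on)
  have fc: "continuous_on (sphere 0 1) (f t)" for t
    unfolding f_def by (rule continuous_on_compose2[OF gc Rc]) (auto simp: nR)
  have f'0: "continuous_on (sphere 0 1) (f' 0)"
  proof -
    have "continuous_on (sphere 0 1) (\<lambda>\<theta>::'a. f' (fst (0::real, \<theta>)) (snd (0::real, \<theta>)))"
      by (rule continuous_on_compose2[OF f'c]) (auto intro!: continuous_on_Pair continuous_on_const continuous_on_id)
    then show ?thesis by simp
  qed
  have "((\<lambda>t. \<integral>\<theta>. f t \<theta> \<partial>sphere_measure) has_real_derivative (\<integral>\<theta>. f' 0 \<theta> \<partial>sphere_measure)) (at 0)"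
  proof (rule finite_measure.has_real_derivative_integral[OF finite_measure_sphere, of 0 "-1" 1])
    fix t and \<theta> :: 'a assume t: "t \<in> {-1<..<(1::real)}" and th: "\<theta> \<in> space sphere_measure"
    then have n: "norm \<theta> = 1" by simp
    show "((\<lambda>t. f t \<theta>) has_real_derivative f' t \<theta>) (at t)"
    proof -
      have "((\<lambda>t. F (r *\<^sub>R R t \<theta>)) has_real_derivative (\<Sum>k\<in>Basis. (r *\<^sub>R V t \<theta> \<bullet> k) * D k (r *\<^sub>R R t \<theta>))) (at t)"
        by (rule has_gradient_along_curve[where \<gamma> = "\<lambda>t. r *\<^sub>R R t \<theta>", OF F[OF ann[OF n]]]) (auto intro!: derivative_eq_intros dR)
      moreover have "((\<lambda>t. p (R t \<theta>)) has_real_derivative (\<Sum>k\<in>Basis. (V t \<theta> \<bullet> k) * E k (R t \<theta>))) (at t)"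
        by (rule has_gradient_along_curve[where \<gamma> = "\<lambda>t. R t \<theta>", OF p dR])
      ultimately show ?thesis unfolding f_def f'_def by (auto intro!: derivative_eq_intros)
    qed
    show "\<bar>f' t \<theta>\<bar> \<le> M" using M[of t \<theta>] t n by auto
  qed (use fc f'0 in \<open>auto intro: continuous_on_sphere_integrable continuous_on_sphere_measurable\<close>)
  moreover have "(\<integral>\<theta>. f t \<theta> \<partial>sphere_measure) = (\<integral>\<theta>. F (r *\<^sub>R \<theta>) * p \<theta> \<partial>sphere_measure)" for t
    unfolding f_def by (rule integral_sphere_orthogonal[OF gc orth])
  ultimately have z: "(\<integral>\<theta>. f' 0 \<theta> \<partial>sphere_measure) = 0"
    using DERIV_unique[OF _ DERIV_const] by simp
  have f'eq: "f' 0 \<theta> = angular i j D (r *\<^sub>R \<theta>) * p \<theta> + F (r *\<^sub>R \<theta>) * angular i j E \<theta>" for \<theta>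
  proof -
    have R0: "R 0 \<theta> = \<theta>" by (simp add: R_def plane_rotation_def)
    have V0: "V 0 \<theta> = B \<theta>" by (simp add: V_def)
    have s: "(\<Sum>k\<in>Basis. (B \<theta> \<bullet> k) * G k) = (\<theta> \<bullet> i) * G j - (\<theta> \<bullet> j) * G i" for G
    proof -
      have "(\<Sum>k\<in>Basis. (B \<theta> \<bullet> k) * G k) = (\<theta> \<bullet> i) * (\<Sum>k\<in>Basis. (j \<bullet> k) * G k) - (\<theta> \<bullet> j) * (\<Sum>k\<in>Basis. (i \<bullet> k) * G k)"
        by (simp add: B_def inner_diff_left left_diff_distrib sum_subtractf sum_distrib_left mult.assoc)
      then show ?thesis by (simp add: sum_Basis_inner_left[OF ij(1)] sum_Basis_inner_left[OF ij(2)])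
    qed
    have e: "(\<Sum>k\<in>Basis. (r *\<^sub>R B \<theta> \<bullet> k) * D k (r *\<^sub>R \<theta>)) = r * (\<Sum>k\<in>Basis. (B \<theta> \<bullet> k) * D k (r *\<^sub>R \<theta>))"
      by (simp add: sum_distrib_left mult.assoc)
    show ?thesis unfolding f'_def R0 V0 e s by (simp add: angular_def algebra_simps)
  qed
  have c1: "continuous_on (sphere 0 1) (\<lambda>\<theta>. angular i j D (r *\<^sub>R \<theta>) * p \<theta>)"
    unfolding angular_def by (intro continuous_intros pc continuous_on_sphere_scaled[OF D a r] ij)
  have c2: "continuous_on (sphere 0 1) (\<lambda>\<theta>. F (r *\<^sub>R \<theta>) * angular i j E \<theta>)"
    unfolding angular_def by (intro continuous_intros continuous_on_subset[OF E] continuous_on_sphere_scaled[OF Fc a r] ij) auto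
  show ?thesis using z unfolding f'eq sphere_moment_def
    by (subst (asm) Bochner_Integration.integral_add[OF continuous_on_sphere_integrable[OF c1] continuous_on_sphere_integrable[OF c2]]) simp
qed

section \<open>The radial equation for spherical moments\<close>

text \<open>The gradient of \<open>angular i j D\<close> when \<open>DD k i\<close> is the \<open>k\<close>-th partial derivative of \<open>D i\<close>.\<close>
definition angular_gradient :: "'a::euclidean_space \<Rightarrow> 'a \<Rightarrow> ('a \<Rightarrow> 'a \<Rightarrow> real) \<Rightarrow> ('a \<Rightarrow> 'a \<Rightarrow> 'a \<Rightarrow> real) \<Rightarrow> 'a \<Rightarrow> 'a \<Rightarrow> real" where
  "angular_gradient i j D DD k x = ((k \<bullet> i) * D j x + (x \<bullet> i) * DD k j x) - ((k \<bullet> j) * D i x + (x \<bullet> j) * DD k i x)"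

lemma has_gradient_angular:
  assumes D: "\<And>i. i \<in> Basis \<Longrightarrow> has_gradient (D i) (\<lambda>k. DD k i x) x" and ij: "i \<in> Basis" "j \<in> Basis"
  shows "has_gradient (angular i j D) (\<lambda>k. angular_gradient i j D DD k x) x"
proof -
  have "((\<lambda>x. (x \<bullet> i) * D j x - (x \<bullet> j) * D i x) has_derivative
    (\<lambda>h. (\<Sum>k\<in>Basis. (h \<bullet> k) * ((k \<bullet> i) * D j x + (x \<bullet> i) * DD k j x)) - (\<Sum>k\<in>Basis. (h \<bullet> k) * ((k \<bullet> j) * D i x + (x \<bullet> j) * DD k i x)))) (at x)"
    by (intro has_derivative_diff has_derivative_coord_mult D ij)
  then show ?thesis
    by (simp add: angular_def[abs_def] angular_gradient_def right_diff_distrib sum_subtractf)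
qed

text \<open>The spherical Laplacian as a sum of squares of angular derivatives: \<open>\<Delta>\<^sub>S = r\<^sup>2 \<Delta> - r\<^sup>2 \<partial>\<^sub>r\<^sup>2 - (N-1) r \<partial>\<^sub>r\<close>. The factor \<open>2\<close> appears
  because every plane is counted twice.\<close>
lemma sum_angular_angular:
  fixes x :: "'a::euclidean_space"
  shows "(\<Sum>i\<in>Basis. \<Sum>j\<in>Basis. angular i j (angular_gradient i j D DD) x) =
    2 * ((norm x)\<^sup>2 * (\<Sum>i\<in>Basis. DD i i x) - (\<Sum>i\<in>Basis. \<Sum>j\<in>Basis. (x \<bullet> i) * (x \<bullet> j) * DD j i x)
      - (real DIM('a) - 1) * (\<Sum>i\<in>Basis. (x \<bullet> i) * D i x))"
proof -
  let ?N = "real DIM('a)"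
  let ?E = "\<Sum>i\<in>Basis. (x \<bullet> i) * D i x"
  let ?Q = "\<Sum>i\<in>Basis. \<Sum>j\<in>Basis. (x \<bullet> i) * (x \<bullet> j) * DD j i x"
  let ?L = "\<Sum>i\<in>Basis. DD i i x"
  have n: "(\<Sum>i\<in>Basis. (x \<bullet> i) * (x \<bullet> i)) = (norm x)\<^sup>2"
    using euclidean_inner[of x x] by (simp add: power2_norm_eq_inner)
  have t1: "(\<Sum>i\<in>Basis. \<Sum>j\<in>Basis. (x \<bullet> i) * ((j \<bullet> i) * D j x)) = ?E"
  proof (rule sum.cong[OF refl])
    fix i :: 'a assume i: "i \<in> Basis"
    have "(\<Sum>j\<in>Basis. (x \<bullet> i) * ((j \<bullet> i) * D j x)) = (x \<bullet> i) * (\<Sum>j\<in>Basis. (i \<bullet> j) * D j x)"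
      by (simp add: sum_distrib_left inner_commute)
    then show "(\<Sum>j\<in>Basis. (x \<bullet> i) * ((j \<bullet> i) * D j x)) = (x \<bullet> i) * D i x" by (simp add: sum_Basis_inner_left[OF i])
  qed
  have t2: "(\<Sum>i\<in>Basis. \<Sum>j\<in>Basis. (x \<bullet> i) * ((x \<bullet> i) * DD j j x)) = (norm x)\<^sup>2 * ?L"
    unfolding n[symmetric] by (simp add: sum_product mult.assoc)
  have t3: "(\<Sum>i\<in>Basis. \<Sum>j\<in>(Basis::'a set). (x \<bullet> i) * D i x) = ?N * ?E"
    by (simp add: sum_distrib_left)
  have sw: "(\<Sum>i\<in>(Basis::'a set). \<Sum>j\<in>Basis. G i j) = (\<Sum>i\<in>Basis. \<Sum>j\<in>Basis. G j i)" for G :: "'a \<Rightarrow> 'a \<Rightarrow> real"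
    by (rule sum.swap)
  define T where "T i j = (x \<bullet> i) * ((j \<bullet> i) * D j x) + (x \<bullet> i) * ((x \<bullet> i) * DD j j x) - (x \<bullet> i) * D i x - (x \<bullet> i) * (x \<bullet> j) * DD j i x" for i j
  have sT: "(\<Sum>i\<in>Basis. \<Sum>j\<in>Basis. T i j) = ?E + (norm x)\<^sup>2 * ?L - ?N * ?E - ?Q"
    unfolding T_def sum.distrib sum_subtractf t1 t2 t3 ..
  have "(\<Sum>i\<in>Basis. \<Sum>j\<in>Basis. angular i j (angular_gradient i j D DD) x) = (\<Sum>i\<in>Basis. \<Sum>j\<in>Basis. T i j + T j i)"
  proof (intro sum.cong refl)
    fix i j :: 'a assume ij: "i \<in> Basis" "j \<in> Basis"
    then have "i \<bullet> i = 1" "j \<bullet> j = 1" by auto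
    then show "angular i j (angular_gradient i j D DD) x = T i j + T j i"
      by (simp add: angular_def angular_gradient_def T_def algebra_simps)
  qed
  also have "\<dots> = (\<Sum>i\<in>Basis. \<Sum>j\<in>Basis. T i j) + (\<Sum>i\<in>Basis. \<Sum>j\<in>Basis. T j i)" by (simp add: sum.distrib)
  also have "(\<Sum>i\<in>Basis. \<Sum>j\<in>Basis. T j i) = (\<Sum>i\<in>Basis. \<Sum>j\<in>Basis. T i j)" by (rule sw)
  finally show ?thesis unfolding sT by (simp add: algebra_simps)
qed

text \<open>Two applications of skew-adjointness move both angular derivatives from \<open>w\<close> to \<open>p\<close>.\<close>
lemma angular_twice_symmetric:
  fixes w p :: "'a::euclidean_space \<Rightarrow> real"
  assumes a: "0 < a" and C2: "C2_on (annulus a b) w" and p: "hpoly k p" and r: "r \<in> {a<..<b}"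
    and ij: "i \<in> Basis" "j \<in> Basis"
  defines "D \<equiv> \<lambda>i. partial_deriv i w" and "E \<equiv> \<lambda>i. partial_deriv i p"
  defines "DD \<equiv> \<lambda>j i. partial_deriv j (partial_deriv i w)" and "EE \<equiv> \<lambda>j i. partial_deriv j (partial_deriv i p)"
  shows "sphere_moment (angular i j (angular_gradient i j D DD)) p r = sphere_moment w (angular i j (angular_gradient i j E EE)) r"
proof -
  note der = C2_on_derivatives[OF C2 open_annulus]
  have cD: "continuous_on (annulus a b) (D i)" if "i \<in> Basis" for i
    unfolding D_def using der(2)[OF _ that] by (meson continuous_at_imp_continuous_on has_derivative_continuous)
  have cDD: "continuous_on (annulus a b) (DD k i)" if "i \<in> Basis" "k \<in> Basis" for i k
    using C2 that unfolding C2_on_def DD_def by blast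
  have hE: "hpoly (k - 1) (E i)" if "i \<in> Basis" for i
    unfolding E_def by (rule hpoly_partial_deriv(1)[OF p that])
  have hEE: "hpoly (k - 1 - 1) (EE l i)" if "i \<in> Basis" "l \<in> Basis" for i l
    using hpoly_partial_deriv(1)[OF hE[OF that(1)] that(2)] by (simp add: E_def EE_def)
  have gE: "has_gradient (E i) (\<lambda>k. EE k i x) x" if "i \<in> Basis" for i x
    unfolding EE_def E_def by (rule hpoly_has_derivative[OF hE[OF that, unfolded E_def]])
  have "sphere_moment (angular i j (angular_gradient i j D DD)) p r = - sphere_moment (angular i j D) (angular i j E) r"
  proof (rule angular_skew_adjoint[OF a _ _ _ _ r ij])
    fix x :: 'a assume x: "x \<in> annulus a b"
    show "has_gradient (angular i j D) (\<lambda>ia. angular_gradient i j D DD ia x) x"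
      by (rule has_gradient_angular[OF _ ij]) (use der(2)[OF x] in \<open>simp add: D_def DD_def\<close>)
  next
    fix l :: 'a assume l: "l \<in> Basis"
    show "continuous_on (annulus a b) (angular_gradient i j D DD l)"
      unfolding angular_gradient_def by (intro continuous_intros cD cDD ij l)
    show "continuous_on UNIV (E l)" by (rule hpoly_continuous[OF hE[OF l]])
  next
    show "has_gradient p (\<lambda>i. E i x) x" for x unfolding E_def by (rule hpoly_has_derivative[OF p])
  qed
  moreover have "sphere_moment (angular i j D) (angular i j E) r = - sphere_moment w (angular i j (angular_gradient i j E EE)) r"
  proof (rule angular_skew_adjoint[OF a _ _ _ _ r ij])
    show "has_gradient w (\<lambda>i. D i x) x" if "x \<in> annulus a b" for x
      unfolding D_def by (rule der(1)[OF that])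
    show "has_gradient (angular i j E) (\<lambda>ia. angular_gradient i j E EE ia x) x" for x
      by (rule has_gradient_angular[OF gE ij])
    show "continuous_on UNIV (angular_gradient i j E EE l)" if l: "l \<in> Basis" for l
      unfolding angular_gradient_def
      by (intro continuous_intros hpoly_continuous[OF hE] hpoly_continuous[OF hEE] ij l)
  qed (rule cD)
  ultimately show ?thesis by simp
qed

lemma sphere_moment_sum:
  assumes "finite I" "\<And>i. i \<in> I \<Longrightarrow> continuous_on (sphere 0 1) (\<lambda>\<theta>. F i (r *\<^sub>R \<theta>) * p i \<theta>)"
  shows "(\<Sum>i\<in>I. sphere_moment (F i) (p i) r) = (\<integral>\<theta>. (\<Sum>i\<in>I. F i (r *\<^sub>R \<theta>) * p i \<theta>) \<partial>sphere_measure)"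
  unfolding sphere_moment_def
  by (intro Bochner_Integration.integral_sum[symmetric] continuous_on_sphere_integrable assms)

text \<open>The radial part of the Laplacian passes to the moment by differentiation under the integral. The angular part is
  symmetric, and on a homogeneous polynomial of degree \<open>k\<close> it acts on the unit sphere as \<open>\<Delta> - k(N-2+k)\<close>.\<close>
lemma sphere_moment_ode:
  fixes w p :: "'a::euclidean_space \<Rightarrow> real"
  assumes a: "0 < a" and C2: "C2_on (annulus a b) w"
    and pde: "\<And>x. x \<in> annulus a b \<Longrightarrow> - laplacian w x = q (norm x) * w x" and p: "hpoly k p"
  shows "\<exists>h' h''. \<forall>r\<in>{a<..<b}. (sphere_moment w p has_real_derivative h' r) (at r) \<and> (h' has_real_derivative h'' r) (at r) \<and>
    - h'' r - (real DIM('a) - 1) / r * h' r =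
      (q r + - (real k * (real DIM('a) - 2 + real k)) / r\<^sup>2) * sphere_moment w p r + sphere_moment w (laplacian p) r / r\<^sup>2"
proof -
  let ?N = "real DIM('a)"
  define D where "D i = partial_deriv i w" for i
  define E where "E i = partial_deriv i p" for i
  define DD where "DD j i = partial_deriv j (partial_deriv i w)" for i j
  define EE where "EE j i = partial_deriv j (partial_deriv i p)" for i j
  note der = C2_on_derivatives[OF C2 open_annulus]
  have gw: "has_gradient w (\<lambda>i. D i x) x" if "x \<in> annulus a b" for x
    unfolding D_def by (rule der(1)[OF that])
  have gD: "has_gradient (D i) (\<lambda>j. DD j i x) x" if "x \<in> annulus a b" "i \<in> Basis" for x i
    unfolding D_def DD_def by (rule der(2)[OF that])
  have cw: "continuous_on (annulus a b) w"
    using gw by (meson continuous_at_imp_continuous_on has_derivative_continuous)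
  have cD: "continuous_on (annulus a b) (D i)" if "i \<in> Basis" for i
    using gD[OF _ that] by (meson continuous_at_imp_continuous_on has_derivative_continuous)
  have cDD: "continuous_on (annulus a b) (DD j i)" if "i \<in> Basis" "j \<in> Basis" for i j
    using C2 that unfolding C2_on_def DD_def by blast
  have pc: "continuous_on S p" for S by (rule hpoly_continuous[OF p])
  define h' where "h' r = (\<Sum>i\<in>Basis. sphere_moment (D i) (\<lambda>\<theta>. (\<theta> \<bullet> i) * p \<theta>) r)" for r
  define h'' where "h'' r = (\<Sum>i\<in>Basis. \<Sum>j\<in>Basis. sphere_moment (DD j i) (\<lambda>\<theta>. (\<theta> \<bullet> j) * ((\<theta> \<bullet> i) * p \<theta>)) r)" for r
  have "(sphere_moment w p has_real_derivative h' r) (at r) \<and> (h' has_real_derivative h'' r) (at r) \<and>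
    - h'' r - (?N - 1) / r * h' r =
      (q r + - (real k * (?N - 2 + real k)) / r\<^sup>2) * sphere_moment w p r + sphere_moment w (laplacian p) r / r\<^sup>2"
    if r: "r \<in> {a<..<b}" for r
  proof (intro conjI)
    have r0: "r > 0" using r a by auto
    show "(sphere_moment w p has_real_derivative h' r) (at r)"
      unfolding h'_def by (rule sphere_moment_derivative[OF a gw cD pc r])
    show "(h' has_real_derivative h'' r) (at r)"
      unfolding h'_def h''_def
      by (intro DERIV_sum sphere_moment_derivative[OF a gD cDD _ r] continuous_intros pc)
    note sc = continuous_on_sphere_scaled[OF _ a r]
    have ann: "r *\<^sub>R \<theta> \<in> annulus a b" if "norm \<theta> = 1" for \<theta> :: 'a using that r r0 by (auto simp: annulus_def)
    let ?I = "integral\<^sup>L (sphere_measure :: 'a measure)"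
    let ?\<Sigma>w = "\<lambda>x. \<Sum>i\<in>Basis. \<Sum>j\<in>Basis. angular i j (angular_gradient i j D DD) x"
    let ?\<Sigma>p = "\<lambda>x. \<Sum>i\<in>Basis. \<Sum>j\<in>Basis. angular i j (angular_gradient i j E EE) x"
    have cang: "continuous_on (annulus a b) (angular i j (angular_gradient i j D DD))" if "i \<in> Basis" "j \<in> Basis" for i j
      unfolding angular_def angular_gradient_def by (intro continuous_intros cD cDD that)
    have hE: "hpoly (k - 1) (E i)" if "i \<in> Basis" for i
      unfolding E_def by (rule hpoly_partial_deriv(1)[OF p that])
    have hEE: "hpoly (k - 1 - 1) (EE l i)" if "i \<in> Basis" "l \<in> Basis" for i l
      using hpoly_partial_deriv(1)[OF hE[OF that(1)] that(2)] by (simp add: E_def EE_def)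
    have cangp: "continuous_on S (angular i j (angular_gradient i j E EE))" if "i \<in> Basis" "j \<in> Basis" for i j S
      unfolding angular_def angular_gradient_def
      by (intro continuous_intros hpoly_continuous[OF hE] hpoly_continuous[OF hEE] that)
    have I1: "h' r = ?I (\<lambda>\<theta>. \<Sum>i\<in>Basis. D i (r *\<^sub>R \<theta>) * ((\<theta> \<bullet> i) * p \<theta>))"
      unfolding h'_def by (rule sphere_moment_sum) (auto intro!: continuous_intros pc sc cD)
    have "(\<Sum>j\<in>Basis. sphere_moment (DD j i) (\<lambda>\<theta>. (\<theta> \<bullet> j) * ((\<theta> \<bullet> i) * p \<theta>)) r)
       = ?I (\<lambda>\<theta>. \<Sum>j\<in>Basis. DD j i (r *\<^sub>R \<theta>) * ((\<theta> \<bullet> j) * ((\<theta> \<bullet> i) * p \<theta>)))" if "i \<in> Basis" for i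
      by (rule sphere_moment_sum) (use that in \<open>auto intro!: continuous_intros pc sc cDD\<close>)
    then have "h'' r = (\<Sum>i\<in>Basis. ?I (\<lambda>\<theta>. \<Sum>j\<in>Basis. DD j i (r *\<^sub>R \<theta>) * ((\<theta> \<bullet> j) * ((\<theta> \<bullet> i) * p \<theta>))))"
      unfolding h''_def by simp
    also have "\<dots> = ?I (\<lambda>\<theta>. \<Sum>i\<in>Basis. \<Sum>j\<in>Basis. DD j i (r *\<^sub>R \<theta>) * ((\<theta> \<bullet> j) * ((\<theta> \<bullet> i) * p \<theta>)))"
      by (intro Bochner_Integration.integral_sum[symmetric] continuous_on_sphere_integrable continuous_intros pc sc cDD)
    finally have I2: "h'' r = ?I (\<lambda>\<theta>. \<Sum>i\<in>Basis. \<Sum>j\<in>Basis. DD j i (r *\<^sub>R \<theta>) * ((\<theta> \<bullet> j) * ((\<theta> \<bullet> i) * p \<theta>)))" .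
    \<comment> \<open>Symmetry of the spherical Laplacian, summed over all planes and written under one integral.\<close>
    have "(\<Sum>i\<in>Basis. \<Sum>j\<in>Basis. sphere_moment (angular i j (angular_gradient i j D DD)) p r)
        = (\<Sum>i\<in>Basis. \<Sum>j\<in>Basis. sphere_moment w (angular i j (angular_gradient i j E EE)) r)"
      unfolding D_def DD_def E_def EE_def by (intro sum.cong refl angular_twice_symmetric[OF a C2 p r])
    moreover have "(\<Sum>i\<in>Basis. \<Sum>j\<in>Basis. sphere_moment (angular i j (angular_gradient i j D DD)) p r) = ?I (\<lambda>\<theta>. ?\<Sigma>w (r *\<^sub>R \<theta>) * p \<theta>)"
    proof -
      have "(\<Sum>i\<in>Basis. \<Sum>j\<in>Basis. sphere_moment (angular i j (angular_gradient i j D DD)) p r)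
         = (\<Sum>i\<in>Basis. ?I (\<lambda>\<theta>. \<Sum>j\<in>Basis. angular i j (angular_gradient i j D DD) (r *\<^sub>R \<theta>) * p \<theta>))"
        by (intro sum.cong refl sphere_moment_sum continuous_intros pc sc cang) auto
      also have "\<dots> = ?I (\<lambda>\<theta>. \<Sum>i\<in>Basis. \<Sum>j\<in>Basis. angular i j (angular_gradient i j D DD) (r *\<^sub>R \<theta>) * p \<theta>)"
        by (intro Bochner_Integration.integral_sum[symmetric] continuous_on_sphere_integrable continuous_intros pc sc cang)
      finally show ?thesis by (simp only: sum_distrib_right)
    qed
    moreover have "(\<Sum>i\<in>Basis. \<Sum>j\<in>Basis. sphere_moment w (angular i j (angular_gradient i j E EE)) r) = ?I (\<lambda>\<theta>. w (r *\<^sub>R \<theta>) * ?\<Sigma>p \<theta>)"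
    proof -
      have "(\<Sum>i\<in>Basis. \<Sum>j\<in>Basis. sphere_moment w (angular i j (angular_gradient i j E EE)) r)
         = (\<Sum>i\<in>Basis. ?I (\<lambda>\<theta>. \<Sum>j\<in>Basis. w (r *\<^sub>R \<theta>) * angular i j (angular_gradient i j E EE) \<theta>))"
        by (intro sum.cong refl sphere_moment_sum continuous_intros sc cw cangp) auto
      also have "\<dots> = ?I (\<lambda>\<theta>. \<Sum>i\<in>Basis. \<Sum>j\<in>Basis. w (r *\<^sub>R \<theta>) * angular i j (angular_gradient i j E EE) \<theta>)"
        by (intro Bochner_Integration.integral_sum[symmetric] continuous_on_sphere_integrable continuous_intros sc cw cangp)
      finally show ?thesis by (simp only: sum_distrib_left)
    qed
    ultimately have sym: "?I (\<lambda>\<theta>. ?\<Sigma>w (r *\<^sub>R \<theta>) * p \<theta>) = ?I (\<lambda>\<theta>. w (r *\<^sub>R \<theta>) * ?\<Sigma>p \<theta>)" by simp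
    \<comment> \<open>On the unit sphere Euler's identity evaluates the radial derivatives of \<open>p\<close>.\<close>
    have ip: "?\<Sigma>p \<theta> = 2 * (laplacian p \<theta> - real k * (?N - 2 + real k) * p \<theta>)" if n: "norm \<theta> = 1" for \<theta>
    proof -
      have e1: "(\<Sum>i\<in>Basis. (\<theta> \<bullet> i) * E i \<theta>) = real k * p \<theta>"
        unfolding E_def using hpoly_partial_deriv(3)[OF p] nonempty_Basis by blast
      have "(\<Sum>i\<in>Basis. \<Sum>j\<in>Basis. (\<theta> \<bullet> i) * (\<theta> \<bullet> j) * EE j i \<theta>) = (\<Sum>i\<in>Basis. (\<theta> \<bullet> i) * (\<Sum>j\<in>Basis. (\<theta> \<bullet> j) * EE j i \<theta>))"
        by (simp add: sum_distrib_left mult.assoc)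
      also have "\<dots> = (\<Sum>i\<in>Basis. (\<theta> \<bullet> i) * (real (k - 1) * E i \<theta>))"
      proof (intro sum.cong refl)
        fix i :: 'a assume i: "i \<in> Basis"
        show "(\<theta> \<bullet> i) * (\<Sum>j\<in>Basis. (\<theta> \<bullet> j) * EE j i \<theta>) = (\<theta> \<bullet> i) * (real (k - 1) * E i \<theta>)"
          using hpoly_partial_deriv(3)[OF hE[OF i] i, of \<theta>] by (simp add: E_def EE_def)
      qed
      also have "\<dots> = real (k - 1) * (\<Sum>i\<in>Basis. (\<theta> \<bullet> i) * E i \<theta>)" by (simp add: sum_distrib_left mult_ac)
      also have "\<dots> = (real k - 1) * (real k * p \<theta>)" unfolding e1 by (cases k) auto
      finally have e2: "(\<Sum>i\<in>Basis. \<Sum>j\<in>Basis. (\<theta> \<bullet> i) * (\<theta> \<bullet> j) * EE j i \<theta>) = (real k - 1) * (real k * p \<theta>)" .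
      have e3: "(\<Sum>i\<in>Basis. EE i i \<theta>) = laplacian p \<theta>" by (simp add: laplacian_def EE_def)
      show ?thesis unfolding sum_angular_angular e1 e2 e3 using n by (simp add: algebra_simps)
    qed
    have cL: "continuous_on S (laplacian p)" for S by (rule hpoly_continuous[OF hpoly_laplacian(1)[OF p]])
    have R: "?I (\<lambda>\<theta>. w (r *\<^sub>R \<theta>) * ?\<Sigma>p \<theta>) = 2 * (sphere_moment w (laplacian p) r - real k * (?N - 2 + real k) * sphere_moment w p r)"
    proof -
      have "?I (\<lambda>\<theta>. w (r *\<^sub>R \<theta>) * ?\<Sigma>p \<theta>) = ?I (\<lambda>\<theta>. 2 * (w (r *\<^sub>R \<theta>) * laplacian p \<theta>) - 2 * (real k * (?N - 2 + real k)) * (w (r *\<^sub>R \<theta>) * p \<theta>))"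
        by (intro Bochner_Integration.integral_cong refl) (simp add: ip algebra_simps)
      also have "\<dots> = ?I (\<lambda>\<theta>. 2 * (w (r *\<^sub>R \<theta>) * laplacian p \<theta>)) - ?I (\<lambda>\<theta>. 2 * (real k * (?N - 2 + real k)) * (w (r *\<^sub>R \<theta>) * p \<theta>))"
        by (intro Bochner_Integration.integral_diff continuous_on_sphere_integrable continuous_intros sc cw cL pc)
      also have "\<dots> = 2 * sphere_moment w (laplacian p) r - 2 * (real k * (?N - 2 + real k)) * sphere_moment w p r"
        unfolding Bochner_Integration.integral_mult_right_zero sphere_moment_def ..
      finally show ?thesis by (simp only: right_diff_distrib mult.assoc)
    qed
    \<comment> \<open>The radial part of the Laplacian is the whole Laplacian minus the spherical part.\<close>
    have "r\<^sup>2 * h'' r + (?N - 1) * (r * h' r) = ?I (\<lambda>\<theta>. r\<^sup>2 * (\<Sum>i\<in>Basis. \<Sum>j\<in>Basis. DD j i (r *\<^sub>R \<theta>) * ((\<theta> \<bullet> j) * ((\<theta> \<bullet> i) * p \<theta>)))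
        + (?N - 1) * (r * (\<Sum>i\<in>Basis. D i (r *\<^sub>R \<theta>) * ((\<theta> \<bullet> i) * p \<theta>))))"
      unfolding I1 I2
      by (subst Bochner_Integration.integral_add) (auto intro!: continuous_on_sphere_integrable continuous_intros sc cD cDD pc)
    also have "\<dots> = ?I (\<lambda>\<theta>. - (r\<^sup>2 * q r) * (w (r *\<^sub>R \<theta>) * p \<theta>) - 1/2 * (?\<Sigma>w (r *\<^sub>R \<theta>) * p \<theta>))"
    proof (intro Bochner_Integration.integral_cong refl)
      fix \<theta> :: 'a assume "\<theta> \<in> space sphere_measure"
      then have n: "norm \<theta> = 1" by simp
      have e3: "(\<Sum>i\<in>Basis. DD i i (r *\<^sub>R \<theta>)) = - (q r * w (r *\<^sub>R \<theta>))"
        using pde[OF ann[OF n]] n r0 by (simp add: laplacian_def DD_def)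
      let ?x = "r *\<^sub>R \<theta>"
      have "r\<^sup>2 * (\<Sum>i\<in>Basis. \<Sum>j\<in>Basis. DD j i ?x * ((\<theta> \<bullet> j) * ((\<theta> \<bullet> i) * p \<theta>))) = (\<Sum>i\<in>Basis. \<Sum>j\<in>Basis. (?x \<bullet> i) * (?x \<bullet> j) * DD j i ?x) * p \<theta>"
        by (simp add: sum_distrib_left sum_distrib_right power2_eq_square mult_ac)
      moreover have "r * (\<Sum>i\<in>Basis. D i ?x * ((\<theta> \<bullet> i) * p \<theta>)) = (\<Sum>i\<in>Basis. (?x \<bullet> i) * D i ?x) * p \<theta>"
        by (simp add: sum_distrib_left sum_distrib_right mult_ac)
      ultimately show "r\<^sup>2 * (\<Sum>i\<in>Basis. \<Sum>j\<in>Basis. DD j i ?x * ((\<theta> \<bullet> j) * ((\<theta> \<bullet> i) * p \<theta>))) + (?N - 1) * (r * (\<Sum>i\<in>Basis. D i ?x * ((\<theta> \<bullet> i) * p \<theta>)))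
         = - (r\<^sup>2 * q r) * (w ?x * p \<theta>) - 1/2 * (?\<Sigma>w ?x * p \<theta>)"
        unfolding sum_angular_angular e3 using n r0 by (simp add: algebra_simps)
    qed
    also have "\<dots> = ?I (\<lambda>\<theta>. - (r\<^sup>2 * q r) * (w (r *\<^sub>R \<theta>) * p \<theta>)) - ?I (\<lambda>\<theta>. 1/2 * (?\<Sigma>w (r *\<^sub>R \<theta>) * p \<theta>))"
      by (intro Bochner_Integration.integral_diff continuous_on_sphere_integrable continuous_intros sc cw cang pc)
    also have "\<dots> = - (r\<^sup>2 * q r) * sphere_moment w p r - (sphere_moment w (laplacian p) r - real k * (?N - 2 + real k) * sphere_moment w p r)"
      unfolding Bochner_Integration.integral_mult_right_zero sym R
      by (simp add: sphere_moment_def diff_divide_distrib)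
    finally have fin: "r\<^sup>2 * h'' r + (?N - 1) * (r * h' r) = - (r\<^sup>2 * q r) * sphere_moment w p r - (sphere_moment w (laplacian p) r - real k * (?N - 2 + real k) * sphere_moment w p r)" .
    have "- h'' r - (?N - 1) / r * h' r = - (r\<^sup>2 * h'' r + (?N - 1) * (r * h' r)) / r\<^sup>2"
      using r0 by (simp add: field_simps power2_eq_square)
    also have "\<dots> = (q r + - (real k * (?N - 2 + real k)) / r\<^sup>2) * sphere_moment w p r + sphere_moment w (laplacian p) r / r\<^sup>2"
      unfolding fin using r0 by (simp add: field_simps)
    finally show "- h'' r - (?N - 1) / r * h' r =
      (q r + - (real k * (?N - 2 + real k)) / r\<^sup>2) * sphere_moment w p r + sphere_moment w (laplacian p) r / r\<^sup>2" .
  qed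
  then show ?thesis by blast
qed

section \<open>From a degenerate solution to a radial eigenvalue\<close>

text \<open>A weight orthogonal to all homogeneous polynomials stays so after multiplication by a polynomial. Quantifying over the
  weight lets products be treated one factor at a time, without splitting a polynomial into homogeneous parts.\<close>
lemma polynomial_weight_moments_vanish:
  fixes g :: "'a::euclidean_space \<Rightarrow> real"
  assumes "real_polynomial_function g" "continuous_on (sphere 0 1) W"
    "\<And>k p. hpoly k p \<Longrightarrow> (\<integral>\<theta>. W \<theta> * p \<theta> \<partial>sphere_measure) = 0" "hpoly k p"
  shows "(\<integral>\<theta>. (W \<theta> * g \<theta>) * p \<theta> \<partial>sphere_measure) = 0"
  using assms
proof (induction arbitrary: W k p rule: real_polynomial_function.induct)
  case (linear f)
  interpret bounded_linear f by fact
  have f: "f x = (\<Sum>i\<in>Basis. (x \<bullet> i) * f i)" for x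
  proof -
    have "f x = f (\<Sum>i\<in>Basis. (x \<bullet> i) *\<^sub>R i)" by (simp add: euclidean_representation)
    then show ?thesis by (simp add: sum scaleR)
  qed
  have "hpoly (Suc k) (\<lambda>x. \<Sum>i\<in>Basis. f i * ((x \<bullet> i) * p x))"
    by (intro hpoly_sum hpoly_scale hpoly.coord linear.prems) auto
  moreover have "f x * p x = (\<Sum>i\<in>Basis. f i * ((x \<bullet> i) * p x))" for x
    by (subst f) (simp add: sum_distrib_left mult_ac)
  ultimately show ?case using linear.prems(2)[of "Suc k" "\<lambda>x. f x * p x"] by (simp add: mult.assoc)
next
  case (const c)
  show ?case using const.prems(2)[OF hpoly_scale[OF const.prems(3), of c]] by (simp add: mult.assoc)
next
  case (add f g)
  have c: "continuous_on (sphere 0 1) f" "continuous_on (sphere 0 1) g"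
    using add.hyps continuous_on_polymonial_function real_polynomial_function_eq by blast+
  have "(\<integral>\<theta>. (W \<theta> * (f \<theta> + g \<theta>)) * p \<theta> \<partial>sphere_measure) = (\<integral>\<theta>. (W \<theta> * f \<theta>) * p \<theta> + (W \<theta> * g \<theta>) * p \<theta> \<partial>sphere_measure)"
    by (simp add: algebra_simps)
  also have "\<dots> = (\<integral>\<theta>. (W \<theta> * f \<theta>) * p \<theta> \<partial>sphere_measure) + (\<integral>\<theta>. (W \<theta> * g \<theta>) * p \<theta> \<partial>sphere_measure)"
    by (intro Bochner_Integration.integral_add continuous_on_sphere_integrable continuous_intros c add.prems hpoly_continuous[OF add.prems(3)])
  finally show ?case using add.IH add.prems by simp
next
  case (mult f g)
  have c: "continuous_on (sphere 0 1) f"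
    using mult.hyps continuous_on_polymonial_function real_polynomial_function_eq by blast
  have "(\<integral>\<theta>. ((W \<theta> * f \<theta>) * g \<theta>) * p \<theta> \<partial>sphere_measure) = 0"
    by (rule mult.IH(2)[OF _ mult.IH(1)[OF mult.prems(1,2)] mult.prems(3)]) (auto intro!: continuous_intros c mult.prems)
  then show ?case by (simp add: mult.assoc)
qed

text \<open>By the Stone--Weierstrass theorem \<open>W\<close> is a uniform limit of polynomials, so \<open>W\<close> is orthogonal to itself.\<close>
lemma hpoly_moments_complete:
  fixes W :: "'a::euclidean_space \<Rightarrow> real"
  assumes c: "continuous_on (sphere 0 1) W"
    and v: "\<And>k p. hpoly k p \<Longrightarrow> (\<integral>\<theta>. W \<theta> * p \<theta> \<partial>sphere_measure) = 0" and x: "norm x = 1"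
  shows "W x = 0"
proof (rule integral_sphere_square_zero[OF c _ x])
  let ?I = "integral\<^sup>L (sphere_measure :: 'a measure)"
  define B where "B = ?I (\<lambda>\<theta>. \<bar>W \<theta>\<bar>)"
  have "\<bar>?I (\<lambda>\<theta>. W \<theta> * W \<theta>)\<bar> \<le> e * B" if e: "e > 0" for e
  proof -
    obtain g where g: "real_polynomial_function g" "\<And>x. x \<in> sphere 0 1 \<Longrightarrow> \<bar>W x - g x\<bar> < e"
      using Stone_Weierstrass_real_polynomial_function[OF compact_sphere c e] by blast
    have cg: "continuous_on (sphere 0 1) g"
      using g(1) continuous_on_polymonial_function real_polynomial_function_eq by blast
    have "?I (\<lambda>\<theta>. W \<theta> * g \<theta>) = 0"
      using polynomial_weight_moments_vanish[OF g(1) c v hpoly.const[of 1]] by simp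
    then have "?I (\<lambda>\<theta>. W \<theta> * W \<theta>) = ?I (\<lambda>\<theta>. W \<theta> * W \<theta>) - ?I (\<lambda>\<theta>. W \<theta> * g \<theta>)" by simp
    also have "\<dots> = ?I (\<lambda>\<theta>. W \<theta> * W \<theta> - W \<theta> * g \<theta>)"
      by (intro Bochner_Integration.integral_diff[symmetric] continuous_on_sphere_integrable continuous_intros c cg)
    also have "\<bar>\<dots>\<bar> \<le> ?I (\<lambda>\<theta>. e * \<bar>W \<theta>\<bar>)"
    proof -
      have "norm (?I (\<lambda>\<theta>. W \<theta> * W \<theta> - W \<theta> * g \<theta>)) \<le> ?I (\<lambda>\<theta>. norm (W \<theta> * W \<theta> - W \<theta> * g \<theta>))"
        by (rule integral_norm_bound)
      also have "\<dots> \<le> ?I (\<lambda>\<theta>. e * \<bar>W \<theta>\<bar>)"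
      proof (rule integral_mono)
        fix \<theta> :: 'a assume "\<theta> \<in> space sphere_measure"
        then have "\<bar>W \<theta> - g \<theta>\<bar> \<le> e" using g(2)[of \<theta>] by auto
        then have "\<bar>W \<theta> - g \<theta>\<bar> * \<bar>W \<theta>\<bar> \<le> e * \<bar>W \<theta>\<bar>" by (intro mult_right_mono) auto
        then show "norm (W \<theta> * W \<theta> - W \<theta> * g \<theta>) \<le> e * \<bar>W \<theta>\<bar>"
          by (simp add: abs_mult[symmetric] algebra_simps)
      qed (intro continuous_on_sphere_integrable continuous_intros c cg)+
      finally show ?thesis by simp
    qed
    also have "\<dots> = e * B" by (simp add: B_def)
    finally show ?thesis .
  qed
  then have le: "\<bar>?I (\<lambda>\<theta>. W \<theta> * W \<theta>)\<bar> \<le> e * B" if "e > 0" for e using that by blast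
  have "B \<ge> 0" unfolding B_def by (intro Bochner_Integration.integral_nonneg) auto
  show "?I (\<lambda>\<theta>. W \<theta> * W \<theta>) = 0"
  proof (rule ccontr)
    assume n: "?I (\<lambda>\<theta>. W \<theta> * W \<theta>) \<noteq> 0"
    define s where "s = \<bar>?I (\<lambda>\<theta>. W \<theta> * W \<theta>)\<bar>"
    have s: "s > 0" using n unfolding s_def by (simp only: zero_less_abs_iff not_False_eq_True)
    have "s \<le> s / (2 * (B + 1)) * B"
      by (rule le[folded s_def]) (use s \<open>B \<ge> 0\<close> in simp)
    also have "\<dots> \<le> s / (2 * (B + 1)) * (B + 1)" using s \<open>B \<ge> 0\<close> by (intro mult_left_mono) auto
    also have "\<dots> = s / 2" using \<open>B \<ge> 0\<close> by (simp add: field_simps)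
    finally show False using s by simp
  qed
qed

text \<open>Take the least degree \<open>k\<close> with a moment of \<open>w\<close> that is not identically zero. For a polynomial \<open>f\<close> of that degree the
  forcing term in the equation for the moment has degree \<open>k - 2\<close> (or the Laplacian of \<open>f\<close> is zero), so it vanishes.\<close>
lemma radial_eigenvalue_of_degenerate:
  fixes v :: "'a::euclidean_space \<Rightarrow> real"
  assumes a: "0 < a" "a < b" and v: "\<And>x. x \<in> annulus a b \<Longrightarrow> v x = u (norm x)"
    and deg: "degenerate p (annulus a b) v"
  shows "\<exists>k::nat. radial_eigenvalue DIM('a) p a b u (- (real k * (real DIM('a) - 2 + real k)))"
proof -
  obtain w where "linearized_solution p (annulus a b) v w" and nz: "\<exists>x\<in>annulus a b. w x \<noteq> 0"
    using deg unfolding degenerate_def by blast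
  then have C2: "C2_on (annulus a b) w" and cw: "continuous_on {x. a \<le> norm x \<and> norm x \<le> b} w"
    and pde: "\<And>x. x \<in> annulus a b \<Longrightarrow> - laplacian w x = (p * \<bar>u (norm x)\<bar> powr (p - 1)) * w x"
    and bd: "\<And>x. norm x = a \<or> norm x = b \<Longrightarrow> w x = 0"
    unfolding linearized_solution_def dirichlet_solution_def closure_annulus[OF a] frontier_annulus[OF a]
    using v by auto
  have ann: "r *\<^sub>R \<theta> \<in> {x. a \<le> norm x \<and> norm x \<le> b}" if "r \<in> {a..b}" "norm \<theta> = 1" for r and \<theta> :: 'a
    using that a by auto
  define P where "P k \<longleftrightarrow> (\<exists>p r. hpoly k p \<and> r \<in> {a<..<b} \<and> sphere_moment w p r \<noteq> 0)" for k
  have "\<exists>k. P k"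
  proof (rule ccontr)
    assume none: "\<nexists>k. P k"
    obtain x where x: "x \<in> annulus a b" "w x \<noteq> 0" using nz by blast
    define r where "r = norm x"
    have r: "r \<in> {a<..<b}" "r > 0" using x a by (auto simp: r_def annulus_def)
    have "w (r *\<^sub>R (x /\<^sub>R r)) = 0"
    proof (rule hpoly_moments_complete[of "\<lambda>\<theta>. w (r *\<^sub>R \<theta>)"])
      show "continuous_on (sphere 0 1) (\<lambda>\<theta>. w (r *\<^sub>R \<theta>))"
        by (rule continuous_on_compose2[OF cw]) (use ann[of r] r in \<open>auto intro!: continuous_intros\<close>)
      show "(\<integral>\<theta>. w (r *\<^sub>R \<theta>) * p \<theta> \<partial>sphere_measure) = 0" if "hpoly k p" for k p
        using none that r unfolding P_def sphere_moment_def by blast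
      show "norm (x /\<^sub>R r) = 1" using r by (simp add: r_def)
    qed
    then show False using x r by simp
  qed
  define k where "k = (LEAST k. P k)"
  have "P k" unfolding k_def using \<open>\<exists>k. P k\<close> by (rule LeastI_ex)
  then obtain f r0 where f: "hpoly k f" and r0: "r0 \<in> {a<..<b}" "sphere_moment w f r0 \<noteq> 0" unfolding P_def by blast
  have lap: "sphere_moment w (laplacian f) r = 0" if r: "r \<in> {a<..<b}" for r
  proof (cases "k < 2")
    case True
    then show ?thesis using hpoly_laplacian(2)[OF f] by (simp add: sphere_moment_def)
  next
    case False
    then have "k - 2 < k" by simp
    then have "\<not> P (k - 2)" unfolding k_def by (rule not_less_Least)
    then show ?thesis using hpoly_laplacian(1)[OF f] r unfolding P_def by blast
  qed
  obtain h' h'' where h: "\<And>r. r \<in> {a<..<b} \<Longrightarrow> (sphere_moment w f has_real_derivative h' r) (at r) \<and> (h' has_real_derivative h'' r) (at r) \<and>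
    - h'' r - (real DIM('a) - 1) / r * h' r =
      (p * \<bar>u r\<bar> powr (p - 1) + - (real k * (real DIM('a) - 2 + real k)) / r\<^sup>2) * sphere_moment w f r + sphere_moment w (laplacian f) r / r\<^sup>2"
    using sphere_moment_ode[OF a(1) C2 pde f] by blast
  have fc: "continuous_on S f" for S by (rule hpoly_continuous[OF f])
  have "continuous_on ({a..b} \<times> sphere 0 1) (\<lambda>z. w (fst z *\<^sub>R snd z) * f (snd z))"
    by (intro continuous_intros continuous_on_compose2[OF cw] continuous_on_compose2[OF fc[of UNIV]]) (use ann in auto)
  then obtain B where B: "\<And>t \<theta>. t \<in> {a..b} \<Longrightarrow> norm \<theta> = 1 \<Longrightarrow> \<bar>w (t *\<^sub>R \<theta>) * f \<theta>\<bar> \<le> B"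
    using compact_bound[of a b "\<lambda>t \<theta>. w (t *\<^sub>R \<theta>) * f \<theta>"] by blast
  have "continuous_on {a..b} (sphere_moment w f)"
    unfolding sphere_moment_def[abs_def]
  proof (rule finite_measure.continuous_on_integral[OF finite_measure_sphere])
    fix \<theta> :: 'a assume th: "\<theta> \<in> space sphere_measure"
    show "continuous_on {a..b} (\<lambda>t. w (t *\<^sub>R \<theta>) * f \<theta>)"
      by (intro continuous_intros continuous_on_compose2[OF cw]) (use ann[of _ \<theta>] th in auto)
  next
    fix t assume t: "t \<in> {a..b}"
    show "(\<lambda>\<theta>. w (t *\<^sub>R \<theta>) * f \<theta>) \<in> borel_measurable sphere_measure"
      by (intro continuous_on_sphere_measurable continuous_intros fc continuous_on_compose2[OF cw]) (use ann[OF t] in auto)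
    show "\<bar>w (t *\<^sub>R \<theta>) * f \<theta>\<bar> \<le> B" if "\<theta> \<in> space sphere_measure" for \<theta> using B[OF t, of \<theta>] that by auto
  qed
  moreover have "sphere_moment w f s = 0" if "s \<in> {a, b}" for s
  proof -
    have "sphere_moment w f s = (\<integral>\<theta>. 0 \<partial>(sphere_measure :: 'a measure))"
      unfolding sphere_moment_def by (intro Bochner_Integration.integral_cong refl) (use bd that a in auto)
    then show ?thesis by simp
  qed
  ultimately have "radial_eigenvalue DIM('a) p a b u (- (real k * (real DIM('a) - 2 + real k)))"
    unfolding radial_eigenvalue_def using h lap r0
    by (intro exI[of _ "sphere_moment w f"] exI[of _ h'] exI[of _ h'']) auto
  then show ?thesis by blast
qed

text \<open>Spheres are connected in dimension at least two, so a connected set of radii sweeps out a connected set.\<close>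
lemma components_norm_vimage:
  fixes U :: "real set"
  assumes N: "DIM('a::euclidean_space) \<ge> 2" and U: "U \<subseteq> {0<..}"
  shows "bij_betw (\<lambda>D. {x::'a. norm x \<in> D}) (components U) (components {x. norm x \<in> U})"
proof -
  define V where "V D = {x::'a. norm x \<in> D}" for D
  obtain e :: 'a where e: "e \<in> Basis" using nonempty_Basis by blast
  have nV: "norm ` V D = D" if "D \<subseteq> U" for D
  proof
    show "D \<subseteq> norm ` V D"
    proof
      fix r assume r: "r \<in> D"
      then have "r > 0" using that U by auto
      then have "norm (r *\<^sub>R e) = r" using e by simp
      then show "r \<in> norm ` V D" using r unfolding V_def by (metis imageI mem_Collect_eq)
    qed
  qed (auto simp: V_def)
  have comp: "V D \<in> components (V U)" if D: "D \<in> components U" for D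
  proof -
    have D1: "D \<subseteq> U" "D \<noteq> {}" "connected D"
      using in_components_subset[OF D] in_components_nonempty[OF D] in_components_connected[OF D] by auto
    have "V D = (\<lambda>z. fst z *\<^sub>R snd z) ` (D \<times> sphere 0 1)"
    proof
      show "V D \<subseteq> (\<lambda>z. fst z *\<^sub>R snd z) ` (D \<times> sphere 0 1)"
      proof
        fix x assume x: "x \<in> V D"
        then have "norm x > 0" using D1 U by (auto simp: V_def)
        then show "x \<in> (\<lambda>z. fst z *\<^sub>R snd z) ` (D \<times> sphere 0 1)"
          using x by (intro image_eqI[of _ _ "(norm x, x /\<^sub>R norm x)"]) (auto simp: V_def)
      qed
      show "(\<lambda>z. fst z *\<^sub>R snd z) ` (D \<times> sphere 0 1) \<subseteq> V D"
        using D1 U by (force simp: V_def)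
    qed
    moreover have "connected (D \<times> sphere (0::'a) 1)" by (intro connected_Times D1 connected_sphere N)
    ultimately have conn: "connected (V D)" by (auto intro!: connected_continuous_image continuous_intros)
    show ?thesis unfolding in_components_maximal
    proof (intro conjI allI impI)
      show "V D \<noteq> {}" using nV[OF D1(1)] D1(2) by auto
      show "V D \<subseteq> V U" using D1(1) by (auto simp: V_def)
      fix T assume T: "T \<noteq> {} \<and> V D \<subseteq> T \<and> T \<subseteq> V U \<and> connected T"
      have "connected (norm ` T)" using T by (intro connected_continuous_image continuous_intros) auto
      moreover have "norm ` T \<subseteq> U" using T by (auto simp: V_def)
      moreover have "D \<inter> norm ` T \<noteq> {}"
      proof -
        have "norm ` V D \<subseteq> norm ` T" using T by (intro image_mono) auto
        then show ?thesis unfolding nV[OF D1(1)] using D1(2) by auto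
      qed
      ultimately have "norm ` T \<subseteq> D" by (rule components_maximal[OF D])
      then have "T \<subseteq> V D" by (auto simp: V_def)
      then show "T = V D" using T by blast
    qed (use conn in auto)
  qed
  have "inj_on V (components U)"
    by (rule inj_onI) (metis nV in_components_subset)
  moreover have "V ` components U = components (V U)"
  proof
    show "V ` components U \<subseteq> components (V U)" using comp by blast
    show "components (V U) \<subseteq> V ` components U"
    proof
      fix C assume C: "C \<in> components (V U)"
      obtain x where x: "x \<in> C" using in_components_nonempty[OF C] by blast
      have "norm x \<in> U" using x in_components_subset[OF C] by (auto simp: V_def)
      then obtain D where D: "D \<in> components U" "norm x \<in> D" using Union_components[of U] by blast
      have "x \<in> V D" using D by (simp add: V_def)
      then have "C = V D" using components_eq[OF C comp[OF D(1)]] x by blast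
      then show "C \<in> V ` components U" using D by blast
    qed
  qed
  ultimately show ?thesis unfolding bij_betw_def V_def by blast
qed

section \<open>The characterization of degeneracy\<close>

theorem proposition1p2:
  fixes v :: "'a::euclidean_space \<Rightarrow> real" and u :: "real \<Rightarrow> real"
    and p a b :: real and m :: nat
  assumes "DIM('a) \<ge> 2" and "p > 1" and "0 < a" and "a < b" and "m \<ge> 1"
    and "lane_emden_solution p (annulus a b) v"
    and "has_profile_on (closure (annulus a b)) v u"
    and "has_nodal_zones (annulus a b) v m"
  shows "radially_nondegenerate p (annulus a b) v \<and>
    (degenerate p (annulus a b) v \<longleftrightarrow>
      (\<exists>l\<in>{1..m}. \<exists>j::int. j \<ge> 2 \<and>
         nth_radial_eigenvalue DIM('a) p a b u l
           (- (real_of_int j * (real DIM('a) - 2 + real_of_int j)))) \<or>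
      nth_radial_eigenvalue DIM('a) p a b u m (- (real DIM('a) - 1)))"
proof -
  note a = \<open>0 < a\<close> \<open>a < b\<close>
  define n where "n = DIM('a) - 1"
  have N: "DIM('a) = Suc n" using assms(1) by (simp add: n_def)
  obtain e :: 'a where e: "e \<in> Basis" using nonempty_Basis by blast
  have ne: "norm (r *\<^sub>R e) = r" if "r > 0" for r using that e by simp
  note cl = closure_annulus[OF a, where 'a='a] and fr = frontier_annulus[OF a, where 'a='a]
  have prof: "v x = u (norm x)" if "a \<le> norm x" "norm x \<le> b" for x
    using assms(7) that unfolding has_profile_on_def cl by blast
  have prof_in: "v x = u (norm x)" if "x \<in> annulus a b" for x
    using that prof by (auto simp: annulus_def)
  have C2: "C2_on (annulus a b) v" and cv: "continuous_on {x. a \<le> norm x \<and> norm x \<le> b} v"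
    and pde: "\<And>x. x \<in> annulus a b \<Longrightarrow> - laplacian v x = \<bar>v x\<bar> powr (p - 1) * v x"
    and bd: "\<And>x. norm x = a \<or> norm x = b \<Longrightarrow> v x = 0"
    using assms(6) unfolding lane_emden_solution_def dirichlet_solution_def cl fr by auto
  have profile_continuous: "continuous_on {a..b} \<phi>"
    if "continuous_on {x::'a. a \<le> norm x \<and> norm x \<le> b} w" "\<And>x. a \<le> norm x \<Longrightarrow> norm x \<le> b \<Longrightarrow> w x = \<phi> (norm x)" for w \<phi>
  proof -
    have "continuous_on {a..b} (\<lambda>r. w (r *\<^sub>R e))"
      by (rule continuous_on_compose2[OF that(1)]) (use a e in \<open>auto intro!: continuous_intros\<close>)
    moreover have "w (r *\<^sub>R e) = \<phi> r" if "r \<in> {a..b}" for r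
      using \<open>\<And>x. a \<le> norm x \<Longrightarrow> norm x \<le> b \<Longrightarrow> w x = \<phi> (norm x)\<close>[of "r *\<^sub>R e"] ne[of r] that a by auto
    ultimately show ?thesis by (metis (no_types, lifting) continuous_on_cong)
  qed
  have cu: "continuous_on {a..b} u" by (rule profile_continuous[OF cv prof])
  have cq: "continuous_on {a..b} (\<lambda>r. \<bar>u r\<bar> powr (p - 1))"
    using \<open>p > 1\<close> by (intro continuous_intros cu continuous_on_powr') auto
  have u0: "u a = 0" "u b = 0"
    using prof[of "a *\<^sub>R e"] prof[of "b *\<^sub>R e"] bd[of "a *\<^sub>R e"] bd[of "b *\<^sub>R e"] ne[of a] ne[of b] a by auto
  obtain g where sol: "radial_sol n (\<lambda>r. \<bar>u r\<bar> powr (p - 1)) 0 a b u g"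
  proof -
    obtain u' u'' where d: "\<And>r. r \<in> {a<..<b} \<Longrightarrow> (u has_real_derivative u' r) (at r) \<and> (u' has_real_derivative u'' r) (at r)"
      and l: "\<And>x. x \<in> annulus a b \<Longrightarrow> laplacian v x = u'' (norm x) + (real DIM('a) - 1) / norm x * u' (norm x)"
      using radial_profile_derivatives[OF a(1) C2 prof_in] by blast
    have "\<exists>g. radial_sol n (\<lambda>r. \<bar>u r\<bar> powr (p - 1)) 0 a b u g"
    proof (rule radial_sol_of_ode[OF a cq cu], intro conjI)
      fix r assume r: "r \<in> {a<..<b}"
      then have x: "r *\<^sub>R e \<in> annulus a b" "norm (r *\<^sub>R e) = r" using ne[of r] a by (auto simp: annulus_def)
      show "- u'' r - real n / r * u' r = (\<bar>u r\<bar> powr (p - 1) + 0 / r\<^sup>2) * u r"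
        using pde[OF x(1)] l[OF x(1)] prof_in[OF x(1)] unfolding x(2) by (simp add: N)
    qed (use d in blast)+
    then show ?thesis using that by blast
  qed
  define Z where "Z = {r\<in>{a<..<b}. u r \<noteq> 0}"
  have "{x\<in>annulus a b. v x \<noteq> 0} = {x. norm x \<in> Z}" using prof_in by (auto simp: Z_def annulus_def)
  moreover have "Z \<subseteq> {0<..}" using a by (auto simp: Z_def)
  ultimately have card: "card (components Z) = m"
    using assms(8) bij_betw_same_card[OF components_norm_vimage[OF assms(1)]]
    unfolding has_nodal_zones_def by metis
  then have fin: "finite (components Z)" using \<open>m \<ge> 1\<close> by (metis card.infinite not_one_le_zero)
  \<comment> \<open>The zones of \<open>v\<close> are the shells over the nodal intervals of \<open>u\<close>, so \<open>u\<close> has \<open>m\<close> of these.\<close>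
  interpret lane_emden_profile n p a b u g m
    by unfold_locales (use assms a sol u0 fin card in \<open>auto simp: Z_def\<close>)
  note index = negative_eigenvalue_index[folded N]
  have minus_n: "- real n = - (real DIM('a) - 1)" by (simp add: N)
  note nth = translation_eigenvalue_nth[folded N, unfolded minus_n]
  have "radially_nondegenerate p (annulus a b) v"
    unfolding radially_nondegenerate_def
  proof safe
    fix w x assume w: "linearized_solution p (annulus a b) v w" "radial_on (closure (annulus a b)) w"
      and x: "x \<in> annulus a b" "w x \<noteq> 0"
    obtain \<phi> where \<phi>: "w x = \<phi> (norm x)" if "a \<le> norm x" "norm x \<le> b" for x
      using w(2) unfolding radial_on_def has_profile_on_def cl by blast
    then have \<phi>_in: "w x = \<phi> (norm x)" if "x \<in> annulus a b" for x using that by (auto simp: annulus_def)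
    have C2w: "C2_on (annulus a b) w" and cw: "continuous_on {x. a \<le> norm x \<and> norm x \<le> b} w"
      and pdew: "\<And>x. x \<in> annulus a b \<Longrightarrow> - laplacian w x = p * \<bar>v x\<bar> powr (p - 1) * w x"
      and bdw: "\<And>x. norm x = a \<or> norm x = b \<Longrightarrow> w x = 0"
      using w(1) unfolding linearized_solution_def dirichlet_solution_def cl fr by auto
    obtain \<phi>' \<phi>'' where d: "\<And>r. r \<in> {a<..<b} \<Longrightarrow> (\<phi> has_real_derivative \<phi>' r) (at r) \<and> (\<phi>' has_real_derivative \<phi>'' r) (at r)"
      and l: "\<And>x. x \<in> annulus a b \<Longrightarrow> laplacian w x = \<phi>'' (norm x) + (real DIM('a) - 1) / norm x * \<phi>' (norm x)"
      using radial_profile_derivatives[OF a(1) C2w \<phi>_in] by blast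
    have "radial_eigenvalue DIM('a) p a b u 0"
      unfolding radial_eigenvalue_def
    proof (rule exI[of _ \<phi>], rule exI[of _ \<phi>'], rule exI[of _ \<phi>''], intro conjI ballI)
      show "continuous_on {a..b} \<phi>" by (rule profile_continuous[OF cw \<phi>])
      show "\<phi> a = 0" "\<phi> b = 0"
        using \<phi>[of "a *\<^sub>R e"] \<phi>[of "b *\<^sub>R e"] bdw[of "a *\<^sub>R e"] bdw[of "b *\<^sub>R e"] ne[of a] ne[of b] a by auto
      show "\<exists>r\<in>{a<..<b}. \<phi> r \<noteq> 0"
        using x \<phi>_in[OF x(1)] by (intro bexI[of _ "norm x"]) (auto simp: annulus_def)
      fix r assume r: "r \<in> {a<..<b}"
      then have y: "r *\<^sub>R e \<in> annulus a b" "norm (r *\<^sub>R e) = r" using ne[of r] a by (auto simp: annulus_def)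
      show "(\<phi> has_real_derivative \<phi>' r) (at r)" "(\<phi>' has_real_derivative \<phi>'' r) (at r)" using d[OF r] by blast+
      show "- \<phi>'' r - (real DIM('a) - 1) / r * \<phi>' r = (p * \<bar>u r\<bar> powr (p - 1) + 0 / r\<^sup>2) * \<phi> r"
        using pdew[OF y(1)] l[OF y(1)] prof_in[OF y(1)] \<phi>_in[OF y(1)] unfolding y(2) by simp
    qed
    then show False using zero_not_radial_eigenvalue by (simp add: N)
  qed
  moreover have "degenerate p (annulus a b) v \<longleftrightarrow>
      (\<exists>l\<in>{1..m}. \<exists>j::int. j \<ge> 2 \<and>
         nth_radial_eigenvalue DIM('a) p a b u l
           (- (real_of_int j * (real DIM('a) - 2 + real_of_int j)))) \<or>
      nth_radial_eigenvalue DIM('a) p a b u m (- (real DIM('a) - 1))" (is "?deg \<longleftrightarrow> ?high \<or> ?one")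
  proof
    assume ?deg
    then obtain k :: nat where ev: "radial_eigenvalue DIM('a) p a b u (- (real k * (real DIM('a) - 2 + real k)))"
      using radial_eigenvalue_of_degenerate[where v = v and u = u, OF a prof_in] by blast
    consider "k = 0" | "k = 1" | "k \<ge> 2" by linarith
    then show "?high \<or> ?one"
    proof cases
      case 1
      then show ?thesis using ev zero_not_radial_eigenvalue by (simp add: N)
    next
      case 2
      then have "radial_eigenvalue DIM('a) p a b u (- (real DIM('a) - 1))" using ev by simp
      then show ?thesis using nth by simp
    next
      case 3
      have "- (real k * (real DIM('a) - 2 + real k)) \<le> 0" using assms(1) by simp
      then obtain l where "l \<in> {1..m}" "nth_radial_eigenvalue DIM('a) p a b u l (- (real k * (real DIM('a) - 2 + real k)))"
        using index[OF ev] by blast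
      then show ?thesis using 3 by (intro disjI1 bexI[of _ l] exI[of _ "int k"]) auto
    qed
  next
    have cuo: "continuous_on {a<..<b} u" by (rule continuous_on_subset[OF cu]) auto
    have deg: ?deg if "radial_eigenvalue DIM('a) p a b u (- (real j * (real DIM('a) - 2 + real j)))" for j
      by (rule degenerate_of_radial_eigenvalue[where v = v and u = u, OF assms(1) a \<open>p > 1\<close> prof_in cuo that])
    assume "?high \<or> ?one"
    then show ?deg
    proof
      assume ?high
      then obtain l and j :: int where j: "j \<ge> 2" "nth_radial_eigenvalue DIM('a) p a b u l (- (real_of_int j * (real DIM('a) - 2 + real_of_int j)))"
        by blast
      then show ?deg by (intro deg[of "nat j"]) (auto simp: nth_radial_eigenvalue_def)
    next
      assume ?one
      then have "radial_eigenvalue DIM('a) p a b u (- (real DIM('a) - 1))"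
        by (simp add: nth_radial_eigenvalue_def)
      moreover have "- (real DIM('a) - 1) = - (real 1 * (real DIM('a) - 2 + real 1))" by simp
      ultimately have "radial_eigenvalue DIM('a) p a b u (- (real 1 * (real DIM('a) - 2 + real 1)))" by metis
      then show ?deg by (rule deg)
    qed
  qed
  ultimately show ?thesis by blast
qed

end
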